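(* Let $(Z,d)$ be a complete separable metric space, $\kappa\in\mathcal P(\mathbb N)$, $\mu\in\mathcal P(Z)$, and let $\rho:Z\times Z\to[0,\infty]$ be lower semi-continuous. Assume that $\mu$ satisfies the transport-entropy inequality with cost $\rho$ and constants $a_1,a_2>0$, i.e. for all $\nu_1,\nu_2\in\mathcal P(Z)$, $$\mathcal T_\rho(\nu_1,\nu_2)\le a_1\mathcal H(\nu_1|\mu)+a_2\mathcal H(\nu_2|\mu).$$ Then for all $\Pi_1,\Pi_2\in\mathcal P(\mathcal M_{\mathbb N}(Z))$ such that $\mathbb T_\rho(\Pi_1,\Pi_2)<\infty$, $$\mathbb T_\rho(\Pi_1,\Pi_2)+(a_1+a_2)\,\mathcal H(\lambda|\kappa)\le a_1\mathcal H(\Pi_1|B_{\mu,\kappa})+a_2\mathcal H(\Pi_2|B_{\mu,\kappa}),$$ where $\lambda\in\mathcal P(\mathbb N)$ is the common law of the total mass: $\Pi_i(\{\eta\in\mathcal M_{\mathbb N}(Z):\eta(Z)\in A\})=\lambda(A)$ for $i\in\{1,2\}$ and all $A\subset\mathbb N$.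
   Context: $\mathcal P(E)$ is the set of Borel probability measures on $E$; $\mathbb N=\{0,1,2,\dots\}$. $\mathcal M_{\mathbb N}(Z)=\{\sum_{i=1}^k\delta_{a_i}:k\in\mathbb N,\ a_1,\dots,a_k\in Z\}$ is the space of finite configurations, with the weak topology (Polish). Relative entropy: $\mathcal H(\nu_1|\nu_2)=\int\log\frac{d\nu_1}{d\nu_2}d\nu_1$ if $\nu_1\ll\nu_2$, and $+\infty$ otherwise. For finite measures $\nu_1,\nu_2$ on $Z$, $\mathcal T_\rho(\nu_1,\nu_2)=\inf\int\rho(x,y)\,N(dx\,dy)$, the infimum being over all couplings $N$, i.e. measures on $Z\times Z$ with first marginal $\nu_1$ and second marginal $\nu_2$; $\inf\emptyset=\infty$, so the cost is $\infty$ if $\nu_1(Z)\ne\nu_2(Z)$. For $\Pi_1,\Pi_2\in\mathcal P(\mathcal M_{\mathbb N}(Z))$, $\mathbb T_\rho(\Pi_1,\Pi_2)=\inf\mathbb E[\mathcal T_\rho(\xi_1,\xi_2)]$, the infimum being over all pairs of random configurations with $\xi_1\sim\Pi_1$, $\xi_2\sim\Pi_2$. Finiteness implies that the law $\lambda$ of the total mass is the same under $\Pi_1$ and $\Pi_2$. $B_{\mu,\kappa}$ is the law of $\sum_{i=1}^N\delta_{X_i}$ with $(X_i)_{i\ge1}$ i.i.d. of law $\mu$ and $N\sim\kappa$ independent of $(X_i)$ (empty sum $=0$). Constants in transport-entropy inequalities are allowed to take the value $\infty$, with the convention $0\cdot\infty=0$. *)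

theory Defs
  imports "HOL-Probability.Probability"
begin

text \<open>There is no type-class structure on measures to write \<open>\<delta> (a 0) + \<dots> + \<delta> (a (k - 1))\<close>,
  so the sum is taken setwise.\<close>

definition dirac_sum :: "nat \<Rightarrow> (nat \<Rightarrow> 'z::topological_space) \<Rightarrow> 'z measure" where
  "dirac_sum k a = measure_of UNIV (sets borel) (\<lambda>A. \<Sum>i<k. emeasure (return borel (a i)) A)"

definition configurations :: "'z::topological_space measure set" where
  "configurations = {dirac_sum k a |k a. True}"

text \<open>The weak topology: the coarsest one for which \<open>\<eta> \<mapsto> \<integral> f d\<eta>\<close> is continuous for every bounded
  continuous \<open>f\<close>.\<close>

definition config_topology :: "'z::topological_space measure topology" where
  "config_topology = topology_generated_by
     {{\<eta> \<in> configurations. (LINT z|\<eta>. f z) \<in> U} |(f :: 'z \<Rightarrow> real) U.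
        continuous_on UNIV f \<and> bounded (range f) \<and> open U}"

text \<open>\<open>configurations\<close> with the Borel sets of the weak topology; only the underlying measurable space
  matters.\<close>

definition config_space :: "'z::topological_space measure measure" where
  "config_space = sigma configurations {U. openin config_topology U}"

text \<open>The integral of \<open>ln (d\<nu>\<^sub>1/d\<nu>\<^sub>2)\<close> is its positive part minus its negative part in the extended
  reals. For probability measures the negative part is finite, because \<open>t ln t \<ge> - 1 / e\<close>; the library's
  \<open>KL_divergence\<close> would return 0 where the integral is infinite. The values of \<open>ln\<close> at a density
  0 or \<open>\<infinity>\<close> concern a \<open>\<nu>\<^sub>1\<close>-null set only.\<close>

definition relative_entropy :: "'a measure \<Rightarrow> 'a measure \<Rightarrow> ereal" where
  "relative_entropy \<nu>1 \<nu>2 =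
     (if absolutely_continuous \<nu>2 \<nu>1
      then enn2ereal (\<integral>\<^sup>+ x. ennreal (ln (enn2real (RN_deriv \<nu>2 \<nu>1 x))) \<partial>\<nu>1)
         - enn2ereal (\<integral>\<^sup>+ x. ennreal (- ln (enn2real (RN_deriv \<nu>2 \<nu>1 x))) \<partial>\<nu>1)
      else \<infinity>)"

definition couplings :: "'a measure \<Rightarrow> 'b measure \<Rightarrow> ('a \<times> 'b) measure set" where
  "couplings \<nu>1 \<nu>2 =
     {N. sets N = sets (\<nu>1 \<Otimes>\<^sub>M \<nu>2) \<and> distr N \<nu>1 fst = \<nu>1 \<and> distr N \<nu>2 snd = \<nu>2}"

definition transport_cost :: "('a \<times> 'b \<Rightarrow> ennreal) \<Rightarrow> 'a measure \<Rightarrow> 'b measure \<Rightarrow> ennreal" where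
  "transport_cost \<rho> \<nu>1 \<nu>2 = (INF N\<in>couplings \<nu>1 \<nu>2. \<integral>\<^sup>+ z. \<rho> z \<partial>N)"

text \<open>The infimum of \<open>E[transport_cost \<rho> \<xi>\<^sub>1 \<xi>\<^sub>2]\<close> over all pairs of random configurations of laws
  \<open>\<Pi>\<^sub>1\<close>, \<open>\<Pi>\<^sub>2\<close>. The expectation depends only on the joint law of the pair, so the infimum runs over
  joint laws.\<close>

definition config_transport_cost ::
  "('z::topological_space \<times> 'z \<Rightarrow> ennreal) \<Rightarrow> 'z measure measure \<Rightarrow> 'z measure measure \<Rightarrow> ennreal" where
  "config_transport_cost \<rho> \<Pi>1 \<Pi>2 = transport_cost (\<lambda>(\<xi>1, \<xi>2). transport_cost \<rho> \<xi>1 \<xi>2) \<Pi>1 \<Pi>2"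

text \<open>The law of \<open>\<delta> (X 0) + \<dots> + \<delta> (X (N - 1))\<close> for an i.i.d. sequence \<open>X\<close> of law \<open>\<mu>\<close> and an
  independent \<open>N\<close> of law \<open>\<kappa>\<close>. The map is measurable: see \<open>measurable_dirac_sum\<close> below.\<close>

definition mixed_binomial :: "'z::topological_space measure \<Rightarrow> nat pmf \<Rightarrow> 'z measure measure" where
  "mixed_binomial \<mu> \<kappa> =
     distr (measure_pmf \<kappa> \<Otimes>\<^sub>M (\<Pi>\<^sub>M i\<in>(UNIV :: nat set). \<mu>)) config_space (\<lambda>(n, x). dirac_sum n x)"

definition lower_semicontinuous :: "('a::topological_space \<Rightarrow> 'b::linorder) \<Rightarrow> bool" where
  "lower_semicontinuous f \<longleftrightarrow> (\<forall>c. open {x. c < f x})"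

definition transport_entropy_inequality ::
  "('z::topological_space \<times> 'z \<Rightarrow> ennreal) \<Rightarrow> ereal \<Rightarrow> ereal \<Rightarrow> 'z measure \<Rightarrow> bool" where
  "transport_entropy_inequality \<rho> a1 a2 \<mu> \<longleftrightarrow>
     (\<forall>\<nu>1 \<in> space (prob_algebra borel). \<forall>\<nu>2 \<in> space (prob_algebra borel).
        enn2ereal (transport_cost \<rho> \<nu>1 \<nu>2) \<le> a1 * relative_entropy \<nu>1 \<mu> + a2 * relative_entropy \<nu>2 \<mu>)"

lemma dirac_sum_eq_distr: "dirac_sum k a = distr (count_space {..<k}) borel a"
proof -
  have "(\<Sum>i<k. emeasure (return borel (a i)) A) = emeasure (distr (count_space {..<k}) borel a) A"
    if "A \<in> sets borel" for A
  proof -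
    have "a -` A \<inter> {..<k} = {i \<in> {..<k}. a i \<in> A}" by auto
    moreover have "(\<Sum>i<k. indicator A (a i)) = (of_nat (card {i \<in> {..<k}. a i \<in> A}) :: ennreal)"
      by (simp add: indicator_def Int_def sum.If_cases)
    moreover have "{i \<in> {..<k}. a i \<in> A} \<subseteq> {..<k}" by auto
    ultimately show ?thesis
      using that by (simp add: emeasure_distr emeasure_count_space_finite del: mem_Collect_eq)
  qed
  then have "dirac_sum k a = measure_of UNIV (sets borel) (emeasure (distr (count_space {..<k}) borel a))"
    unfolding dirac_sum_def by (intro measure_of_eq) (auto simp: sets.sigma_sets_eq[of borel, simplified])
  also have "\<dots> = distr (count_space {..<k}) borel a"
    using measure_of_of_measure[of "distr (count_space {..<k}) borel a"] by simp
  finally show ?thesis .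
qed

lemma topspace_config_topology:
  "topspace config_topology = (configurations :: 'z::topological_space measure set)"
proof -
  let ?S = "{{\<eta> \<in> configurations. (LINT z|\<eta>. f z) \<in> U} |(f :: 'z \<Rightarrow> real) U.
        continuous_on UNIV f \<and> bounded (range f) \<and> open U}"
  have "configurations = {\<eta> \<in> configurations. (LINT z|\<eta>. (\<lambda>_ :: 'z. 0 :: real) z) \<in> UNIV}" by simp
  moreover have "continuous_on UNIV (\<lambda>_ :: 'z. 0 :: real)" "bounded (range (\<lambda>_ :: 'z. 0 :: real))"
    by (auto simp: image_constant_conv)
  ultimately have "configurations \<in> ?S"
    using open_UNIV by (intro CollectI exI[of _ "\<lambda>_. 0"] exI[of _ UNIV] conjI)
  moreover have "\<Union> ?S \<subseteq> configurations" by blast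
  ultimately have "\<Union> ?S = configurations" by blast
  then show ?thesis
    unfolding config_topology_def topology_generated_by_topspace .
qed

lemma openin_config_topology_subset: "{U. openin config_topology U} \<subseteq> Pow configurations"
  using openin_subset topspace_config_topology by blast

lemma space_config_space: "space config_space = configurations"
  unfolding config_space_def by (rule space_measure_of[OF openin_config_topology_subset])

lemma sets_config_space: "sets config_space = sigma_sets configurations {U. openin config_topology U}"
  unfolding config_space_def by (rule sets_measure_of[OF openin_config_topology_subset])

lemma continuous_map_dirac_sum:
  "continuous_map euclidean config_topology (dirac_sum k :: (nat \<Rightarrow> 'z::topological_space) \<Rightarrow> _)"
  unfolding config_topology_def
proof (rule continuous_on_generated_topo)
  fix V :: "'z measure set"
  assume "V \<in> {{\<eta> \<in> configurations. (LINT z|\<eta>. f z) \<in> U} |(f :: 'z \<Rightarrow> real) U.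
       continuous_on UNIV f \<and> bounded (range f) \<and> open U}"
  then have "\<exists>(f :: 'z \<Rightarrow> real) U. V = {\<eta> \<in> configurations. (LINT z|\<eta>. f z) \<in> U} \<and> continuous_on UNIV f \<and> open U"
    by blast
  then obtain f :: "'z \<Rightarrow> real" and U where V: "V = {\<eta> \<in> configurations. (LINT z|\<eta>. f z) \<in> U}"
    and f: "continuous_on UNIV f" and U: "open U" by blast
  have [measurable]: "f \<in> borel_measurable borel"
    using f by (rule borel_measurable_continuous_onI)
  have "(LINT z|dirac_sum k a. f z) = (\<Sum>i<k. f (a i))" for a
    by (simp add: dirac_sum_eq_distr integral_distr lebesgue_integral_count_space_finite)
  then have "dirac_sum k -` V = (\<lambda>a. \<Sum>i<k. f (a i)) -` U"
    by (auto simp: V configurations_def)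
  moreover have "continuous_on UNIV (\<lambda>a. \<Sum>i<k. f (a i))"
    by (intro continuous_on_sum continuous_on_compose2[OF f] continuous_on_coordinatewise_then_product
        continuous_on_product_coordinates) auto
  ultimately show "openin euclidean (dirac_sum k -` V \<inter> topspace euclidean)"
    using U by (simp add: open_vimage)
next
  show "dirac_sum k ` topspace euclidean \<subseteq> \<Union> {{\<eta> \<in> configurations. (LINT z|\<eta>. f z) \<in> U} |(f :: 'z \<Rightarrow> real) U.
       continuous_on UNIV f \<and> bounded (range f) \<and> open U}"
    using topspace_config_topology unfolding config_topology_def topology_generated_by_topspace
    by (auto simp: configurations_def)
qed

lemma measurable_dirac_sum:
  fixes \<mu> :: "'z::second_countable_topology measure"
  assumes "sets \<mu> = sets borel"
  shows "(\<lambda>(n, x). dirac_sum n x) \<in> measurable (measure_pmf \<kappa> \<Otimes>\<^sub>M (\<Pi>\<^sub>M i\<in>(UNIV :: nat set). \<mu>)) config_space"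
proof -
  have "dirac_sum n \<in> measurable (borel :: (nat \<Rightarrow> 'z) measure) config_space" for n
    unfolding config_space_def
  proof (rule measurable_measure_of)
    show "{U. openin config_topology U} \<subseteq> Pow configurations"
      by (rule openin_config_topology_subset)
  next
    fix U :: "'z measure set" assume "U \<in> {U. openin config_topology U}"
    then have "openin euclidean {x \<in> topspace euclidean. dirac_sum n x \<in> U}"
      using openin_continuous_map_preimage[OF continuous_map_dirac_sum] by blast
    then show "dirac_sum n -` U \<inter> space borel \<in> sets borel" by (simp add: vimage_def)
  qed (auto simp: configurations_def)
  moreover have "sets (\<Pi>\<^sub>M i\<in>(UNIV :: nat set). \<mu>) = sets (borel :: (nat \<Rightarrow> 'z) measure)"
    using sets_PiM_cong[OF refl, of UNIV "\<lambda>_. \<mu>" "\<lambda>_. borel"] assms sets_PiM_equal_borel by auto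
  ultimately have *: "dirac_sum n \<in> measurable (\<Pi>\<^sub>M i\<in>(UNIV :: nat set). \<mu>) config_space" for n
    using measurable_cong_sets by blast
  have "(\<lambda>(n, x). dirac_sum n x) \<in> measurable (count_space UNIV \<Otimes>\<^sub>M (\<Pi>\<^sub>M i\<in>(UNIV :: nat set). \<mu>)) config_space"
    using * by (intro measurable_pair_measure_countable1) auto
  moreover have "sets (measure_pmf \<kappa> \<Otimes>\<^sub>M (\<Pi>\<^sub>M i\<in>(UNIV :: nat set). \<mu>))
      = sets (count_space UNIV \<Otimes>\<^sub>M (\<Pi>\<^sub>M i\<in>(UNIV :: nat set). \<mu>))"
    by (intro sets_pair_measure_cong) auto
  ultimately show ?thesis using measurable_cong_sets by blast
qed

end

theory Submission
  imports Defs
begin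

text \<open>The inequality is first tensorized to \<open>\<mu>\<^sup>\<infinity>\<close> with cost \<open>\<Sum>i<n. \<rho> (x i, y i)\<close>, then pushed forward by
  \<open>dirac_sum n\<close>, and finally mixed over \<open>n\<close>: conditioning on the total mass splits the relative entropy
  into that of the mass law plus the mean of the conditional ones, which produces the term
  \<open>(a1 + a2) * relative_entropy l \<kappa>\<close>.

  The tensorization step glues couplings of conditional laws. Instead of selecting optimal couplings
  measurably, the conditional laws are averaged over the cells of a finite partition of the first
  factor. This does not increase the entropy (Jensen), and only countably many couplings have to be
  chosen. Refining the partition gives couplings whose marginals eventually agree with the target
  on every finite Boolean combination of basic open sets. A cluster point of these couplings, turned
  into a measure by the Daniell-Kolmogorov theorem, is a coupling of the target laws, and its cost is
  controlled because a lower semi-continuous cost is an increasing limit of functions that depend on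
  finitely many basic open sets.\<close>

text \<open>A limit of couplings would usually come from tightness and weak convergence. Here the
  marginals of the approximating couplings are only known to stabilize set by set, so the cluster
  point is taken over the values of all sets at once; it is a limit along a filter and only finitely
  additive. Countable additivity is recovered after coding a point by its memberships in a countable
  basis: the joint law lives first on pairs of 0-1 sequences, and its two marginals, images of true
  laws, force almost every sequence to be the code of a point. The infinite product keeps the
  induction uniform: splitting off one coordinate of \<open>\<mu>\<^sup>\<infinity>\<close> leaves
  the same measure, and only the number of coordinates in the cost grows. Mixing works because
  finite cost forces equal total masses, so both laws have the same mass law and are coupled level
  by level. The entropy of the mass law is released once by each chain rule, with weight
  \<open>a1\<close> and with weight \<open>a2\<close>; hence the constant
  \<open>a1 + a2\<close>.\<close>

section \<open>Entropy of densities\<close>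

text \<open>The summand \<open>1 - t\<close> integrates to 0 against a probability density; it makes the integrand
  nonnegative, so that entropies can be handled as \<open>ennreal\<close>-valued integrals.\<close>

definition entropy_fun :: "real \<Rightarrow> real" where
  "entropy_fun t = t * ln t - t + 1"

lemma entropy_fun_0 [simp]: "entropy_fun 0 = 1" and entropy_fun_1 [simp]: "entropy_fun 1 = 0"
  by (simp_all add: entropy_fun_def)

lemma borel_measurable_entropy_fun [measurable]: "entropy_fun \<in> borel_measurable borel"
  unfolding entropy_fun_def by measurable

text \<open>Convexity: \<open>ln s\<close> is the derivative of \<open>entropy_fun\<close> at
  \<open>s\<close>, so this is the tangent line lying below the graph; it reduces to
  \<open>ln x \<le> x - 1\<close> at \<open>x = s / t\<close>. The case \<open>s = 1\<close> gives
  nonnegativity, and \<open>s\<close> equal to a mean gives Jensen's inequality.\<close>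

lemma entropy_fun_tangent:
  assumes "0 \<le> t" "0 < s"
  shows "entropy_fun s + ln s * (t - s) \<le> entropy_fun t"
proof (cases "t = 0")
  case True
  then show ?thesis using assms by (simp add: entropy_fun_def algebra_simps)
next
  case False
  then have t: "0 < t" using assms by simp
  have "ln (s / t) \<le> s / t - 1" using t assms by (intro ln_le_minus_one) simp
  then have "t * ln (s / t) \<le> t * (s / t - 1)" using t by (intro mult_left_mono) auto
  then show ?thesis using t assms by (simp add: entropy_fun_def ln_div algebra_simps)
qed

lemma entropy_fun_nonneg: "0 \<le> t \<Longrightarrow> 0 \<le> entropy_fun t"
  using entropy_fun_tangent[of t 1] by simp

text \<open>Source of every chain rule below: the last summand is affine in \<open>t\<close> and
  vanishes on integration when \<open>t\<close> is a probability density. The boundary cases hold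
  because every logarithm occurs with its argument as a factor.\<close>

lemma entropy_fun_mult:
  assumes "0 \<le> s" "0 \<le> t"
  shows "entropy_fun (s * t) = entropy_fun s + s * entropy_fun t + s * ln s * (t - 1)"
proof (cases "s = 0 \<or> t = 0")
  case False
  then show ?thesis using assms by (simp add: entropy_fun_def ln_mult algebra_simps)
qed (auto simp: entropy_fun_def algebra_simps)

definition density_entropy :: "'a measure \<Rightarrow> ('a \<Rightarrow> real) \<Rightarrow> ennreal" where
  "density_entropy M f = (\<integral>\<^sup>+ x. ennreal (entropy_fun (f x)) \<partial>M)"

text \<open>Chain rule on one fibre, \<open>s\<close> being the marginal density there and
  \<open>t\<close> the conditional one. An infinite right-hand side is trivial, and a finite one
  makes \<open>entropy_fun (s * t x)\<close> integrable, so that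
  \<open>s * entropy_fun (t x)\<close> is obtained by subtraction among real integrals.\<close>

lemma density_entropy_mult_ge:
  assumes "prob_space M" and [measurable]: "t \<in> borel_measurable M" and t: "\<And>x. 0 \<le> t x"
    and t1: "(\<integral>\<^sup>+ x. ennreal (t x) \<partial>M) = 1" and s: "0 \<le> s"
  shows "ennreal (entropy_fun s) + ennreal s * density_entropy M t \<le> density_entropy M (\<lambda>x. s * t x)"
proof (cases "density_entropy M (\<lambda>x. s * t x) = \<infinity>")
  case False
  interpret prob_space M by fact
  have 1: "integrable M (\<lambda>x. entropy_fun (s * t x))"
    using False s t by (intro integrableI_nonneg) (auto simp: density_entropy_def entropy_fun_nonneg less_top)
  have 2: "integrable M t" "(LINT x|M. t x) = 1"
    using t1 t by (auto intro!: integrableI_nonneg simp: integral_eq_nn_integral)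
  have eq: "s * entropy_fun (t x) = entropy_fun (s * t x) - entropy_fun s - s * ln s * (t x - 1)" for x
    using entropy_fun_mult[OF s t[of x]] by simp
  have 3: "integrable M (\<lambda>x. s * entropy_fun (t x))"
    unfolding eq using 1 2 by auto
  have 4: "(LINT x|M. s * entropy_fun (t x)) = (LINT x|M. entropy_fun (s * t x)) - entropy_fun s"
    unfolding eq using 1 2 by (simp add: prob_space)
  have "ennreal s * density_entropy M t = (\<integral>\<^sup>+ x. ennreal (s * entropy_fun (t x)) \<partial>M)"
    unfolding density_entropy_def using s t by (simp add: nn_integral_cmult[symmetric] ennreal_mult entropy_fun_nonneg)
  also have "\<dots> = ennreal (LINT x|M. s * entropy_fun (t x))"
    using 3 s t by (intro nn_integral_eq_integral) (auto simp: entropy_fun_nonneg)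
  finally have 5: "ennreal s * density_entropy M t = ennreal (LINT x|M. s * entropy_fun (t x))" .
  have 6: "density_entropy M (\<lambda>x. s * t x) = ennreal (LINT x|M. entropy_fun (s * t x))"
    unfolding density_entropy_def using 1 s t by (intro nn_integral_eq_integral) (auto simp: entropy_fun_nonneg)
  have "0 \<le> (LINT x|M. s * entropy_fun (t x))" using s t by (intro Bochner_Integration.integral_nonneg) (auto simp: entropy_fun_nonneg)
  then show ?thesis unfolding 5 6 using 4 entropy_fun_nonneg[OF s] by (simp add: ennreal_plus[symmetric] del: ennreal_plus)
qed simp

text \<open>Jensen's inequality for a measure of mass \<open>q\<close> under which \<open>t\<close>
  has mean \<open>W / q\<close>. The mass is kept general because the averages below run over cells
  weighted by a density. The tangent is taken at the mean, where its linear part integrates to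
  0.\<close>

lemma entropy_fun_jensen:
  assumes [measurable]: "t \<in> borel_measurable M" and t: "\<And>x. 0 \<le> t x"
    and q: "emeasure M (space M) = ennreal q" "0 < q"
    and W: "(\<integral>\<^sup>+ x. ennreal (t x) \<partial>M) = ennreal W" "0 \<le> W"
  shows "ennreal (q * entropy_fun (W / q)) \<le> (\<integral>\<^sup>+ x. ennreal (entropy_fun (t x)) \<partial>M)"
proof -
  interpret finite_measure M using q by (intro finite_measureI) simp
  have mq: "measure M (space M) = q" using q by (simp add: measure_def)
  show ?thesis
  proof (cases "(\<integral>\<^sup>+ x. ennreal (entropy_fun (t x)) \<partial>M) = \<infinity>")
    case False
    have 1: "integrable M (\<lambda>x. entropy_fun (t x))"
      using False t by (intro integrableI_nonneg) (auto simp: entropy_fun_nonneg less_top)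
    have 2: "integrable M t" "(LINT x|M. t x) = W"
      using W t by (auto intro!: integrableI_nonneg simp: integral_eq_nn_integral)
    have 3: "(\<integral>\<^sup>+ x. ennreal (entropy_fun (t x)) \<partial>M) = ennreal (LINT x|M. entropy_fun (t x))"
      using 1 t by (intro nn_integral_eq_integral) (auto simp: entropy_fun_nonneg)
    have "q * entropy_fun (W / q) \<le> (LINT x|M. entropy_fun (t x))"
    \<comment> \<open>No tangent exists at 0, but then \<open>t\<close> vanishes almost everywhere
      and both sides equal \<open>q\<close>.\<close>
    proof (cases "W = 0")
      case True
      then have "AE x in M. t x = 0"
        using W t by (auto simp: nn_integral_0_iff_AE ennreal_eq_0_iff elim!: eventually_mono intro: antisym)
      then have "(LINT x|M. entropy_fun (t x)) = (LINT x|M. 1)" by (intro integral_cong_AE) auto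
      then show ?thesis using True mq by simp
    next
      case False
      then have s: "0 < W / q" using W q by simp
      have "(LINT x|M. entropy_fun (W/q) + ln (W/q) * (t x - W/q)) \<le> (LINT x|M. entropy_fun (t x))"
        using 1 2 t s by (intro integral_mono entropy_fun_tangent) auto
      also have "(LINT x|M. entropy_fun (W/q) + ln (W/q) * (t x - W/q)) = q * entropy_fun (W/q)"
        using 2 q by (simp add: mq)
      finally show ?thesis .
    qed
    then show ?thesis by (simp add: 3 ennreal_leI)
  qed simp
qed

text \<open>The bound \<open>- t ln t \<le> 1 - t\<close> keeps the negative part finite, so the
  difference in \<open>relative_entropy\<close> is never infinity minus infinity, and the summand
  \<open>1 - t\<close> of \<open>entropy_fun\<close> integrates to 0 against a probability
  density.\<close>

lemma relative_entropy_density: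
  assumes "prob_space M" and [measurable]: "f \<in> borel_measurable M" and f: "\<And>x. 0 \<le> f x"
    and f1: "(\<integral>\<^sup>+ x. ennreal (f x) \<partial>M) = 1"
  shows "relative_entropy (density M (\<lambda>x. ennreal (f x))) M = enn2ereal (density_entropy M f)"
proof -
  interpret prob_space M by fact
  let ?N = "density M (\<lambda>x. ennreal (f x))"
  have "AE x in M. ennreal (f x) = RN_deriv M ?N x" by (rule RN_deriv_unique) auto
  then have ae: "AE x in M. enn2real (RN_deriv M ?N x) = f x"
    using f by (auto elim!: eventually_mono) (metis enn2real_ennreal)
  define pos neg where "pos = (\<integral>\<^sup>+ x. ennreal (f x) * ennreal (ln (f x)) \<partial>M)"
    and "neg = (\<integral>\<^sup>+ x. ennreal (f x) * ennreal (- ln (f x)) \<partial>M)"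
  have p: "(\<integral>\<^sup>+ x. ennreal (ln (enn2real (RN_deriv M ?N x))) \<partial>?N) = pos"
    unfolding pos_def by (subst nn_integral_density) (use ae in \<open>auto intro!: nn_integral_cong_AE elim!: eventually_mono\<close>)
  have n: "(\<integral>\<^sup>+ x. ennreal (- ln (enn2real (RN_deriv M ?N x))) \<partial>?N) = neg"
    unfolding neg_def by (subst nn_integral_density) (use ae in \<open>auto intro!: nn_integral_cong_AE elim!: eventually_mono\<close>)
  have "ennreal (f x) * ennreal (- ln (f x)) \<le> 1" for x
  proof (cases "0 < f x")
    case True
    have "- (f x * ln (f x)) \<le> 1 - f x" using entropy_fun_nonneg[OF f[of x]] by (simp add: entropy_fun_def)
    then have "f x * (- ln (f x)) \<le> 1" using f[of x] by (simp add: algebra_simps) 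
    then show ?thesis using f[of x] by (cases "0 \<le> - ln (f x)") (auto simp: ennreal_mult[symmetric] ennreal_neg)
  qed (use f[of x] in \<open>auto simp: ennreal_neg\<close>)
  then have "neg \<le> (\<integral>\<^sup>+ x. 1 \<partial>M)" unfolding neg_def by (intro nn_integral_mono)
  then have neg: "neg < \<infinity>" by (simp add: emeasure_space_1 order_le_less_trans)
  \<comment> \<open>Pointwise, \<open>entropy_fun t\<close> plus the negative part of
    \<open>t ln t\<close> plus \<open>t\<close> equals the positive part of \<open>t ln t\<close>
    plus 1. Arranged without subtraction, this can be integrated in \<open>ennreal\<close> even when
    the entropy is infinite.\<close>
  have "density_entropy M f + neg + 1 = (\<integral>\<^sup>+ x. ennreal (entropy_fun (f x)) + ennreal (f x) * ennreal (- ln (f x)) + ennreal (f x) \<partial>M)"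
    unfolding density_entropy_def neg_def by (simp add: nn_integral_add f1[symmetric])
  also have "\<dots> = (\<integral>\<^sup>+ x. ennreal (f x) * ennreal (ln (f x)) + 1 \<partial>M)"
  proof (rule nn_integral_cong)
    fix x
    show "ennreal (entropy_fun (f x)) + ennreal (f x) * ennreal (- ln (f x)) + ennreal (f x)
        = ennreal (f x) * ennreal (ln (f x)) + 1"
    proof (cases "0 \<le> ln (f x)")
      case True
      have "ennreal (entropy_fun (f x)) + ennreal (f x) = ennreal (f x * ln (f x) + 1)"
        using f[of x] entropy_fun_nonneg[OF f[of x]] by (simp add: ennreal_plus[symmetric] del: ennreal_plus) (simp add: entropy_fun_def)
      also have "\<dots> = ennreal (f x) * ennreal (ln (f x)) + 1"
        using True f[of x] by (simp add: ennreal_mult[symmetric])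
      finally show ?thesis using True by (simp add: ennreal_neg)
    next
      case False
      then have "ennreal (f x) * ennreal (- ln (f x)) = ennreal (- (f x * ln (f x)))" 
        using f[of x] by (simp add: ennreal_mult[symmetric])
      moreover have "0 \<le> - (f x * ln (f x))" using False f[of x] by (simp add: mult_nonneg_nonpos)
      ultimately have "ennreal (entropy_fun (f x)) + ennreal (f x) * ennreal (- ln (f x)) + ennreal (f x) = ennreal 1"
        using f[of x] entropy_fun_nonneg[OF f[of x]] by (simp add: ennreal_plus[symmetric] del: ennreal_plus ennreal_1) (simp add: entropy_fun_def)
      then show ?thesis using False by (simp add: ennreal_neg)
    qed
  qed
  also have "\<dots> = pos + 1" unfolding pos_def by (simp add: nn_integral_add emeasure_space_1)
  finally have "1 + (density_entropy M f + neg) = 1 + pos" by (simp add: ac_simps)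
  then have "pos = density_entropy M f + neg" by (subst (asm) ennreal_add_left_cancel) auto
  moreover have "absolutely_continuous M ?N"
    by (rule absolutely_continuousI_density) auto
  ultimately show ?thesis unfolding relative_entropy_def p n using neg
    by (cases "density_entropy M f"; cases neg) (auto simp: enn2ereal_ennreal plus_ennreal.rep_eq top_ennreal.rep_eq)
qed

text \<open>\<open>enn2real\<close> alters the Radon-Nikodym derivative only where it is infinite, a
  null set because \<open>N\<close> is sigma-finite.\<close>

lemma absolutely_continuous_real_density:
  assumes "prob_space M" "prob_space N" "sets N = sets M" "absolutely_continuous M N"
  obtains f where "f \<in> borel_measurable M" "\<And>x. (0 :: real) \<le> f x"
    "N = density M (\<lambda>x. ennreal (f x))" "(\<integral>\<^sup>+ x. ennreal (f x) \<partial>M) = 1"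
proof -
  interpret M: prob_space M by fact
  interpret N: prob_space N by fact
  define f where "f x = enn2real (RN_deriv M N x)" for x
  have [measurable]: "f \<in> borel_measurable M" unfolding f_def by measurable
  have "AE x in M. RN_deriv M N x \<noteq> \<infinity>"
    by (rule M.RN_deriv_finite) (use assms N.sigma_finite_measure_axioms in auto)
  then have "AE x in M. ennreal (f x) = RN_deriv M N x"
    by (rule eventually_mono) (simp add: f_def less_top)
  then have "density M (\<lambda>x. ennreal (f x)) = density M (RN_deriv M N)"
    by (intro density_cong) auto
  also have "\<dots> = N" using assms by (intro M.density_RN_deriv)
  finally have N: "N = density M (\<lambda>x. ennreal (f x))" ..
  have "(\<integral>\<^sup>+ x. ennreal (f x) \<partial>M) = (\<integral>\<^sup>+ x. ennreal (f x) * indicator (space M) x \<partial>M)"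
    by (intro nn_integral_cong) simp
  also have "\<dots> = emeasure (density M (\<lambda>x. ennreal (f x))) (space M)"
    by (simp add: emeasure_density)
  also have "\<dots> = emeasure N (space M)" by (simp only: N[symmetric])
  also have "\<dots> = 1"
    using N.emeasure_space_1 sets_eq_imp_space_eq[OF assms(3)] by simp
  finally have "(\<integral>\<^sup>+ x. ennreal (f x) \<partial>M) = 1" .
  moreover have "0 \<le> f x" for x by (simp add: f_def)
  ultimately show ?thesis using that[of f] N by simp
qed

lemma relative_entropy_finite_density:
  assumes "prob_space M" "prob_space N" "sets N = sets M" "relative_entropy N M \<noteq> \<infinity>"
  obtains f where "f \<in> borel_measurable M" "\<And>x. (0 :: real) \<le> f x"
    "N = density M (\<lambda>x. ennreal (f x))" "(\<integral>\<^sup>+ x. ennreal (f x) \<partial>M) = 1"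
    "relative_entropy N M = enn2ereal (density_entropy M f)"
proof -
  have "absolutely_continuous M N" using assms(4) by (auto simp: relative_entropy_def split: if_splits)
  then obtain f where f: "f \<in> borel_measurable M" "\<And>x. (0 :: real) \<le> f x"
    "N = density M (\<lambda>x. ennreal (f x))" "(\<integral>\<^sup>+ x. ennreal (f x) \<partial>M) = 1"
    using absolutely_continuous_real_density[OF assms(1-3)] by blast
  show ?thesis using that[OF f] relative_entropy_density[OF assms(1) f(1,2,4)] f(3) by simp
qed

section \<open>Limits of couplings\<close>

text \<open>Tychonoff's theorem for a power of the unit interval. The index type will be all sets of
  pairs, for which no convergent subsequence need exist; hence a filter \<open>G\<close> finer than
  \<open>sequentially\<close>.\<close>

lemma pointwise_cluster_point:
  fixes f :: "nat \<Rightarrow> 'i \<Rightarrow> real"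
  assumes "\<And>k i. f k i \<in> {0..1}"
  obtains G L where "G \<le> sequentially" "G \<noteq> bot" "\<And>i. ((\<lambda>k. f k i) \<longlongrightarrow> L i) G"
proof -
  let ?K = "PiE UNIV (\<lambda>_. {0..1}) :: ('i \<Rightarrow> real) set"
  have "compactin (product_topology (\<lambda>i. euclidean) UNIV) ?K"
    unfolding compactin_PiE by simp
  then have "compact ?K" by (simp add: euclidean_product_topology)
  moreover have "filtermap f sequentially \<noteq> bot" by (simp add: filtermap_bot_iff)
  moreover have "eventually (\<lambda>x. x \<in> ?K) (filtermap f sequentially)"
    using assms by (intro always_eventually[THEN eventually_filtermap[THEN iffD2]]) (auto simp: PiE_iff)
  ultimately obtain L where L: "inf (nhds L) (filtermap f sequentially) \<noteq> bot"
    unfolding compact_filter by blast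
  \<comment> \<open>Concentrates on the indices \<open>k\<close> with \<open>f k\<close> close to
    \<open>L\<close>. It is nontrivial because \<open>L\<close> is a cluster point: every
    neighbourhood of \<open>L\<close> is visited by arbitrarily late \<open>f k\<close>.\<close>
  define G where "G = inf sequentially (filtercomap f (nhds L))"
  have "G \<noteq> bot"
  proof
    assume "G = bot"
    then obtain Q R where QR: "eventually Q sequentially" "eventually R (filtercomap f (nhds L))"
      "\<And>n. Q n \<Longrightarrow> R n \<Longrightarrow> False"
      unfolding G_def trivial_limit_def eventually_inf by blast
    then obtain P where P: "eventually P (nhds L)" "\<And>n. P (f n) \<Longrightarrow> R n"
      unfolding eventually_filtercomap by blast
    have "eventually (\<lambda>x. \<not> P x) (filtermap f sequentially)"
      unfolding eventually_filtermap using QR(1) by eventually_elim (use QR P in blast)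
    then have "eventually (\<lambda>x. False) (inf (nhds L) (filtermap f sequentially))"
      unfolding eventually_inf using P(1) by blast
    with L show False by (simp add: trivial_limit_def)
  qed
  moreover have "((\<lambda>k. f k i) \<longlongrightarrow> L i) G" for i
  proof -
    have "filterlim f (nhds L) G"
      unfolding G_def by (rule filterlim_mono[OF filterlim_filtercomap]) auto
    then show ?thesis
    proof (intro topological_tendstoI)
      fix S :: "real set" assume S: "open S" "L i \<in> S" and f: "(f \<longlongrightarrow> L) G"
      have "open ((\<lambda>x :: 'i \<Rightarrow> real. x i) -` S)"
        using S by (intro open_vimage continuous_on_product_coordinates) auto
      from topological_tendstoD[OF f this] show "eventually (\<lambda>k. f k i \<in> S) G" using S by simp
    qed
  qed
  ultimately show ?thesis using that[of G L] by (simp add: G_def)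
qed

text \<open>Since every coordinate of \<open>code\<close> takes finitely many values, finite additivity of \<open>L\<close> is enough
  to obtain genuine finite-dimensional laws.\<close>

lemma finitely_additive_kolmogorov:
  fixes code :: "'w \<Rightarrow> nat \<Rightarrow> 'c::polish_space" and L :: "'w set \<Rightarrow> real"
  assumes space: "space M = UNIV"
    and code [measurable]: "\<And>i. (\<lambda>w. code w i) \<in> borel_measurable M"
    and fin: "\<And>i. finite (range (\<lambda>w. code w i))"
    and L0: "\<And>A. 0 \<le> L A" and L1: "L UNIV = 1"
    and L_add: "\<And>A B. A \<in> sets M \<Longrightarrow> B \<in> sets M \<Longrightarrow> A \<inter> B = {} \<Longrightarrow> L (A \<union> B) = L A + L B"
  obtains K where "prob_space K" "sets K = sets (PiM UNIV (\<lambda>_. borel))"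
    "\<And>J X. finite J \<Longrightarrow> X \<in> sets (PiM J (\<lambda>_. borel)) \<Longrightarrow>
       emeasure K {\<omega>. restrict \<omega> J \<in> X} = ennreal (L {w. restrict (code w) J \<in> X})"
proof -
  define cJ where "cJ J w = restrict (code w) J" for J w
  define R where "R J = range (cJ J)" for J
  have finR: "finite (R J)" if "finite J" for J
  proof (rule finite_subset)
    show "R J \<subseteq> PiE J (\<lambda>i. range (\<lambda>w. code w i))" by (auto simp: R_def cJ_def)
    show "finite (PiE J (\<lambda>i. range (\<lambda>w. code w i)))" using that fin by (intro finite_PiE) auto
  qed
  have cJ_meas [measurable]: "cJ J \<in> M \<rightarrow>\<^sub>M PiM J (\<lambda>_. borel)" for J
    unfolding cJ_def by measurable
  have L_empty: "L {} = 0" using L_add[of "{}" "{}"] by simp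
  have L_sum: "L (\<Union>r\<in>T. A r) = (\<Sum>r\<in>T. L (A r))"
    if "finite T" "disjoint_family_on A T" "\<And>r. r \<in> T \<Longrightarrow> A r \<in> sets M" for T and A :: "(nat \<Rightarrow> 'c) \<Rightarrow> 'w set"
    using that
  proof (induction T rule: finite_induct)
    case (insert r T)
    have "A r \<inter> (\<Union>r\<in>T. A r) = {}"
      using insert by (auto simp: disjoint_family_on_def)
    then have "L (A r \<union> (\<Union>r\<in>T. A r)) = L (A r) + L (\<Union>r\<in>T. A r)"
      using insert by (intro L_add) auto
    moreover have "disjoint_family_on A T"
      using insert(4) by (auto simp: disjoint_family_on_def)
    ultimately show ?case using insert by simp
  qed (simp add: L_empty)
  have sing: "{r} \<in> sets (PiM J (\<lambda>_. borel :: 'c measure))" if "finite J" "r \<in> R J" for J r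
  proof -
    have "{r} = PiE J (\<lambda>i. {r i})" 
      using that(2) by (subst PiE_singleton) (auto simp: R_def cJ_def)
    also have "\<dots> \<in> sets (PiM J (\<lambda>_. borel :: 'c measure))" using that by (intro sets_PiM_I_finite) auto
    finally show ?thesis .
  qed
  have fib: "{w. cJ J w = r} \<in> sets M" if "finite J" "r \<in> R J" for J r
    using measurable_sets[OF cJ_meas sing[OF that]] space by (auto simp: vimage_def)
  \<comment> \<open>An event about the coordinates in \<open>J\<close> is a finite disjoint union of
    fibres, since \<open>R J\<close> is finite; finite additivity thus determines its value from the
    atoms.\<close>
  have L_fib: "L {w. cJ J w \<in> X} = (\<Sum>r\<in>R J \<inter> X. L {w. cJ J w = r})" if "finite J" for J X
  proof -
    have "{w. cJ J w \<in> X} = (\<Union>r\<in>R J \<inter> X. {w. cJ J w = r})" by (auto simp: R_def)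
    then show ?thesis
      using that finR[OF that] fib[OF that] by (simp only:) (intro L_sum, auto simp: disjoint_family_on_def)
  qed
  \<comment> \<open>A finite sum of weighted point masses, hence countably additive; the identity
    map only replaces the power set of \<open>R J\<close> by the product sigma-algebra.\<close>
  define P where "P J = distr (point_measure (R J) (\<lambda>r. ennreal (L {w. cJ J w = r}))) (PiM J (\<lambda>_. borel :: 'c measure)) (\<lambda>r. r)" for J
  have sets_P: "sets (P J) = sets (PiM J (\<lambda>_. borel))" for J by (simp add: P_def)
  have R_sub: "R J \<subseteq> space (PiM J (\<lambda>_. borel))" for J by (auto simp: R_def cJ_def space_PiM)
  have P_eq: "emeasure (P J) X = ennreal (L {w. cJ J w \<in> X})" if "finite J" "X \<in> sets (PiM J (\<lambda>_. borel))" for J X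
  proof -
    have "(\<lambda>r. r) \<in> point_measure (R J) (\<lambda>r. ennreal (L {w. cJ J w = r})) \<rightarrow>\<^sub>M PiM J (\<lambda>_. borel :: 'c measure)"
      using R_sub by (auto simp: measurable_def space_point_measure sets_point_measure)
    then have "emeasure (P J) X = emeasure (point_measure (R J) (\<lambda>r. ennreal (L {w. cJ J w = r}))) (R J \<inter> X)"
      unfolding P_def using that by (subst emeasure_distr) (auto simp: space_point_measure Int_commute)
    also have "\<dots> = (\<Sum>r\<in>R J \<inter> X. ennreal (L {w. cJ J w = r}))"
      using finR that by (intro emeasure_point_measure_finite) auto
    also have "\<dots> = ennreal (L {w. cJ J w \<in> X})"
      using L0 that by (simp add: L_fib)
    finally show ?thesis .
  qed
  \<comment> \<open>Consistency: evaluated by \<open>P_eq\<close>, both sides are \<open>L\<close>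
    of the same event about the code, as restricting to \<open>H\<close> and then to
    \<open>J\<close> is restricting to \<open>J\<close>.\<close>
  interpret polish_projective "UNIV :: nat set" P
  proof (intro polish_projective.intro projective_family.intro)
    fix J H :: "nat set" assume JH: "J \<subseteq> H" "finite H"
    then have "finite J" by (auto intro: finite_subset)
    show "P J = distr (P H) (PiM J (\<lambda>_. borel)) (\<lambda>f. restrict f J)"
    proof (rule measure_eqI)
      show "sets (P J) = sets (distr (P H) (PiM J (\<lambda>_. borel)) (\<lambda>f. restrict f J))" by (simp add: sets_P)
      fix X assume "X \<in> sets (P J)"
      then have X: "X \<in> sets (PiM J (\<lambda>_. borel :: 'c measure))" by (simp add: sets_P)
      have r: "(\<lambda>f. restrict f J) \<in> P H \<rightarrow>\<^sub>M PiM J (\<lambda>_. borel :: 'c measure)"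
        using measurable_restrict_subset[OF JH(1), of "\<lambda>_. borel :: 'c measure"]
        by (simp cong: measurable_cong_sets add: sets_P)
      have "emeasure (distr (P H) (PiM J (\<lambda>_. borel)) (\<lambda>f. restrict f J)) X
          = emeasure (P H) ((\<lambda>f. restrict f J) -` X \<inter> space (P H))"
        using r X by (intro emeasure_distr)
      also have "\<dots> = ennreal (L {w. cJ H w \<in> ((\<lambda>f. restrict f J) -` X \<inter> space (P H))})"
        using JH measurable_sets[OF r X] by (intro P_eq) (auto simp: sets_P)
      also have "{w. cJ H w \<in> ((\<lambda>f. restrict f J) -` X \<inter> space (P H))} = {w. cJ J w \<in> X}"
        using JH sets_eq_imp_space_eq[OF sets_P[of H]] by (auto simp: cJ_def space_PiM restrict_restrict Int_absorb1 Int_absorb2)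
      also have "ennreal (L \<dots>) = emeasure (P J) X" by (rule P_eq[OF \<open>finite J\<close> X, symmetric])
      finally show "emeasure (P J) X = emeasure (distr (P H) (PiM J (\<lambda>_. borel)) (\<lambda>f. restrict f J)) X" ..
    qed
  next
    fix J :: "nat set" assume J: "finite J"
    have "{w. cJ J w \<in> space (PiM J (\<lambda>_. borel))} = UNIV" by (auto simp: cJ_def space_PiM)
    then have "emeasure (P J) (space (PiM J (\<lambda>_. borel))) = 1"
      using P_eq[OF J, of "space (PiM J (\<lambda>_. borel))"] L1 by simp
    then show "prob_space (P J)"
      by (intro prob_spaceI) (simp only: sets_eq_imp_space_eq[OF sets_P])
  qed
  show ?thesis
  proof
    show "prob_space lim" by (rule P.prob_space_axioms)
    show "sets lim = sets (PiM UNIV (\<lambda>_. borel))" by simp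
    fix J and X :: "(nat \<Rightarrow> 'c) set" assume JX: "finite J" "X \<in> sets (PiM J (\<lambda>_. borel))"
    have "{\<omega>. restrict \<omega> J \<in> X} = prod_emb UNIV (\<lambda>_. borel) J X" by (auto simp: prod_emb_def)
    then show "emeasure lim {\<omega>. restrict \<omega> J \<in> X} = ennreal (L {w. restrict (code w) J \<in> X})"
      using emeasure_lim_emb[OF _ JX] P_eq[OF JX] by (simp add: cJ_def)
  qed
qed

section \<open>Basis codes and lower semi-continuous costs\<close>

lemma borel_measurable_lower_semicontinuous:
  fixes f :: "'a::topological_space \<Rightarrow> ennreal"
  assumes "lower_semicontinuous f"
  shows "f \<in> borel_measurable borel"
  by (rule borel_measurableI_greater) (use assms in \<open>auto simp: lower_semicontinuous_def\<close>)

lemma borel_measurable_fst_snd [measurable]: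
  "fst \<in> borel_measurable (borel :: ('a::topological_space \<times> 'b::topological_space) measure)"
  "snd \<in> borel_measurable (borel :: ('a::topological_space \<times> 'b::topological_space) measure)"
  by (auto intro!: borel_measurable_continuous_onI continuous_intros)

text \<open>A Borel left inverse of coding \<open>x\<close> by the sequence
  \<open>indicator (U i) x\<close>: membership in ever smaller basic sets pins down the point, and
  completeness gives the limit. It is defined on all real sequences, also those that code no point,
  because it will be applied to a limit law on sequence space.\<close>

lemma decode_basis:
  fixes U :: "nat \<Rightarrow> 'a::{complete_space, second_countable_topology} set"
  assumes U: "topological_basis (range U)"
  obtains dec :: "(nat \<Rightarrow> real) \<Rightarrow> 'a" where "dec \<in> PiM UNIV (\<lambda>_. borel) \<rightarrow>\<^sub>M borel"
    "\<And>x. dec (\<lambda>i. indicator (U i) x) = x"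
proof -
  define S where "S k i \<longleftrightarrow> (\<forall>x\<in>U i. \<forall>y\<in>U i. dist x y < 1 / real (Suc k))" for k i
  \<comment> \<open>The first basic set claimed by \<open>v\<close> whose diameter is at most
    \<open>1 / real (Suc k)\<close>; on a sequence without such a set the value of
    \<open>LEAST\<close> is arbitrary.\<close>
  define near where "near k v = (LEAST i. v i = (1 :: real) \<and> S k i)" for k and v :: "nat \<Rightarrow> real"
  define q where "q i = (SOME x. x \<in> U i)" for i
  \<comment> \<open>The Cauchy test replaces a non-Cauchy sequence by a constant one, so that
    \<open>h k v\<close> converges for every \<open>v\<close> and \<open>dec\<close> is measurable
    as a pointwise limit.\<close>
  define h where "h k v = (if Cauchy (\<lambda>k. q (near k v)) then q (near k v) else q 0)" for k v
  define dec where "dec v = lim (\<lambda>k. h k v)" for v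
  have near_meas [measurable]: "near k \<in> PiM UNIV (\<lambda>_. borel) \<rightarrow>\<^sub>M count_space UNIV" for k
    unfolding near_def by measurable
  have [measurable]: "(\<lambda>v. q (near k v)) \<in> PiM UNIV (\<lambda>_. borel) \<rightarrow>\<^sub>M borel" for k
    by (rule measurable_compose[OF near_meas]) simp
  have [measurable]: "h k \<in> PiM UNIV (\<lambda>_. borel) \<rightarrow>\<^sub>M borel" for k
    unfolding h_def by measurable
  have "dec \<in> PiM UNIV (\<lambda>_. borel) \<rightarrow>\<^sub>M borel"
  proof (rule borel_measurable_LIMSEQ_metric)
    fix v :: "nat \<Rightarrow> real"
    have "Cauchy (\<lambda>k. h k v)"
    proof (cases "Cauchy (\<lambda>k. q (near k v))")
      case False
      then show ?thesis using convergent_Cauchy[OF convergent_const, of "q 0"] by (simp add: h_def)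
    qed (simp add: h_def)
    then show "(\<lambda>k. h k v) \<longlonglongrightarrow> dec v"
      unfolding dec_def by (simp add: Cauchy_convergent_iff convergent_LIMSEQ_iff)
  qed measurable
  moreover have "dec (\<lambda>i. indicator (U i) x) = x" for x
  proof -
    let ?v = "\<lambda>i. indicator (U i) x :: real"
    have d: "dist (q (near k ?v)) x < 1 / real (Suc k)" for k
    proof -
      \<comment> \<open>Half the target as radius, so that two points of \<open>U i\<close> are
        closer than \<open>1 / real (Suc k)\<close>.\<close>
      obtain i where i: "x \<in> U i" "U i \<subseteq> ball x (1 / (2 * real (Suc k)))"
        using topological_basisE[OF U open_ball, of x x "1 / (2 * real (Suc k))"] by auto
      have "dist a b < 1 / real (Suc k)" if "a \<in> U i" "b \<in> U i" for a b
      proof -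
        have "dist a x < 1 / (2 * real (Suc k))" "dist b x < 1 / (2 * real (Suc k))"
          using i that by (auto simp: dist_commute subset_iff)
        then have "dist a b < 1 / (2 * real (Suc k)) + 1 / (2 * real (Suc k))"
          using dist_triangle2[of a b x] by linarith
        also have "\<dots> = 1 / real (Suc k)" by (simp add: field_simps)
        finally show ?thesis .
      qed
      then have "?v i = 1 \<and> S k i" using i by (auto simp: S_def)
      then have *: "?v (near k ?v) = 1 \<and> S k (near k ?v)" unfolding near_def by (rule LeastI)
      then have x: "x \<in> U (near k ?v)" by (auto simp: indicator_def split: if_splits)
      then have "q (near k ?v) \<in> U (near k ?v)" unfolding q_def by (rule someI)
      then show ?thesis using * x by (auto simp: S_def)
    qed
    have lim: "(\<lambda>k. q (near k ?v)) \<longlonglongrightarrow> x"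
    proof (rule tendsto_dist_iff[THEN iffD2], rule tendsto_sandwich[OF _ _ tendsto_const])
      show "(\<lambda>k. 1 / real (Suc k)) \<longlonglongrightarrow> 0" using LIMSEQ_inverse_real_of_nat by (simp add: inverse_eq_divide)
      show "\<forall>\<^sub>F k in sequentially. dist (q (near k ?v)) x \<le> 1 / real (Suc k)"
        using d by (intro always_eventually allI less_imp_le)
    qed simp
    then have "Cauchy (\<lambda>k. q (near k ?v))" by (rule LIMSEQ_imp_Cauchy)
    then have "dec ?v = lim (\<lambda>k. q (near k ?v))" by (simp add: dec_def h_def)
    then show ?thesis using limI[OF lim] by simp
  qed
  ultimately show ?thesis using that by blast
qed


text \<open>Stands in for compactness of couplings together with lower semi-continuity of the total
  cost. Instead of weak convergence, the marginals are asked to agree exactly, from some index on,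
  with the target on each finite Boolean combination of the \<open>U i\<close>; this is what
  refining partitions supply and what survives a set-by-set cluster point.\<close>

lemma transport_cost_le_limit:
  fixes U :: "nat \<Rightarrow> 'a::{complete_space, second_countable_topology} set" and N :: "nat \<Rightarrow> ('a \<times> 'a) measure"
  assumes U: "topological_basis (range U)"
    and c: "lower_semicontinuous c"
    and P: "prob_space P" "sets P = sets borel" and Q: "prob_space Q" "sets Q = sets borel"
    and N: "\<And>k. prob_space (N k)" "\<And>k. sets (N k) = sets borel"
    and NP: "\<And>J \<S>. finite J \<Longrightarrow> eventually (\<lambda>k. emeasure (N k) {w. {i\<in>J. fst w \<in> U i} \<in> \<S>} = emeasure P {x. {i\<in>J. x \<in> U i} \<in> \<S>}) sequentially"
    and NQ: "\<And>J \<S>. finite J \<Longrightarrow> eventually (\<lambda>k. emeasure (N k) {w. {i\<in>J. snd w \<in> U i} \<in> \<S>} = emeasure Q {x. {i\<in>J. x \<in> U i} \<in> \<S>}) sequentially"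
    and NC: "\<And>k. (\<integral>\<^sup>+ w. c w \<partial>N k) \<le> C"
  shows "transport_cost c P Q \<le> C"
proof -
  interpret N: prob_space "N k" for k by (rule N)
  interpret P: prob_space P by (rule P)
  interpret Q: prob_space Q by (rule Q)
  have spN: "space (N k) = UNIV" for k using sets_eq_imp_space_eq[OF N(2)] by simp
  note [measurable_cong] = N(2) P(2) Q(2)
  have Uo: "open (U i)" for i using U by (auto simp: topological_basis_def)
  have [measurable]: "U i \<in> sets borel" for i using Uo by simp
  obtain G L where G: "G \<le> sequentially" "G \<noteq> bot" and L: "\<And>A. ((\<lambda>k. measure (N k) A) \<longlongrightarrow> L A) G"
    using pointwise_cluster_point[of "\<lambda>k A. measure (N k) A"] by auto
  have L0: "0 \<le> L A" for A
    by (rule tendsto_lowerbound[OF L _ G(2)]) simp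
  have L1: "L UNIV = 1"
    using L[of UNIV] N.prob_space G(2) by (auto simp: spN tendsto_const_iff)
  have L_add: "L (A \<union> B) = L A + L B" if "A \<in> sets borel" "B \<in> sets borel" "A \<inter> B = {}" for A B
  proof -
    have "measure (N k) (A \<union> B) = measure (N k) A + measure (N k) B" for k
      using that by (intro N.finite_measure_Union) (auto simp: N(2))
    then show ?thesis using tendsto_unique[OF G(2) L[of "A \<union> B"]] tendsto_add[OF L L] by simp
  qed
  have L_ev: "ennreal (L A) = a" if "eventually (\<lambda>k. emeasure (N k) A = a) sequentially" for A a
  proof -
    have "eventually (\<lambda>k. emeasure (N k) A = a) G" using that G(1) by (simp add: le_filter_def)
    then have "((\<lambda>k. emeasure (N k) A) \<longlongrightarrow> a) G" by (rule tendsto_eventually)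
    moreover have "((\<lambda>k. emeasure (N k) A) \<longlongrightarrow> ennreal (L A)) G"
      unfolding N.emeasure_eq_measure by (intro tendsto_ennrealI L)
    ultimately show ?thesis using tendsto_unique[OF G(2)] by blast
  qed
  define ind where "ind x = (\<lambda>i. indicator (U i) x :: real)" for x
  define code where "code w i = (ind (fst w) i, ind (snd w) i)" for w i
  have [measurable]: "(\<lambda>x. ind x i) \<in> borel_measurable borel" for i unfolding ind_def by measurable
  have code_i [measurable]: "(\<lambda>w. code w i) \<in> borel_measurable borel" for i
    unfolding code_def by (intro borel_measurable_Pair) measurable
  have fin: "finite (range (\<lambda>w. code w i))" for i
    by (rule finite_subset[of _ "{0, 1} \<times> {0, 1}"]) (auto simp: code_def ind_def indicator_def split: if_splits)
  obtain K where K: "prob_space K" "sets K = sets (PiM UNIV (\<lambda>_. borel))"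
    "\<And>J X. finite J \<Longrightarrow> X \<in> sets (PiM J (\<lambda>_. borel)) \<Longrightarrow>
       emeasure K {\<omega>. restrict \<omega> J \<in> X} = ennreal (L {w. restrict (code w) J \<in> X})"
    by (rule finitely_additive_kolmogorov[where code = code, OF space_borel code_i fin L0 L1 L_add]) blast+
  interpret K: prob_space K by fact
  note [measurable_cong] = K(2)
  have spK: "space K = UNIV" using sets_eq_imp_space_eq[OF K(2)] by (auto simp: space_PiM)
  have \<pi>_meas: "(\<lambda>\<omega> i. \<pi> (\<omega> i)) \<in> K \<rightarrow>\<^sub>M PiM UNIV (\<lambda>_. borel)"
    if [measurable]: "\<pi> \<in> borel_measurable borel" for \<pi> :: "real \<times> real \<Rightarrow> real"
    by (rule measurable_PiM_single') (auto simp: space_PiM)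
  have marg: "distr K (PiM UNIV (\<lambda>_. borel)) (\<lambda>\<omega> i. \<pi> (\<omega> i)) = distr R (PiM UNIV (\<lambda>_. borel)) ind"
    if \<pi> [measurable]: "\<pi> \<in> borel_measurable borel"
      and R: "sets R = sets borel" "prob_space R"
      and \<pi>_code: "\<And>w i. \<pi> (code w i) = ind (pr w) i"
      and ev: "\<And>J \<S>. finite J \<Longrightarrow> eventually (\<lambda>k. emeasure (N k) {w. {i\<in>J. pr w \<in> U i} \<in> \<S>} = emeasure R {x. {i\<in>J. x \<in> U i} \<in> \<S>}) sequentially"
    for \<pi> :: "real \<times> real \<Rightarrow> real" and pr :: "'a \<times> 'a \<Rightarrow> 'a" and R
  proof -
    interpret R: prob_space R by fact
    note [measurable_cong] = R(1)
    have spR: "space R = UNIV" using sets_eq_imp_space_eq[OF R(1)] by simp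
    have ind_meas [measurable]: "ind \<in> R \<rightarrow>\<^sub>M PiM UNIV (\<lambda>_. borel)" by (rule measurable_PiM_single') (auto simp: ind_def space_PiM)
    show ?thesis
    proof (rule measure_eqI_PiM_infinite)
      fix A :: "nat \<Rightarrow> real set" and J :: "nat set"
      assume J: "finite J" "\<And>i. i \<in> J \<Longrightarrow> A i \<in> sets borel"
      let ?E = "prod_emb UNIV (\<lambda>_. borel) J (Pi\<^sub>E J A)"
      have E: "?E \<in> sets (PiM UNIV (\<lambda>_. borel))" using J by (intro sets_PiM_I) auto
      \<comment> \<open>Coordinates of a code are 0 or 1, so a cylinder condition is a condition on
        the membership pattern \<open>{i\<in>J. x \<in> U i}\<close>; \<open>\<S>\<close> lists the
        admissible patterns. This is the form to which \<open>ev\<close> applies.\<close>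
      define \<S> where "\<S> = {T. \<forall>i\<in>J. (if i \<in> T then 1 else 0) \<in> A i}"
      have \<S>: "(\<forall>i\<in>J. ind x i \<in> A i) \<longleftrightarrow> {i\<in>J. x \<in> U i} \<in> \<S>" for x
        by (auto simp: \<S>_def ind_def indicator_def split: if_splits)
      have X: "(Pi\<^sub>E J (\<lambda>i. \<pi> -` A i)) \<in> sets (PiM J (\<lambda>_. borel))"
        using J measurable_sets[OF \<pi>] by (intro sets_PiM_I_finite) auto
      have "emeasure (distr K (PiM UNIV (\<lambda>_. borel)) (\<lambda>\<omega> i. \<pi> (\<omega> i))) ?E
          = emeasure K ((\<lambda>\<omega> i. \<pi> (\<omega> i)) -` ?E \<inter> space K)"
        using E by (intro emeasure_distr \<pi>_meas \<pi>) auto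
      also have "(\<lambda>\<omega> i. \<pi> (\<omega> i)) -` ?E \<inter> space K = {\<omega>. restrict \<omega> J \<in> Pi\<^sub>E J (\<lambda>i. \<pi> -` A i)}"
        by (auto simp: prod_emb_def spK space_PiM PiE_iff)
      also have "emeasure K \<dots> = ennreal (L {w. restrict (code w) J \<in> Pi\<^sub>E J (\<lambda>i. \<pi> -` A i)})"
        using J X by (intro K)
      also have "{w. restrict (code w) J \<in> Pi\<^sub>E J (\<lambda>i. \<pi> -` A i)} = {w. {i\<in>J. pr w \<in> U i} \<in> \<S>}"
        by (auto simp: PiE_iff \<pi>_code \<S>[symmetric])
      also have "ennreal (L \<dots>) = emeasure R {x. {i\<in>J. x \<in> U i} \<in> \<S>}"
        by (intro L_ev ev J)
      also have "{x. {i\<in>J. x \<in> U i} \<in> \<S>} = ind -` ?E \<inter> space R"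
        by (auto simp: prod_emb_def spR space_PiM PiE_iff \<S>[symmetric])
      also have "emeasure R \<dots> = emeasure (distr R (PiM UNIV (\<lambda>_. borel)) ind) ?E"
        using E by (intro emeasure_distr[symmetric] ind_meas) auto
      finally show "emeasure (distr K (PiM UNIV (\<lambda>_. borel)) (\<lambda>\<omega> i. \<pi> (\<omega> i))) ?E
          = emeasure (distr R (PiM UNIV (\<lambda>_. borel)) ind) ?E" .
    next
      show "finite_measure (distr K (PiM UNIV (\<lambda>_. borel)) (\<lambda>\<omega> i. \<pi> (\<omega> i)))"
        by (intro K.finite_measure_distr \<pi>_meas \<pi>)
    qed auto
  qed
  have margP: "distr K (PiM UNIV (\<lambda>_. borel)) (\<lambda>\<omega> i. fst (\<omega> i)) = distr P (PiM UNIV (\<lambda>_. borel)) ind"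
    by (rule marg[OF borel_measurable_fst_snd(1) P(2,1) _ NP]) (simp_all add: code_def)
  have margQ: "distr K (PiM UNIV (\<lambda>_. borel)) (\<lambda>\<omega> i. snd (\<omega> i)) = distr Q (PiM UNIV (\<lambda>_. borel)) ind"
    by (rule marg[OF borel_measurable_fst_snd(2) Q(2,1) _ NQ]) (simp_all add: code_def)
  obtain dec where dec [measurable]: "dec \<in> PiM UNIV (\<lambda>_. borel) \<rightarrow>\<^sub>M borel" and dec_ind: "\<And>x. dec (ind x) = x"
    using decode_basis[OF U] unfolding ind_def by metis
  have ind_meas [measurable]: "ind \<in> borel \<rightarrow>\<^sub>M PiM UNIV (\<lambda>_. borel)"
    by (rule measurable_PiM_single') (auto simp: ind_def space_PiM)
  \<comment> \<open>\<open>K\<close> is merely a law on sequences. Since its image under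
    \<open>\<pi>\<close> is the law of \<open>ind\<close> under the countably additive
    \<open>R\<close>, that image is carried by sequences unchanged by decoding and encoding again,
    that is, by codes of points.\<close>
  have distr_dec: "distr K borel (\<lambda>\<omega>. dec (\<lambda>i. \<pi> (\<omega> i))) = R"
    and AE_dec: "AE \<omega> in K. \<forall>i. \<pi> (\<omega> i) = ind (dec (\<lambda>i. \<pi> (\<omega> i))) i"
    if R: "sets R = sets borel" and \<pi> [measurable]: "\<pi> \<in> borel_measurable borel"
    and eq: "distr K (PiM UNIV (\<lambda>_. borel)) (\<lambda>\<omega> i. \<pi> (\<omega> i)) = distr R (PiM UNIV (\<lambda>_. borel)) ind"
    for R and \<pi> :: "real \<times> real \<Rightarrow> real"
  proof -
    note [measurable_cong] = R
    note [measurable] = \<pi>_meas[OF \<pi>]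
    have "distr K borel (\<lambda>\<omega>. dec (\<lambda>i. \<pi> (\<omega> i))) = distr (distr K (PiM UNIV (\<lambda>_. borel)) (\<lambda>\<omega> i. \<pi> (\<omega> i))) borel dec"
      by (subst distr_distr) (auto simp: comp_def)
    also have "\<dots> = distr R borel (\<lambda>x. dec (ind x))"
      unfolding eq by (subst distr_distr) (auto simp: comp_def)
    also have "\<dots> = R" unfolding dec_ind using R by (intro distr_id2) simp
    finally show "distr K borel (\<lambda>\<omega>. dec (\<lambda>i. \<pi> (\<omega> i))) = R" .
    have ind_dec: "(\<lambda>v. ind (dec v) i) \<in> borel_measurable (PiM UNIV (\<lambda>_. borel))" for i
      by (rule measurable_compose[OF dec]) measurable
    have pm: "{v \<in> space (PiM UNIV (\<lambda>_. borel)). \<forall>i. v i = ind (dec v) i} \<in> sets (PiM UNIV (\<lambda>_. borel))"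
      by (intro sets.sets_Collect_countable_All borel_measurable_eq ind_dec) measurable
    have "AE v in distr R (PiM UNIV (\<lambda>_. borel)) ind. \<forall>i. v i = ind (dec v) i"
      using pm by (subst AE_distr_iff) (auto simp: dec_ind)
    then show "AE \<omega> in K. \<forall>i. \<pi> (\<omega> i) = ind (dec (\<lambda>i. \<pi> (\<omega> i))) i"
      unfolding eq[symmetric] using pm by (subst (asm) AE_distr_iff) auto
  qed
  define D where "D \<omega> = (dec (\<lambda>i. fst (\<omega> i)), dec (\<lambda>i. snd (\<omega> i)))" for \<omega> :: "nat \<Rightarrow> real \<times> real"
  have D_meas [measurable]: "D \<in> K \<rightarrow>\<^sub>M borel"
    unfolding D_def
    by (intro borel_measurable_Pair measurable_compose[OF \<pi>_meas dec] borel_measurable_fst_snd)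
  have AE_D: "AE \<omega> in K. \<forall>i. code (D \<omega>) i = \<omega> i"
    using AE_dec[OF P(2) borel_measurable_fst_snd(1) margP] AE_dec[OF Q(2) borel_measurable_fst_snd(2) margQ]
  proof eventually_elim
    case (elim \<omega>)
    show ?case unfolding code_def D_def prod_eq_iff fst_conv snd_conv
      using elim(1)[THEN spec, symmetric] elim(2)[THEN spec, symmetric] by blast
  qed
  define M where "M = distr K borel D"
  have "distr M P fst = P"
  proof -
    have "distr M P fst = distr M borel fst" by (intro distr_cong refl P(2))
    also have "\<dots> = distr K borel (\<lambda>\<omega>. dec (\<lambda>i. fst (\<omega> i)))"
      unfolding M_def distr_distr[OF borel_measurable_fst_snd(1) D_meas] by (simp add: comp_def D_def)
    finally show ?thesis using distr_dec[OF P(2) borel_measurable_fst_snd(1) margP] by simp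
  qed
  moreover have "distr M Q snd = Q"
  proof -
    have "distr M Q snd = distr M borel snd" by (intro distr_cong refl Q(2))
    also have "\<dots> = distr K borel (\<lambda>\<omega>. dec (\<lambda>i. snd (\<omega> i)))"
      unfolding M_def distr_distr[OF borel_measurable_fst_snd(2) D_meas] by (simp add: comp_def D_def)
    finally show ?thesis using distr_dec[OF Q(2) borel_measurable_fst_snd(2) margQ] by simp
  qed
  moreover have "sets M = sets (P \<Otimes>\<^sub>M Q)"
    unfolding M_def using sets_pair_measure_cong[OF P(2) Q(2)] unfolding borel_prod by simp
  ultimately have M: "M \<in> couplings P Q" by (simp add: couplings_def)
  define cell where "cell n w = restrict (code w) {..<n}" for n w
  define R where "R n = range (cell n)" for n
  have finR: "finite (R n)" for n
  proof (rule finite_subset)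
    show "R n \<subseteq> PiE {..<n} (\<lambda>i. range (\<lambda>w. code w i))" by (auto simp: R_def cell_def split: if_splits)
    show "finite (PiE {..<n} (\<lambda>i. range (\<lambda>w. code w i)))" using fin by (intro finite_PiE) auto
  qed
  have sing: "{r} \<in> sets (PiM {..<n} (\<lambda>_. borel))" if "r \<in> R n" for r n
  proof -
    have "{r} = PiE {..<n} (\<lambda>i. {r i})" using that by (subst PiE_singleton) (auto simp: R_def cell_def)
    also have "\<dots> \<in> sets (PiM {..<n} (\<lambda>_. borel))" by (intro sets_PiM_I_finite) auto
    finally show ?thesis .
  qed
  have cell_meas: "cell n \<in> borel \<rightarrow>\<^sub>M PiM {..<n} (\<lambda>_. borel)" for n
    unfolding cell_def by measurable
  have fib: "{w. cell n w = r} \<in> sets borel" if "r \<in> R n" for r n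
    using measurable_sets[OF cell_meas sing[OF that]] by (auto simp: vimage_def)
  have M_cell: "emeasure M {w. cell n w = r} = ennreal (L {w. cell n w = r})" if r: "r \<in> R n" for n r
  proof -
    have "emeasure M {w. cell n w = r} = emeasure K (D -` {w. cell n w = r} \<inter> space K)"
      unfolding M_def using fib[OF r] by (intro emeasure_distr) auto
    also have "\<dots> = emeasure K {\<omega>. restrict \<omega> {..<n} \<in> {r}}"
    proof (rule emeasure_eq_AE)
      show "AE \<omega> in K. (\<omega> \<in> D -` {w. cell n w = r} \<inter> space K) = (\<omega> \<in> {\<omega>. restrict \<omega> {..<n} \<in> {r}})"
        using AE_D by eventually_elim (auto simp: spK cell_def)
      show "D -` {w. cell n w = r} \<inter> space K \<in> sets K" by (rule measurable_sets[OF D_meas fib[OF r]])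
      have "(\<lambda>\<omega>. restrict \<omega> {..<n}) \<in> K \<rightarrow>\<^sub>M PiM {..<n} (\<lambda>_. borel)" by measurable
      from measurable_sets[OF this sing[OF r]] show "{\<omega>. restrict \<omega> {..<n} \<in> {r}} \<in> sets K"
        by (simp add: spK vimage_def)
    qed
    also have "\<dots> = ennreal (L {w. cell n w = r})"
      using K(3)[OF _ sing[OF r]] by (simp add: cell_def)
    finally show ?thesis .
  qed
  \<comment> \<open>Infimum of \<open>c\<close> over a cell, truncated at \<open>n\<close>: a finite
    coefficient lets the limit along \<open>G\<close> pass through its product with the measure of
    the cell.\<close>
  define S where "S n r = min (of_nat n) (INF w\<in>{w. cell n w = r}. c w)" for n r
  have S_fin: "S n r < \<infinity>" for n r by (simp add: S_def min_less_iff_disj less_top of_nat_less_top)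
  have S_le: "S n (cell n w) \<le> c w" for n w
    unfolding S_def by (rule min.coboundedI2) (auto intro: INF_lower)
  have S_int: "(\<integral>\<^sup>+ w. S n (cell n w) \<partial>B) = (\<Sum>r\<in>R n. S n r * emeasure B {w. cell n w = r})"
    if "sets B = sets borel" for B n
  proof -
    have "(\<integral>\<^sup>+ w. S n (cell n w) \<partial>B) = (\<integral>\<^sup>+ w. (\<Sum>r\<in>R n. S n r * indicator {w. cell n w = r} w) \<partial>B)"
    proof (rule nn_integral_cong)
      fix w
      have "(\<Sum>r\<in>R n. S n r * indicator {w. cell n w = r} w) = (\<Sum>r\<in>R n. if cell n w = r then S n r else 0)"
        by (intro sum.cong) (auto simp: indicator_def)
      also have "\<dots> = S n (cell n w)" using finR by (simp add: R_def)
      finally show "S n (cell n w) = (\<Sum>r\<in>R n. S n r * indicator {w. cell n w = r} w)" ..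
    qed
    also have "\<dots> = (\<Sum>r\<in>R n. S n r * emeasure B {w. cell n w = r})"
      using fib that by (subst nn_integral_sum) (auto simp: nn_integral_cmult)
    finally show ?thesis .
  qed
  \<comment> \<open>The integral of a function of the cell is a finite sum, so the bound
    \<open>C\<close> for each \<open>N k\<close> passes to \<open>L\<close>, and \<open>M\<close>
    agrees with \<open>L\<close> on cells.\<close>
  have S_M: "(\<integral>\<^sup>+ w. S n (cell n w) \<partial>M) \<le> C" for n
  proof -
    have "((\<lambda>k. \<Sum>r\<in>R n. S n r * ennreal (measure (N k) {w. cell n w = r})) \<longlongrightarrow> (\<Sum>r\<in>R n. S n r * ennreal (L {w. cell n w = r}))) G"
      by (intro tendsto_sum ennreal_tendsto_cmult tendsto_ennrealI L S_fin[unfolded infinity_ennreal_def])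
    moreover have "(\<Sum>r\<in>R n. S n r * ennreal (measure (N k) {w. cell n w = r})) \<le> C" for k
    proof -
      have "(\<Sum>r\<in>R n. S n r * ennreal (measure (N k) {w. cell n w = r})) = (\<integral>\<^sup>+ w. S n (cell n w) \<partial>N k)"
        by (simp add: S_int[OF N(2)] N.emeasure_eq_measure)
      also have "\<dots> \<le> (\<integral>\<^sup>+ w. c w \<partial>N k)" by (intro nn_integral_mono S_le)
      finally show ?thesis using NC[of k] by simp
    qed
    ultimately have "(\<Sum>r\<in>R n. S n r * ennreal (L {w. cell n w = r})) \<le> C"
      using G(2) by (intro tendsto_upperbound) auto
    then show ?thesis by (subst S_int) (auto simp: M_def M_cell[unfolded M_def])
  qed
  \<comment> \<open>Lower semi-continuity enters here: \<open>c\<close> exceeds \<open>t\<close> on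
    a rectangle of basic sets around \<open>w\<close>, and once \<open>n\<close> is past both of its
    indices the whole cell lies in that rectangle.\<close>
  have S_SUP: "(SUP n. S n (cell n w)) = c w" for w
  proof (rule antisym)
    show "(SUP n. S n (cell n w)) \<le> c w" by (intro SUP_least S_le)
    show "c w \<le> (SUP n. S n (cell n w))"
    proof (rule dense_le)
      fix t assume t: "t < c w"
      have "open {w. t < c w}" using c by (auto simp: lower_semicontinuous_def)
      then obtain A B where AB: "open A" "open B" "w \<in> A \<times> B" "A \<times> B \<subseteq> {w. t < c w}"
        using t by (auto elim!: open_prod_elim)
      obtain i where i: "fst w \<in> U i" "U i \<subseteq> A"
        using topological_basisE[OF U AB(1), of "fst w"] AB(3) by (auto simp: mem_Times_iff)
      obtain j where j: "snd w \<in> U j" "U j \<subseteq> B"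
        using topological_basisE[OF U AB(2), of "snd w"] AB(3) by (auto simp: mem_Times_iff)
      obtain m :: nat where m: "t < of_nat m"
        using t ennreal_Ex_less_of_nat[of t] by (metis infinity_ennreal_def not_less_iff_gr_or_eq order_less_le_trans top_greatest)
      \<comment> \<open>\<open>m\<close> lifts the truncation level above \<open>t\<close>;
        \<open>i\<close> and \<open>j\<close> must be strictly below \<open>n\<close> because a cell
        reads the coordinates in \<open>{..<n}\<close>.\<close>
      define n where "n = Suc (max m (max i j))"
      have "t \<le> c w'" if "cell n w' = cell n w" for w'
      proof -
        have "i < n" "j < n" by (simp_all add: n_def less_Suc_eq_le)
        then have "code w' i = code w i" "code w' j = code w j"
          using fun_cong[OF that, of i] fun_cong[OF that, of j] by (simp_all add: cell_def)
        then have "fst w' \<in> U i" "snd w' \<in> U j" using i j by (auto simp: code_def ind_def indicator_def split: if_splits)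
        then have "w' \<in> A \<times> B" using i j by (auto simp: mem_Times_iff)
        then show ?thesis using AB by auto
      qed
      moreover have "t \<le> of_nat n"
        using m by (rule order.trans[OF less_imp_le]) (simp add: n_def del: of_nat_Suc)
      ultimately have "t \<le> S n (cell n w)" unfolding S_def by (auto intro!: INF_greatest)
      then show "t \<le> (SUP n. S n (cell n w))" by (rule SUP_upper2[OF UNIV_I])
    qed
  qed
  have S_meas: "(\<lambda>w. S n (cell n w)) \<in> borel_measurable M" for n
  proof -
    have "(\<lambda>w. S n (cell n w)) = (\<lambda>w. \<Sum>r\<in>R n. S n r * indicator {w. cell n w = r} w)"
    proof
      fix w
      have "(\<Sum>r\<in>R n. S n r * indicator {w. cell n w = r} w) = (\<Sum>r\<in>R n. if cell n w = r then S n r else 0)"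
        by (intro sum.cong) (auto simp: indicator_def)
      also have "\<dots> = S n (cell n w)" using finR by (simp add: R_def)
      finally show "S n (cell n w) = (\<Sum>r\<in>R n. S n r * indicator {w. cell n w = r} w)" ..
    qed
    then show ?thesis using fib by (simp add: M_def)
  qed
  have S_inc: "incseq (\<lambda>n w. S n (cell n w))"
  proof (intro incseq_SucI le_funI)
    fix n w
    have "cell n w' = cell n w" if "cell (Suc n) w' = cell (Suc n) w" for w'
    proof
      fix i show "cell n w' i = cell n w i"
        using fun_cong[OF that, of i] by (auto simp: cell_def)
    qed
    then have I: "(INF w'\<in>{w'. cell n w' = cell n w}. c w') \<le> (INF w'\<in>{w'. cell (Suc n) w' = cell (Suc n) w}. c w')"
      by (intro INF_superset_mono subsetI CollectI order_refl) blast
    show "S n (cell n w) \<le> S (Suc n) (cell (Suc n) w)"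
      unfolding S_def by (rule min.mono[OF of_nat_mono I]) simp
  qed
  have "(\<integral>\<^sup>+ w. c w \<partial>M) = (\<integral>\<^sup>+ w. (SUP n. S n (cell n w)) \<partial>M)" by (simp add: S_SUP)
  also have "\<dots> = (SUP n. \<integral>\<^sup>+ w. S n (cell n w) \<partial>M)"
    by (rule nn_integral_monotone_convergence_SUP[OF S_inc S_meas])
  also have "\<dots> \<le> C" by (intro SUP_least S_M)
  finally show ?thesis unfolding transport_cost_def by (rule INF_lower2[OF M])
qed

section \<open>Tensorization\<close>

definition prob_density :: "'a measure \<Rightarrow> ('a \<Rightarrow> real) \<Rightarrow> bool" where
  "prob_density M f \<longleftrightarrow> f \<in> borel_measurable M \<and> (\<forall>x. 0 \<le> f x) \<and> (\<integral>\<^sup>+ x. ennreal (f x) \<partial>M) = 1"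

lemma prob_densityD:
  assumes "prob_density M f"
  shows "f \<in> borel_measurable M" "0 \<le> f x" "(\<integral>\<^sup>+ x. ennreal (f x) \<partial>M) = 1"
  using assms by (auto simp: prob_density_def)

lemma prob_space_prob_density:
  assumes "prob_density M f"
  shows "prob_space (density M (\<lambda>x. ennreal (f x)))"
proof (rule prob_spaceI)
  note [measurable] = prob_densityD(1)[OF assms]
  have "(\<integral>\<^sup>+ x. ennreal (f x) * indicator (space M) x \<partial>M) = (\<integral>\<^sup>+ x. ennreal (f x) \<partial>M)"
    by (intro nn_integral_cong) simp
  then show "emeasure (density M (\<lambda>x. ennreal (f x))) (space (density M (\<lambda>x. ennreal (f x)))) = 1"
    using prob_densityD(3)[OF assms] by (simp add: emeasure_density)
qed

text \<open>The transport-entropy inequality restricted to laws with a real density, for which both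
  entropies are integrals; all other laws have infinite entropy.\<close>

definition density_te :: "'a measure \<Rightarrow> ('a \<times> 'a \<Rightarrow> ennreal) \<Rightarrow> ennreal \<Rightarrow> ennreal \<Rightarrow> bool" where
  "density_te M c a1 a2 \<longleftrightarrow> (\<forall>f g. prob_density M f \<longrightarrow> prob_density M g \<longrightarrow>
     transport_cost c (density M (\<lambda>x. ennreal (f x))) (density M (\<lambda>x. ennreal (g x))) \<le> a1 * density_entropy M f + a2 * density_entropy M g)"

lemma measurable_couplings:
  assumes "N \<in> couplings A B"
  shows "fst \<in> N \<rightarrow>\<^sub>M A" "snd \<in> N \<rightarrow>\<^sub>M B"
  using assms by (auto simp: couplings_def cong: measurable_cong_sets)

lemma nn_integral_couplings:
  assumes N: "N \<in> couplings A B"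
  shows "f \<in> borel_measurable A \<Longrightarrow> (\<integral>\<^sup>+ w. f (fst w) \<partial>N) = (\<integral>\<^sup>+ x. f x \<partial>A)"
    and "g \<in> borel_measurable B \<Longrightarrow> (\<integral>\<^sup>+ w. g (snd w) \<partial>N) = (\<integral>\<^sup>+ x. g x \<partial>B)"
  using N nn_integral_distr[OF measurable_couplings(1)[OF N], of f] nn_integral_distr[OF measurable_couplings(2)[OF N], of g]
  by (auto simp: couplings_def)

lemma prob_space_couplings:
  assumes "N \<in> couplings A B" "prob_space A"
  shows "prob_space N"
  using nn_integral_couplings(1)[OF assms(1), of "\<lambda>_. 1"] prob_space.emeasure_space_1[OF assms(2)]
  by (intro prob_spaceI) simp

lemma pair_measure_couplings:
  assumes "prob_space A" "prob_space B"
  shows "A \<Otimes>\<^sub>M B \<in> couplings A B"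
proof -
  interpret A: prob_space A by fact
  interpret B: prob_space B by fact
  interpret pair_sigma_finite A B ..
  have "distr (A \<Otimes>\<^sub>M B) B snd = B"
  proof (rule measure_eqI)
    fix X assume "X \<in> sets (distr (A \<Otimes>\<^sub>M B) B snd)"
    then have X: "X \<in> sets B" by simp
    then have "snd -` X \<inter> space (A \<Otimes>\<^sub>M B) = space A \<times> X"
      using sets.sets_into_space[OF X] by (auto simp: space_pair_measure)
    then show "emeasure (distr (A \<Otimes>\<^sub>M B) B snd) X = emeasure B X"
      using X by (simp add: emeasure_distr B.emeasure_pair_measure_Times A.emeasure_space_1)
  qed simp
  moreover have "distr (A \<Otimes>\<^sub>M B) A fst = A" by (rule B.distr_pair_fst)
  ultimately show ?thesis by (simp add: couplings_def)
qed

text \<open>The infimum need not be attained, so a slack \<open>e\<close> buys a coupling. With an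
  infinite bound there is no strict inequality to exploit, and the product coupling serves.\<close>

lemma density_te_coupling:
  assumes "density_te M c a1 a2" and f: "prob_density M f" and g: "prob_density M g" and e: "0 < (e :: ennreal)"
  obtains N where "N \<in> couplings (density M (\<lambda>x. ennreal (f x))) (density M (\<lambda>x. ennreal (g x)))"
    "(\<integral>\<^sup>+ w. c w \<partial>N) \<le> a1 * density_entropy M f + a2 * density_entropy M g + e"
proof (cases "a1 * density_entropy M f + a2 * density_entropy M g = \<infinity>")
  case True
  then have "a1 * density_entropy M f + a2 * density_entropy M g + e = top" by simp
  then show ?thesis
    using that[OF pair_measure_couplings[OF prob_space_prob_density[OF f] prob_space_prob_density[OF g]]] by (simp only: top_greatest)
next
  case False
  have "transport_cost c (density M (\<lambda>x. ennreal (f x))) (density M (\<lambda>x. ennreal (g x))) \<le> a1 * density_entropy M f + a2 * density_entropy M g"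
    using assms by (auto simp: density_te_def)
  also have "\<dots> < a1 * density_entropy M f + a2 * density_entropy M g + e"
    using False e by (metis add.right_neutral ennreal_add_left_cancel_less infinity_ennreal_def)
  finally show ?thesis using that unfolding transport_cost_def INF_less_iff by (auto intro: less_imp_le)
qed

section \<open>Disintegration and averaging of densities\<close>

lemma disintegrate_prob_density:
  assumes "prob_space M1" "prob_space M2" and f: "prob_density (M1 \<Otimes>\<^sub>M M2) f"
  obtains F t where "prob_density M1 F" "case_prod t \<in> borel_measurable (M1 \<Otimes>\<^sub>M M2)"
    "\<And>z. z \<in> space M1 \<Longrightarrow> prob_density M2 (t z)" "\<And>z x. 0 \<le> t z x"
    "AE w in M1 \<Otimes>\<^sub>M M2. f w = F (fst w) * t (fst w) (snd w)"
proof -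
  interpret M1: prob_space M1 by fact
  interpret M2: prob_space M2 by fact
  interpret pair_sigma_finite M1 M2 ..
  note [measurable] = prob_densityD(1)[OF f]
  define F0 where "F0 z = (\<integral>\<^sup>+ x. ennreal (f (z, x)) \<partial>M2)" for z
  define F where "F z = enn2real (F0 z)" for z
  \<comment> \<open>With a product as reference measure, conditional densities are plain quotients
    by the marginal. The default 1 covers \<open>F z = 0\<close>, including fibres of infinite mass,
    which \<open>enn2real\<close> sends to 0; it makes \<open>t z\<close> a probability density for
    every \<open>z\<close> in the space.\<close>
  define t where "t z x = (if F z = 0 then 1 else f (z, x) / F z)" for z x
  have [measurable]: "F0 \<in> borel_measurable M1" unfolding F0_def by measurable
  have [measurable]: "F \<in> borel_measurable M1" unfolding F_def by measurable
  have t_meas [measurable]: "case_prod t \<in> borel_measurable (M1 \<Otimes>\<^sub>M M2)"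
    unfolding t_def by measurable
  have F_nonneg: "0 \<le> F z" for z by (simp add: F_def)
  have t_nonneg: "0 \<le> t z x" for z x using prob_densityD(2)[OF f] F_nonneg by (simp add: t_def)
  have F0_1: "(\<integral>\<^sup>+ z. F0 z \<partial>M1) = 1"
    unfolding F0_def using prob_densityD(3)[OF f] by (subst M2.nn_integral_fst) auto
  then have fin: "AE z in M1. F0 z \<noteq> \<infinity>" by (intro nn_integral_PInf_AE) auto
  then have "(\<integral>\<^sup>+ z. ennreal (F z) \<partial>M1) = (\<integral>\<^sup>+ z. F0 z \<partial>M1)"
    by (intro nn_integral_cong_AE) (auto simp: F_def less_top elim!: eventually_mono)
  then have F: "prob_density M1 F" using F0_1 F_nonneg by (simp add: prob_density_def)
  have t: "prob_density M2 (t z)" if z [measurable]: "z \<in> space M1" for z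
  proof (cases "F z = 0")
    case True
    then show ?thesis by (simp add: t_def[abs_def] prob_density_def M2.emeasure_space_1)
  next
    case False
    then have *: "0 < F z" "F0 z = ennreal (F z)" 
      using F_nonneg[of z] by (auto simp: F_def enn2real_eq_0_iff enn2real_positive_iff zero_less_iff_neq_zero less_top)
    have "(\<integral>\<^sup>+ x. ennreal (t z x) \<partial>M2) = (\<integral>\<^sup>+ x. ennreal (f (z, x)) / ennreal (F z) \<partial>M2)"
      using * prob_densityD(2)[OF f] by (intro nn_integral_cong) (simp add: t_def divide_ennreal)
    also have "\<dots> = F0 z / ennreal (F z)" unfolding F0_def by (intro nn_integral_divide) measurable
    also have "\<dots> = 1" using * by (simp add: divide_ennreal)
    finally have "(\<integral>\<^sup>+ x. ennreal (t z x) \<partial>M2) = 1" .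
    moreover have "t z \<in> borel_measurable M2" using measurable_compose[OF measurable_Pair1'[OF z] t_meas] by simp
    ultimately show ?thesis using t_nonneg by (simp add: prob_density_def)
  qed
  have "AE w in M1 \<Otimes>\<^sub>M M2. f w = F (fst w) * t (fst w) (snd w)"
  proof (rule AE_pair_measure)
    have [measurable]: "(\<lambda>w. t (fst w) (snd w)) \<in> borel_measurable (M1 \<Otimes>\<^sub>M M2)"
      using t_meas by (simp add: case_prod_beta')
    show "{w \<in> space (M1 \<Otimes>\<^sub>M M2). f w = F (fst w) * t (fst w) (snd w)} \<in> sets (M1 \<Otimes>\<^sub>M M2)"
      by measurable
    show "AE z in M1. AE x in M2. f (z, x) = F (fst (z, x)) * t (fst (z, x)) (snd (z, x))"
      using fin AE_space
    proof eventually_elim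
      case (elim z)
      note [measurable] = elim(2)
      show ?case
      \<comment> \<open>\<open>fin\<close> rules out \<open>F0 z = \<infinity>\<close>, so
        \<open>F z = 0\<close> means that \<open>f\<close> vanishes almost everywhere on the fibre
        and agrees with \<open>F z * t z x\<close> there.\<close>
      proof (cases "F z = 0")
        case True
        then have "F0 z = 0" using elim by (simp add: F_def enn2real_eq_0_iff)
        then have "AE x in M2. ennreal (f (z, x)) = 0"
          unfolding F0_def by (subst (asm) nn_integral_0_iff_AE) auto
        then show ?thesis
          using True prob_densityD(2)[OF f] by (auto simp: ennreal_eq_0_iff intro: antisym elim!: eventually_mono)
      qed (simp add: t_def)
    qed
  qed
  with F t_meas t t_nonneg show ?thesis using that by blast
qed

lemma nn_integral_countable_partition:
  fixes p :: "'a \<Rightarrow> nat"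
  assumes [measurable]: "G \<in> borel_measurable M" and p [measurable]: "p \<in> M \<rightarrow>\<^sub>M count_space UNIV"
  shows "(\<integral>\<^sup>+ z. G z \<partial>M) = (\<Sum>j. \<integral>\<^sup>+ z. G z * indicator {z. p z = j} z \<partial>M)"
proof -
  have [measurable]: "(\<lambda>z. indicator {z. p z = j} z :: ennreal) \<in> borel_measurable M" for j
  proof -
    have "(\<lambda>z. indicator {z. p z = j} z :: ennreal) = (\<lambda>z. indicator {j} (p z))" by (auto simp: indicator_def)
    then show ?thesis using measurable_compose[OF p, of "indicator {j}" borel] by simp
  qed
  have "(\<Sum>j. G z * indicator {z. p z = j} z) = G z" for z
    by (rule suminf_cmult_indicator) (auto simp: disjoint_family_on_def)
  then show ?thesis by (subst nn_integral_suminf[symmetric]) auto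
qed

text \<open>The kernel density \<open>t\<close> is replaced by its \<open>F\<close>-weighted average over each cell of the partition
  \<open>p\<close>; by Jensen's inequality this does not increase the conditional entropy.\<close>

lemma average_kernel:
  fixes p :: "'a \<Rightarrow> nat"
  assumes "prob_space M1" "prob_space M2" and F: "prob_density M1 F"
    and t_meas: "case_prod t \<in> borel_measurable (M1 \<Otimes>\<^sub>M M2)"
    and t: "\<And>z. z \<in> space M1 \<Longrightarrow> prob_density M2 (t z)" and t_nonneg: "\<And>z x. 0 \<le> t z x"
    and p [measurable]: "p \<in> M1 \<rightarrow>\<^sub>M count_space UNIV"
  obtains u where "\<And>j. prob_density M2 (u j)"
    "(\<integral>\<^sup>+ z. ennreal (F z) * density_entropy M2 (u (p z)) \<partial>M1) \<le> (\<integral>\<^sup>+ z. ennreal (F z) * density_entropy M2 (t z) \<partial>M1)"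
    "\<And>h. h \<in> borel_measurable (count_space UNIV \<Otimes>\<^sub>M M2) \<Longrightarrow>
       (\<integral>\<^sup>+ z. ennreal (F z) * (\<integral>\<^sup>+ x. ennreal (u (p z) x) * h (p z, x) \<partial>M2) \<partial>M1)
     = (\<integral>\<^sup>+ z. ennreal (F z) * (\<integral>\<^sup>+ x. ennreal (t z x) * h (p z, x) \<partial>M2) \<partial>M1)"
proof -
  interpret M1: prob_space M1 by fact
  interpret M2: prob_space M2 by fact
  interpret pair_sigma_finite M1 M2 ..
  note [measurable] = prob_densityD(1)[OF F]
  have F_nonneg: "0 \<le> F z" for z by (rule prob_densityD(2)[OF F])
  have t_meas' [measurable]: "(\<lambda>w. t (fst w) (snd w)) \<in> borel_measurable (M1 \<Otimes>\<^sub>M M2)"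
    using t_meas by (simp add: case_prod_beta')
  have t_swap [measurable]: "(\<lambda>w. t (snd w) (fst w)) \<in> borel_measurable (M2 \<Otimes>\<^sub>M M1)"
    using measurable_compose[OF measurable_pair_swap' t_meas] by (simp add: case_prod_beta')
  define I where "I j z = (indicator {z. p z = j} z :: ennreal)" for j z
  have [measurable]: "I j \<in> borel_measurable M1" for j
  proof -
    have "I j = (\<lambda>z. indicator {j} (p z))" by (auto simp: indicator_def I_def)
    then show ?thesis using measurable_compose[OF p, of "indicator {j}" borel] by simp
  qed
  \<comment> \<open>\<open>q j\<close> is the \<open>F\<close>-mass of cell \<open>j\<close> and
    \<open>W j\<close> the unnormalized mixture of the kernels over it; cells of mass 0 get the
    default density 1.\<close>
  define q where "q j = (\<integral>\<^sup>+ z. ennreal (F z) * I j z \<partial>M1)" for j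
  define W where "W j x = (\<integral>\<^sup>+ z. ennreal (F z) * I j z * ennreal (t z x) \<partial>M1)" for j x
  define u where "u j x = (if q j = 0 then 1 else enn2real (W j x) / enn2real (q j))" for j x
  have [measurable]: "W j \<in> borel_measurable M2" for j unfolding W_def by measurable
  have [measurable]: "u j \<in> borel_measurable M2" for j unfolding u_def by measurable
  have "q j \<le> (\<integral>\<^sup>+ z. ennreal (F z) \<partial>M1)" for j
    unfolding q_def by (intro nn_integral_mono) (auto simp: I_def indicator_def)
  then have q_fin: "q j < \<infinity>" for j
    using prob_densityD(3)[OF F] by (metis ennreal_one_less_top infinity_ennreal_def order_le_less_trans)
  have swap: "(\<integral>\<^sup>+ x. (\<integral>\<^sup>+ z. ennreal (F z) * I j z * X z x \<partial>M1) \<partial>M2)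
      = (\<integral>\<^sup>+ z. ennreal (F z) * I j z * (\<integral>\<^sup>+ x. X z x \<partial>M2) \<partial>M1)"
    if [measurable]: "case_prod X \<in> borel_measurable (M1 \<Otimes>\<^sub>M M2)" for j X
  proof -
    have "(\<integral>\<^sup>+ x. (\<integral>\<^sup>+ z. ennreal (F z) * I j z * X z x \<partial>M1) \<partial>M2)
        = (\<integral>\<^sup>+ z. (\<integral>\<^sup>+ x. ennreal (F z) * I j z * X z x \<partial>M2) \<partial>M1)"
      by (rule Fubini') measurable
    also have "\<dots> = (\<integral>\<^sup>+ z. ennreal (F z) * I j z * (\<integral>\<^sup>+ x. X z x \<partial>M2) \<partial>M1)"
      by (intro nn_integral_cong nn_integral_cmult) measurable
    finally show ?thesis .
  qed
  have W_int: "(\<integral>\<^sup>+ x. W j x \<partial>M2) = q j" for j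
  proof -
    have "(\<integral>\<^sup>+ x. W j x \<partial>M2) = (\<integral>\<^sup>+ z. ennreal (F z) * I j z * (\<integral>\<^sup>+ x. ennreal (t z x) \<partial>M2) \<partial>M1)"
      unfolding W_def by (rule swap) measurable
    also have "\<dots> = q j"
      unfolding q_def by (intro nn_integral_cong) (simp add: prob_densityD(3)[OF t])
    finally show ?thesis .
  qed
  have W_fin: "AE x in M2. W j x \<noteq> \<infinity>" for j
    using W_int[of j] q_fin[of j] by (intro nn_integral_PInf_AE) auto
  \<comment> \<open>True also on cells of mass 0, where \<open>W j\<close> integrates to 0;
    multiplied by \<open>q j\<close>, the default value in \<open>u\<close> disappears.\<close>
  have qu: "AE x in M2. q j * ennreal (u j x) = W j x" for j
  proof (cases "q j = 0")
    case True
    then have "(\<integral>\<^sup>+ x. W j x \<partial>M2) = 0" by (simp add: W_int)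
    then have "AE x in M2. W j x = 0" by (subst (asm) nn_integral_0_iff_AE) auto
    then show ?thesis by eventually_elim (simp add: True)
  next
    case False
    then have "0 < enn2real (q j)" "q j = ennreal (enn2real (q j))" using q_fin[of j] by (auto simp: enn2real_positive_iff zero_less_iff_neq_zero)
    then have *: "q j * ennreal (enn2real (W j x) / enn2real (q j)) = ennreal (enn2real (W j x))" for x
      by (metis ennreal_mult' less_imp_le nonzero_mult_div_cancel_left times_divide_eq_right less_irrefl)
    show ?thesis using W_fin[of j] by eventually_elim (simp add: u_def False * less_top)
  qed
  have u_nonneg: "0 \<le> u j x" for j x by (simp add: u_def)
  have u: "prob_density M2 (u j)" for j
  proof (cases "q j = 0")
    case True
    then show ?thesis by (simp add: u_def[abs_def] prob_density_def M2.emeasure_space_1)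
  next
    case False
    have "q j * (\<integral>\<^sup>+ x. ennreal (u j x) \<partial>M2) = (\<integral>\<^sup>+ x. W j x \<partial>M2)"
      by (subst nn_integral_cmult[symmetric]) (use qu[of j] in \<open>auto intro!: nn_integral_cong_AE\<close>)
    then have "q j * (\<integral>\<^sup>+ x. ennreal (u j x) \<partial>M2) = q j * 1" by (simp add: W_int)
    then have "(\<integral>\<^sup>+ x. ennreal (u j x) \<partial>M2) = 1"
      using False q_fin[of j] by (subst (asm) ennreal_mult_cancel_left) auto
    then show ?thesis using u_nonneg by (simp add: prob_density_def)
  qed
  have jensen: "q j * density_entropy M2 (u j) \<le> (\<integral>\<^sup>+ z. ennreal (F z) * I j z * density_entropy M2 (t z) \<partial>M1)" for j
  proof (cases "q j = 0")
    case False
    then have q: "0 < enn2real (q j)" "q j = ennreal (enn2real (q j))" using q_fin[of j] by (auto simp: enn2real_positive_iff zero_less_iff_neq_zero)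
    have "q j * density_entropy M2 (u j) = (\<integral>\<^sup>+ x. q j * ennreal (entropy_fun (u j x)) \<partial>M2)"
      unfolding density_entropy_def by (intro nn_integral_cmult[symmetric]) measurable
    also have "\<dots> \<le> (\<integral>\<^sup>+ x. (\<integral>\<^sup>+ z. ennreal (F z) * I j z * ennreal (entropy_fun (t z x)) \<partial>M1) \<partial>M2)"
    proof (rule nn_integral_mono_AE)
      show "AE x in M2. q j * ennreal (entropy_fun (u j x)) \<le> (\<integral>\<^sup>+ z. ennreal (F z) * I j z * ennreal (entropy_fun (t z x)) \<partial>M1)"
        using W_fin[of j] AE_space
      proof eventually_elim
        case (elim x)
        have [measurable]: "(\<lambda>z. t z x) \<in> borel_measurable M1"
          using measurable_compose[OF measurable_Pair2'[OF elim(2)] t_meas'] by simp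
        \<comment> \<open>Jensen at fixed \<open>x\<close>, in the variable \<open>z\<close> and
          under the measure with density \<open>F\<close> restricted to cell \<open>j\<close>: its
          mass is \<open>q j\<close> and the integral of \<open>t z x\<close> is
          \<open>W j x\<close>.\<close>
        have "ennreal (enn2real (q j) * entropy_fun (enn2real (W j x) / enn2real (q j)))
            \<le> (\<integral>\<^sup>+ z. ennreal (entropy_fun (t z x)) \<partial>density M1 (\<lambda>z. ennreal (F z) * I j z))"
        proof (rule entropy_fun_jensen)
          have "emeasure (density M1 (\<lambda>z. ennreal (F z) * I j z)) (space M1) = q j"
            unfolding q_def by (subst emeasure_density) (auto intro!: nn_integral_cong)
          then show "emeasure (density M1 (\<lambda>z. ennreal (F z) * I j z)) (space (density M1 (\<lambda>z. ennreal (F z) * I j z))) = ennreal (enn2real (q j))"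
            using q by simp
          show "(\<integral>\<^sup>+ z. ennreal (t z x) \<partial>density M1 (\<lambda>z. ennreal (F z) * I j z)) = ennreal (enn2real (W j x))"
            using elim by (subst nn_integral_density) (auto simp: W_def less_top)
        qed (use q t_nonneg in auto)
        also have "\<dots> = (\<integral>\<^sup>+ z. ennreal (F z) * I j z * ennreal (entropy_fun (t z x)) \<partial>M1)"
          by (subst nn_integral_density) auto
        also have "ennreal (enn2real (q j) * entropy_fun (enn2real (W j x) / enn2real (q j))) = q j * ennreal (entropy_fun (u j x))"
          using q False entropy_fun_nonneg[OF u_nonneg] by (subst (3) q(2)) (simp add: u_def ennreal_mult')
        finally show ?case .
      qed
    qed
    also have "\<dots> = (\<integral>\<^sup>+ z. ennreal (F z) * I j z * density_entropy M2 (t z) \<partial>M1)"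
      unfolding density_entropy_def by (rule swap) measurable
    finally show ?thesis .
  qed simp
  have ent_t [measurable]: "(\<lambda>z. density_entropy M2 (t z)) \<in> borel_measurable M1" unfolding density_entropy_def by measurable
  have "(\<integral>\<^sup>+ z. ennreal (F z) * density_entropy M2 (u (p z)) \<partial>M1) \<le> (\<integral>\<^sup>+ z. ennreal (F z) * density_entropy M2 (t z) \<partial>M1)"
  proof -
    have [measurable]: "(\<lambda>z. density_entropy M2 (u (p z))) \<in> borel_measurable M1" by (rule measurable_compose[OF p]) simp
    have "(\<integral>\<^sup>+ z. ennreal (F z) * density_entropy M2 (u (p z)) \<partial>M1)
        = (\<Sum>j. \<integral>\<^sup>+ z. ennreal (F z) * density_entropy M2 (u (p z)) * I j z \<partial>M1)"
      unfolding I_def by (rule nn_integral_countable_partition) measurable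
    also have "\<dots> = (\<Sum>j. q j * density_entropy M2 (u j))"
    proof (rule suminf_cong)
      fix j
      have "(\<integral>\<^sup>+ z. ennreal (F z) * density_entropy M2 (u (p z)) * I j z \<partial>M1) = (\<integral>\<^sup>+ z. ennreal (F z) * I j z * density_entropy M2 (u j) \<partial>M1)"
        by (intro nn_integral_cong) (auto simp: I_def indicator_def)
      also have "\<dots> = q j * density_entropy M2 (u j)" unfolding q_def by (intro nn_integral_multc) measurable
      finally show "(\<integral>\<^sup>+ z. ennreal (F z) * density_entropy M2 (u (p z)) * I j z \<partial>M1) = q j * density_entropy M2 (u j)" .
    qed
    also have "\<dots> \<le> (\<Sum>j. \<integral>\<^sup>+ z. ennreal (F z) * I j z * density_entropy M2 (t z) \<partial>M1)"
      by (intro suminf_le jensen) auto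
    also have "\<dots> = (\<Sum>j. \<integral>\<^sup>+ z. ennreal (F z) * density_entropy M2 (t z) * I j z \<partial>M1)"
      by (simp add: ac_simps)
    also have "\<dots> = (\<integral>\<^sup>+ z. ennreal (F z) * density_entropy M2 (t z) \<partial>M1)"
      unfolding I_def by (rule nn_integral_countable_partition[symmetric]) measurable
    finally show ?thesis .
  qed
  \<comment> \<open>A test function that sees \<open>z\<close> only through \<open>p z\<close> is
    constant in \<open>z\<close> on each cell, so it cannot distinguish the kernel from its average:
    the joint law of the cell and of \<open>x\<close> is preserved.\<close>
  moreover have "(\<integral>\<^sup>+ z. ennreal (F z) * (\<integral>\<^sup>+ x. ennreal (u (p z) x) * h (p z, x) \<partial>M2) \<partial>M1)
     = (\<integral>\<^sup>+ z. ennreal (F z) * (\<integral>\<^sup>+ x. ennreal (t z x) * h (p z, x) \<partial>M2) \<partial>M1)"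
    if h [measurable]: "h \<in> borel_measurable (count_space UNIV \<Otimes>\<^sub>M M2)" for h
  proof -
    have hj [measurable]: "(\<lambda>x. h (j, x)) \<in> borel_measurable M2" for j
      using measurable_compose[OF measurable_Pair1' h, of j] by simp
    have [measurable]: "(\<lambda>z. \<integral>\<^sup>+ x. ennreal (u (p z) x) * h (p z, x) \<partial>M2) \<in> borel_measurable M1"
      by (rule measurable_compose[OF p]) simp
    have "(\<integral>\<^sup>+ z. ennreal (F z) * (\<integral>\<^sup>+ x. ennreal (u (p z) x) * h (p z, x) \<partial>M2) \<partial>M1)
        = (\<Sum>j. \<integral>\<^sup>+ z. ennreal (F z) * (\<integral>\<^sup>+ x. ennreal (u (p z) x) * h (p z, x) \<partial>M2) * I j z \<partial>M1)"
      unfolding I_def by (rule nn_integral_countable_partition) measurable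
    also have "\<dots> = (\<Sum>j. \<integral>\<^sup>+ z. ennreal (F z) * (\<integral>\<^sup>+ x. ennreal (t z x) * h (p z, x) \<partial>M2) * I j z \<partial>M1)"
    proof (rule suminf_cong)
      fix j
      have "(\<integral>\<^sup>+ z. ennreal (F z) * (\<integral>\<^sup>+ x. ennreal (u (p z) x) * h (p z, x) \<partial>M2) * I j z \<partial>M1)
          = (\<integral>\<^sup>+ z. ennreal (F z) * I j z * (\<integral>\<^sup>+ x. ennreal (u j x) * h (j, x) \<partial>M2) \<partial>M1)"
        by (intro nn_integral_cong) (auto simp: I_def indicator_def)
      also have "\<dots> = q j * (\<integral>\<^sup>+ x. ennreal (u j x) * h (j, x) \<partial>M2)"
        unfolding q_def by (intro nn_integral_multc) measurable
      also have "\<dots> = (\<integral>\<^sup>+ x. q j * ennreal (u j x) * h (j, x) \<partial>M2)"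
        by (subst nn_integral_cmult[symmetric]) (auto simp: mult.assoc)
      also have "\<dots> = (\<integral>\<^sup>+ x. W j x * h (j, x) \<partial>M2)"
        using qu[of j] by (intro nn_integral_cong_AE) (auto elim!: eventually_mono)
      also have "\<dots> = (\<integral>\<^sup>+ x. (\<integral>\<^sup>+ z. ennreal (F z) * I j z * (ennreal (t z x) * h (j, x)) \<partial>M1) \<partial>M2)"
      proof (rule nn_integral_cong)
        fix x assume x: "x \<in> space M2"
        have [measurable]: "(\<lambda>z. t z x) \<in> borel_measurable M1"
          using measurable_compose[OF measurable_Pair2'[OF x] t_meas'] by simp
        show "W j x * h (j, x) = (\<integral>\<^sup>+ z. ennreal (F z) * I j z * (ennreal (t z x) * h (j, x)) \<partial>M1)"
          unfolding W_def by (subst nn_integral_multc[symmetric]) (auto simp: mult.assoc)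
      qed
      also have "\<dots> = (\<integral>\<^sup>+ z. ennreal (F z) * I j z * (\<integral>\<^sup>+ x. ennreal (t z x) * h (j, x) \<partial>M2) \<partial>M1)"
        by (rule swap) measurable
      also have "\<dots> = (\<integral>\<^sup>+ z. ennreal (F z) * (\<integral>\<^sup>+ x. ennreal (t z x) * h (p z, x) \<partial>M2) * I j z \<partial>M1)"
        by (intro nn_integral_cong) (auto simp: I_def indicator_def)
      finally show "(\<integral>\<^sup>+ z. ennreal (F z) * (\<integral>\<^sup>+ x. ennreal (u (p z) x) * h (p z, x) \<partial>M2) * I j z \<partial>M1)
          = (\<integral>\<^sup>+ z. ennreal (F z) * (\<integral>\<^sup>+ x. ennreal (t z x) * h (p z, x) \<partial>M2) * I j z \<partial>M1)" .
    qed
    also have "\<dots> = (\<integral>\<^sup>+ z. ennreal (F z) * (\<integral>\<^sup>+ x. ennreal (t z x) * h (p z, x) \<partial>M2) \<partial>M1)"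
      unfolding I_def by (rule nn_integral_countable_partition[symmetric]) measurable
    finally show ?thesis .
  qed
  ultimately show ?thesis by (intro that[of u] u)
qed

section \<open>Lower semi-continuity of sums\<close>

lemma lower_semicontinuous_compose:
  assumes "lower_semicontinuous f" "continuous_on UNIV g"
  shows "lower_semicontinuous (\<lambda>x. f (g x))"
  using open_vimage[OF assms(1)[unfolded lower_semicontinuous_def, rule_format] assms(2)]
  by (simp add: lower_semicontinuous_def vimage_def)

text \<open>Otherwise \<open>r + s \<le> t\<close> for all \<open>r\<close> below \<open>a\<close>
  and \<open>s\<close> below \<open>b\<close>, and density of the order lets first \<open>s\<close>
  rise to \<open>b\<close> and then \<open>r\<close> to \<open>a\<close>, contradicting
  \<open>t < a + b\<close>. Positivity makes 0 available below each summand, which justifies the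
  truncated subtractions.\<close>

lemma ennreal_less_add_split:
  fixes a b t :: ennreal
  assumes "t < a + b" "0 < a" "0 < b"
  obtains r s where "r < a" "s < b" "t < r + s"
proof (rule ccontr)
  assume *: "\<not> thesis"
  have le: "r + s \<le> t" if "r < a" "s < b" for r s using * that(1,2) \<open>\<And>r s. r < a \<Longrightarrow> s < b \<Longrightarrow> t < r + s \<Longrightarrow> thesis\<close> 
    by (metis not_le)
  have le': "r + b \<le> t" if r: "r < a" for r
  proof -
    have rt: "r \<le> t" using le[OF r assms(3)] by simp
    have "b \<le> t - r"
    proof (rule dense_le)
      fix s assume "s < b"
      from le[OF r this] have "s + r \<le> t" by (subst add.commute)
      then show "s \<le> t - r" by (simp add: ennreal_le_minus_iff)
    qed
    then have "b + r \<le> t - r + r" by (rule add_right_mono)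
    then show ?thesis unfolding diff_add_cancel_ennreal[OF rt] by (subst add.commute)
  qed
  have "a \<le> t - b"
  proof (rule dense_le)
    fix r assume "r < a"
    then show "r \<le> t - b" using le' by (simp add: ennreal_le_minus_iff)
  qed
  then have "a + b \<le> t - b + b" by (rule add_right_mono)
  also have "\<dots> = t" using le'[OF assms(2)] by (intro diff_add_cancel_ennreal) simp
  finally show False using assms(1) by (simp add: not_le[symmetric])
qed

text \<open>Where a summand is 0 no threshold lies strictly below it; there the other summand alone
  exceeds \<open>t\<close> on a neighbourhood. Elsewhere \<open>ennreal_less_add_split\<close> gives
  a threshold for each.\<close>

lemma lower_semicontinuous_add:
  fixes f g :: "'a::topological_space \<Rightarrow> ennreal"
  assumes f: "lower_semicontinuous f" and g: "lower_semicontinuous g"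
  shows "lower_semicontinuous (\<lambda>x. f x + g x)"
  unfolding lower_semicontinuous_def
proof (intro allI Topological_Spaces.openI)
  note fo = f[unfolded lower_semicontinuous_def, rule_format] and go = g[unfolded lower_semicontinuous_def, rule_format]
  fix t x assume "x \<in> {x. t < f x + g x}"
  then have t: "t < f x + g x" by simp
  consider "f x = 0" | "g x = 0" | "0 < f x" "0 < g x" by (auto simp: zero_less_iff_neq_zero)
  then show "\<exists>T. open T \<and> x \<in> T \<and> T \<subseteq> {x. t < f x + g x}"
  proof cases
    case 1
    then show ?thesis using t go[of t]
      by (intro exI[of _ "{x. t < g x}"]) (auto intro: order_less_le_trans)
  next
    case 2
    then show ?thesis using t fo[of t]
      by (intro exI[of _ "{x. t < f x}"]) (auto intro: order_less_le_trans)
  next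
    case 3
    obtain r s where "r < f x" "s < g x" "t < r + s" using ennreal_less_add_split[OF t 3] .
    then show ?thesis using fo[of r] go[of s]
      by (intro exI[of _ "{x. r < f x} \<inter> {x. s < g x}"])
        (auto intro: order_less_le_trans add_mono less_imp_le)
  qed
qed

text \<open>\<open>N\<close> draws \<open>(z, z')\<close> from \<open>N0\<close> and then
  \<open>(x, x')\<close> from \<open>K (p z) (p z')\<close>. The kernel depends on
  \<open>(z, z')\<close> through countably many values only, which makes it measurable for an
  arbitrary choice of the \<open>K i j\<close>.\<close>

lemma glue_couplings:
  fixes M1 :: "'a::second_countable_topology measure" and M2 :: "'b::second_countable_topology measure"
    and p :: "'a \<Rightarrow> nat"
  assumes M1: "prob_space M1" "sets M1 = sets borel" and M2: "prob_space M2" "sets M2 = sets borel"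
    and F: "prob_density M1 F" and G: "prob_density M1 G"
    and u: "\<And>j. prob_density M2 (u j)" and v: "\<And>j. prob_density M2 (v j)"
    and p [measurable]: "p \<in> M1 \<rightarrow>\<^sub>M count_space UNIV"
    and N0: "N0 \<in> couplings (density M1 (\<lambda>z. ennreal (F z))) (density M1 (\<lambda>z. ennreal (G z)))"
    and K: "\<And>i j. K i j \<in> couplings (density M2 (\<lambda>x. ennreal (u i x))) (density M2 (\<lambda>x. ennreal (v j x)))"
  obtains N :: "(('a \<times> 'b) \<times> ('a \<times> 'b)) measure" where "prob_space N" "sets N = sets borel"
    "\<And>h. h \<in> borel_measurable borel \<Longrightarrow>
       (\<integral>\<^sup>+ w. h (fst w) \<partial>N) = (\<integral>\<^sup>+ z. ennreal (F z) * (\<integral>\<^sup>+ x. ennreal (u (p z) x) * h (z, x) \<partial>M2) \<partial>M1)"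
    "\<And>h. h \<in> borel_measurable borel \<Longrightarrow>
       (\<integral>\<^sup>+ w. h (snd w) \<partial>N) = (\<integral>\<^sup>+ z. ennreal (G z) * (\<integral>\<^sup>+ x. ennreal (v (p z) x) * h (z, x) \<partial>M2) \<partial>M1)"
    "\<And>h. h \<in> borel_measurable borel \<Longrightarrow>
       (\<integral>\<^sup>+ w. h w \<partial>N) = (\<integral>\<^sup>+ w0. (\<integral>\<^sup>+ w1. h ((fst w0, fst w1), (snd w0, snd w1)) \<partial>K (p (fst w0)) (p (snd w0))) \<partial>N0)"
proof -
  interpret M1: prob_space M1 by fact
  interpret M2: prob_space M2 by fact
  note [measurable_cong] = M1(2) M2(2)
  note [measurable] = prob_densityD(1)[OF F] prob_densityD(1)[OF G] prob_densityD(1)[OF u] prob_densityD(1)[OF v]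
  have pK: "prob_space (K i j)" for i j by (rule prob_space_couplings[OF K prob_space_prob_density[OF u]])
  interpret N0: prob_space N0 by (rule prob_space_couplings[OF N0 prob_space_prob_density[OF F]])
  have sK: "sets (K i j) = sets borel" for i j
  proof -
    have "sets (K i j) = sets (M2 \<Otimes>\<^sub>M M2)" using K[of i j] by (simp add: couplings_def cong: sets_pair_measure_cong)
    then show ?thesis using sets_pair_measure_cong[OF M2(2) M2(2)] unfolding borel_prod by simp
  qed
  have sN0: "sets N0 = sets borel"
  proof -
    have "sets N0 = sets (M1 \<Otimes>\<^sub>M M1)" using N0 by (simp add: couplings_def cong: sets_pair_measure_cong)
    then show ?thesis using sets_pair_measure_cong[OF M1(2) M1(2)] unfolding borel_prod by simp
  qed
  note [measurable_cong] = sK sN0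
  have p_borel [measurable]: "p \<in> borel \<rightarrow>\<^sub>M count_space UNIV" using p by (simp cong: measurable_cong_sets add: M1(2))
  define Q where "Q w0 = K (p (fst w0)) (p (snd w0))" for w0
  \<comment> \<open>Turns \<open>((z, z'), (x, x'))\<close> into
    \<open>((z, x), (z', x'))\<close>.\<close>
  define T where "T w0 w1 = ((fst w0, fst w1), (snd w0, snd w1))" for w0 :: "'a \<times> 'a" and w1 :: "'b \<times> 'b"
  have Kij: "K i j \<in> space (subprob_algebra borel)" for i j
    using pK[of i j] sK by (simp add: space_subprob_algebra prob_space_imp_subprob_space)
  have Q_meas [measurable]: "Q \<in> N0 \<rightarrow>\<^sub>M subprob_algebra borel"
  proof -
    have 1: "(\<lambda>w. (p (fst w), p (snd w))) \<in> N0 \<rightarrow>\<^sub>M count_space UNIV \<Otimes>\<^sub>M count_space UNIV"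
      by measurable
    have 2: "(\<lambda>(i, j). K i j) \<in> count_space UNIV \<Otimes>\<^sub>M count_space UNIV \<rightarrow>\<^sub>M subprob_algebra borel"
      unfolding pair_measure_countable[OF countableI_type countableI_type] using Kij by auto
    show ?thesis using measurable_compose[OF 1 2] by (simp add: Q_def[abs_def])
  qed
  have T_meas: "case_prod T \<in> borel \<Otimes>\<^sub>M borel \<rightarrow>\<^sub>M borel"
    unfolding T_def case_prod_beta' by (intro borel_measurable_Pair) measurable
  have T_meas' [measurable]: "T w0 \<in> borel \<rightarrow>\<^sub>M borel" for w0
    unfolding T_def by (intro borel_measurable_Pair) measurable
  have T_meas2: "case_prod T \<in> N0 \<Otimes>\<^sub>M borel \<rightarrow>\<^sub>M borel"
    using T_meas by (simp cong: measurable_cong_sets sets_pair_measure_cong add: sN0)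
  define \<kappa> where "\<kappa> w0 = distr (Q w0) borel (T w0)" for w0
  have \<kappa>: "\<kappa> \<in> N0 \<rightarrow>\<^sub>M subprob_algebra borel"
    unfolding \<kappa>_def by (rule measurable_distr2[OF T_meas2 Q_meas])
  define N where "N = N0 \<bind> \<kappa>"
  have sN: "sets N = sets borel"
    unfolding N_def by (rule sets_bind_measurable[OF \<kappa> N0.not_empty])
  have N_int: "(\<integral>\<^sup>+ w. h w \<partial>N) = (\<integral>\<^sup>+ w0. (\<integral>\<^sup>+ w1. h (T w0 w1) \<partial>Q w0) \<partial>N0)"
    if h: "h \<in> borel_measurable borel" for h
  proof -
    have "T w0 \<in> Q w0 \<rightarrow>\<^sub>M borel" for w0
      using T_meas'[of w0] by (simp cong: measurable_cong_sets add: Q_def sK)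
    then show ?thesis
      unfolding N_def nn_integral_bind[OF h \<kappa>] \<kappa>_def using h by (intro nn_integral_cong nn_integral_distr) auto
  qed
  have spK: "emeasure (Q w0) (space (Q w0)) = 1" for w0
    unfolding Q_def by (rule prob_space.emeasure_space_1[OF pK])
  have "prob_space N"
    using N_int[of "\<lambda>_. 1"] spK N0.emeasure_space_1 by (intro prob_spaceI) simp
  moreover have "(\<integral>\<^sup>+ w. h (fst w) \<partial>N) = (\<integral>\<^sup>+ z. ennreal (F z) * (\<integral>\<^sup>+ x. ennreal (u (p z) x) * h (z, x) \<partial>M2) \<partial>M1)"
    if h: "h \<in> borel_measurable borel" for h
  proof -
    have hz [measurable]: "(\<lambda>x. h (z, x)) \<in> borel_measurable borel" for z
      by (rule measurable_compose[OF _ h]) (intro borel_measurable_Pair, auto)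
    have hp [measurable]: "h \<in> borel_measurable (M1 \<Otimes>\<^sub>M M2)"
      using h unfolding borel_prod[symmetric] by (simp cong: measurable_cong_sets sets_pair_measure_cong add: M1(2) M2(2))
    have [measurable]: "(\<lambda>w. u (p (fst w)) (snd w)) \<in> borel_measurable (M1 \<Otimes>\<^sub>M M2)"
      by (rule measurable_compose_countable[where g="\<lambda>w. p (fst w)"]) auto
    have H: "(\<lambda>z. \<integral>\<^sup>+ x. ennreal (u (p z) x) * h (z, x) \<partial>M2) \<in> borel_measurable M1"
      by (rule M2.borel_measurable_nn_integral) measurable
    have "(\<integral>\<^sup>+ w. h (fst w) \<partial>N) = (\<integral>\<^sup>+ w0. (\<integral>\<^sup>+ w1. h (fst w0, fst w1) \<partial>K (p (fst w0)) (p (snd w0))) \<partial>N0)"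
      by (subst N_int) (auto simp: T_def Q_def intro: measurable_compose[OF _ h])
    also have "\<dots> = (\<integral>\<^sup>+ w0. (\<integral>\<^sup>+ x. ennreal (u (p (fst w0)) x) * h (fst w0, x) \<partial>M2) \<partial>N0)"
      by (intro nn_integral_cong) (simp add: nn_integral_couplings(1)[OF K, where f="\<lambda>x. h (_, x)"] nn_integral_density)
    also have "\<dots> = (\<integral>\<^sup>+ z. (\<integral>\<^sup>+ x. ennreal (u (p z) x) * h (z, x) \<partial>M2) \<partial>density M1 (\<lambda>z. ennreal (F z)))"
      using H by (intro nn_integral_couplings(1)[OF N0]) simp
    also have "\<dots> = (\<integral>\<^sup>+ z. ennreal (F z) * (\<integral>\<^sup>+ x. ennreal (u (p z) x) * h (z, x) \<partial>M2) \<partial>M1)"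
      using H by (intro nn_integral_density) measurable
    finally show ?thesis .
  qed
  moreover have "(\<integral>\<^sup>+ w. h (snd w) \<partial>N) = (\<integral>\<^sup>+ z. ennreal (G z) * (\<integral>\<^sup>+ x. ennreal (v (p z) x) * h (z, x) \<partial>M2) \<partial>M1)"
    if h: "h \<in> borel_measurable borel" for h
  proof -
    have hz [measurable]: "(\<lambda>x. h (z, x)) \<in> borel_measurable borel" for z
      by (rule measurable_compose[OF _ h]) (intro borel_measurable_Pair, auto)
    have hp [measurable]: "h \<in> borel_measurable (M1 \<Otimes>\<^sub>M M2)"
      using h unfolding borel_prod[symmetric] by (simp cong: measurable_cong_sets sets_pair_measure_cong add: M1(2) M2(2))
    have [measurable]: "(\<lambda>w. v (p (fst w)) (snd w)) \<in> borel_measurable (M1 \<Otimes>\<^sub>M M2)"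
      by (rule measurable_compose_countable[where g="\<lambda>w. p (fst w)"]) auto
    have H: "(\<lambda>z. \<integral>\<^sup>+ x. ennreal (v (p z) x) * h (z, x) \<partial>M2) \<in> borel_measurable M1"
      by (rule M2.borel_measurable_nn_integral) measurable
    have "(\<integral>\<^sup>+ w. h (snd w) \<partial>N) = (\<integral>\<^sup>+ w0. (\<integral>\<^sup>+ w1. h (snd w0, snd w1) \<partial>K (p (fst w0)) (p (snd w0))) \<partial>N0)"
      by (subst N_int) (auto simp: T_def Q_def intro: measurable_compose[OF _ h])
    also have "\<dots> = (\<integral>\<^sup>+ w0. (\<integral>\<^sup>+ x. ennreal (v (p (snd w0)) x) * h (snd w0, x) \<partial>M2) \<partial>N0)"
      by (intro nn_integral_cong) (simp add: nn_integral_couplings(2)[OF K, where g="\<lambda>x. h (_, x)"] nn_integral_density)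
    also have "\<dots> = (\<integral>\<^sup>+ z. (\<integral>\<^sup>+ x. ennreal (v (p z) x) * h (z, x) \<partial>M2) \<partial>density M1 (\<lambda>z. ennreal (G z)))"
      using H by (intro nn_integral_couplings(2)[OF N0]) simp
    also have "\<dots> = (\<integral>\<^sup>+ z. ennreal (G z) * (\<integral>\<^sup>+ x. ennreal (v (p z) x) * h (z, x) \<partial>M2) \<partial>M1)"
      using H by (intro nn_integral_density) measurable
    finally show ?thesis .
  qed
  moreover have "(\<integral>\<^sup>+ w. h w \<partial>N) = (\<integral>\<^sup>+ w0. (\<integral>\<^sup>+ w1. h ((fst w0, fst w1), (snd w0, snd w1)) \<partial>K (p (fst w0)) (p (snd w0))) \<partial>N0)"
    if "h \<in> borel_measurable borel" for h
    using N_int[OF that] by (simp add: T_def Q_def)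
  ultimately show ?thesis using sN by (intro that[of N])
qed

text \<open>\<open>density_entropy_mult_ge\<close> on each fibre, integrated over the first factor:
  marginal entropy plus mean conditional entropy.\<close>

lemma density_entropy_pair_ge:
  assumes "prob_space M1" "prob_space M2" and [measurable]: "f \<in> borel_measurable (M1 \<Otimes>\<^sub>M M2)"
    and F: "prob_density M1 F" and t_meas: "case_prod t \<in> borel_measurable (M1 \<Otimes>\<^sub>M M2)"
    and t: "\<And>z. z \<in> space M1 \<Longrightarrow> prob_density M2 (t z)"
    and f: "AE w in M1 \<Otimes>\<^sub>M M2. f w = F (fst w) * t (fst w) (snd w)"
  shows "density_entropy M1 F + (\<integral>\<^sup>+ z. ennreal (F z) * density_entropy M2 (t z) \<partial>M1) \<le> density_entropy (M1 \<Otimes>\<^sub>M M2) f"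
proof -
  interpret M1: prob_space M1 by fact
  interpret M2: prob_space M2 by fact
  note [measurable] = prob_densityD(1)[OF F]
  have [measurable]: "(\<lambda>w. t (fst w) (snd w)) \<in> borel_measurable (M1 \<Otimes>\<^sub>M M2)"
    using t_meas by (simp add: case_prod_beta')
  have [measurable]: "(\<lambda>z. density_entropy M2 (t z)) \<in> borel_measurable M1" unfolding density_entropy_def by measurable
  have "density_entropy M1 F + (\<integral>\<^sup>+ z. ennreal (F z) * density_entropy M2 (t z) \<partial>M1)
      = (\<integral>\<^sup>+ z. ennreal (entropy_fun (F z)) + ennreal (F z) * density_entropy M2 (t z) \<partial>M1)"
    unfolding density_entropy_def[of M1] by (intro nn_integral_add[symmetric]) measurable
  also have "\<dots> \<le> (\<integral>\<^sup>+ z. (\<integral>\<^sup>+ x. ennreal (entropy_fun (F z * t z x)) \<partial>M2) \<partial>M1)"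
  proof (rule nn_integral_mono)
    fix z assume "z \<in> space M1"
    then show "ennreal (entropy_fun (F z)) + ennreal (F z) * density_entropy M2 (t z) \<le> (\<integral>\<^sup>+ x. ennreal (entropy_fun (F z * t z x)) \<partial>M2)"
      using density_entropy_mult_ge[OF assms(2) prob_densityD[OF t] prob_densityD(2)[OF F]] by (simp add: density_entropy_def)
  qed
  also have "\<dots> = (\<integral>\<^sup>+ w. ennreal (entropy_fun (F (fst w) * t (fst w) (snd w))) \<partial>(M1 \<Otimes>\<^sub>M M2))"
    by (subst M2.nn_integral_fst[symmetric]) auto
  also have "\<dots> = density_entropy (M1 \<Otimes>\<^sub>M M2) f"
    unfolding density_entropy_def using f by (intro nn_integral_cong_AE) (auto elim!: eventually_mono)
  finally show ?thesis .
qed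

text \<open>Keeps the exact first marginal \<open>F\<close> but replaces the conditional laws by
  countably many. The price is the last clause: the law of \<open>(p z, x)\<close>, not that of
  \<open>(z, x)\<close>, is reproduced. The chain rule bound is kept.\<close>

lemma discretize_prob_density:
  fixes p :: "'a \<Rightarrow> nat"
  assumes "prob_space M1" "prob_space M2" and f: "prob_density (M1 \<Otimes>\<^sub>M M2) f"
    and p [measurable]: "p \<in> M1 \<rightarrow>\<^sub>M count_space UNIV"
  obtains F u where "prob_density M1 F" "\<And>j. prob_density M2 (u j)"
    "density_entropy M1 F + (\<integral>\<^sup>+ z. ennreal (F z) * density_entropy M2 (u (p z)) \<partial>M1) \<le> density_entropy (M1 \<Otimes>\<^sub>M M2) f"
    "\<And>E. E \<in> sets (count_space UNIV \<Otimes>\<^sub>M M2) \<Longrightarrow>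
       (\<integral>\<^sup>+ z. ennreal (F z) * (\<integral>\<^sup>+ x. ennreal (u (p z) x) * indicator E (p z, x) \<partial>M2) \<partial>M1)
     = emeasure (density (M1 \<Otimes>\<^sub>M M2) (\<lambda>w. ennreal (f w))) {w \<in> space (M1 \<Otimes>\<^sub>M M2). (p (fst w), snd w) \<in> E}"
proof -
  interpret M1: prob_space M1 by fact
  interpret M2: prob_space M2 by fact
  obtain F t where F: "prob_density M1 F" and t_meas: "case_prod t \<in> borel_measurable (M1 \<Otimes>\<^sub>M M2)"
    and t: "\<And>z. z \<in> space M1 \<Longrightarrow> prob_density M2 (t z)" and t0: "\<And>z x. 0 \<le> t z x"
    and fFt: "AE w in M1 \<Otimes>\<^sub>M M2. f w = F (fst w) * t (fst w) (snd w)"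
    using disintegrate_prob_density[OF assms(1-3)] by blast
  obtain u where u: "\<And>j. prob_density M2 (u j)"
    and u_ent: "(\<integral>\<^sup>+ z. ennreal (F z) * density_entropy M2 (u (p z)) \<partial>M1) \<le> (\<integral>\<^sup>+ z. ennreal (F z) * density_entropy M2 (t z) \<partial>M1)"
    and u_h: "\<And>h. h \<in> borel_measurable (count_space UNIV \<Otimes>\<^sub>M M2) \<Longrightarrow>
       (\<integral>\<^sup>+ z. ennreal (F z) * (\<integral>\<^sup>+ x. ennreal (u (p z) x) * h (p z, x) \<partial>M2) \<partial>M1)
     = (\<integral>\<^sup>+ z. ennreal (F z) * (\<integral>\<^sup>+ x. ennreal (t z x) * h (p z, x) \<partial>M2) \<partial>M1)"
    using average_kernel[OF assms(1,2) F t_meas t t0 p] by blast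
  note [measurable] = prob_densityD(1)[OF F] prob_densityD(1)[OF f]
  have t_meas' [measurable]: "(\<lambda>w. t (fst w) (snd w)) \<in> borel_measurable (M1 \<Otimes>\<^sub>M M2)"
    using t_meas by (simp add: case_prod_beta')
  show ?thesis
  proof (rule that[OF F u])
    show "density_entropy M1 F + (\<integral>\<^sup>+ z. ennreal (F z) * density_entropy M2 (u (p z)) \<partial>M1) \<le> density_entropy (M1 \<Otimes>\<^sub>M M2) f"
      using add_left_mono[OF u_ent, of "density_entropy M1 F"] density_entropy_pair_ge[OF assms(1,2) prob_densityD(1)[OF f] F t_meas t fFt]
      by (rule order.trans)
  next
    fix E :: "(nat \<times> 'b) set" assume E [measurable]: "E \<in> sets (count_space UNIV \<Otimes>\<^sub>M M2)"
    have [measurable]: "(\<lambda>w. indicator E (p (fst w), snd w) :: ennreal) \<in> borel_measurable (M1 \<Otimes>\<^sub>M M2)"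
      by (rule measurable_compose[where N="count_space UNIV \<Otimes>\<^sub>M M2"]) measurable
    have "(\<integral>\<^sup>+ z. ennreal (F z) * (\<integral>\<^sup>+ x. ennreal (u (p z) x) * indicator E (p z, x) \<partial>M2) \<partial>M1)
        = (\<integral>\<^sup>+ z. ennreal (F z) * (\<integral>\<^sup>+ x. ennreal (t z x) * indicator E (p z, x) \<partial>M2) \<partial>M1)"
      by (rule u_h) measurable
    also have "\<dots> = (\<integral>\<^sup>+ z. (\<integral>\<^sup>+ x. ennreal (F z) * (ennreal (t z x) * indicator E (p z, x)) \<partial>M2) \<partial>M1)"
    proof (rule nn_integral_cong)
      fix z assume z: "z \<in> space M1"
      note [measurable] = prob_densityD(1)[OF t[OF z]]
      have [measurable]: "(\<lambda>x. indicator E (p z, x) :: ennreal) \<in> borel_measurable M2"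
        by (rule measurable_compose[where N="count_space UNIV \<Otimes>\<^sub>M M2"]) measurable
      have "(\<lambda>x. ennreal (t z x) * indicator E (p z, x)) \<in> borel_measurable M2"
        by measurable
      then show "ennreal (F z) * (\<integral>\<^sup>+ x. ennreal (t z x) * indicator E (p z, x) \<partial>M2)
          = (\<integral>\<^sup>+ x. ennreal (F z) * (ennreal (t z x) * indicator E (p z, x)) \<partial>M2)"
        by (rule nn_integral_cmult[symmetric])
    qed
    also have "\<dots> = (\<integral>\<^sup>+ w. ennreal (F (fst w)) * (ennreal (t (fst w) (snd w)) * indicator E (p (fst w), snd w)) \<partial>(M1 \<Otimes>\<^sub>M M2))"
      by (subst M2.nn_integral_fst[symmetric]) auto
    also have "\<dots> = (\<integral>\<^sup>+ w. ennreal (f w) * indicator {w \<in> space (M1 \<Otimes>\<^sub>M M2). (p (fst w), snd w) \<in> E} w \<partial>(M1 \<Otimes>\<^sub>M M2))"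
      using fFt AE_space
      by (intro nn_integral_cong_AE, eventually_elim)
        (auto simp: ennreal_mult' prob_densityD(2)[OF F] indicator_def)
    also have "\<dots> = emeasure (density (M1 \<Otimes>\<^sub>M M2) (\<lambda>w. ennreal (f w))) {w \<in> space (M1 \<Otimes>\<^sub>M M2). (p (fst w), snd w) \<in> E}"
      by (intro emeasure_density[symmetric]) measurable
    finally show "(\<integral>\<^sup>+ z. ennreal (F z) * (\<integral>\<^sup>+ x. ennreal (u (p z) x) * indicator E (p z, x) \<partial>M2) \<partial>M1) = \<dots>" .
  qed
qed

lemma sets_pair_borel:
  fixes M1 :: "'a::second_countable_topology measure" and M2 :: "'b::second_countable_topology measure"
  assumes "sets M1 = sets borel" "sets M2 = sets borel"
  shows "sets (M1 \<Otimes>\<^sub>M M2) = sets borel"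
  using sets_pair_measure_cong[OF assms] unfolding borel_prod .

text \<open>Near-optimal couplings are chosen only for the countably many pairs of averaged kernels, so no
  measurable selection theorem is involved.\<close>

lemma density_te_pair_partition:
  fixes M1 :: "'a::second_countable_topology measure" and M2 :: "'b::second_countable_topology measure"
    and p :: "'a \<Rightarrow> nat"
  assumes M1: "prob_space M1" "sets M1 = sets borel" and M2: "prob_space M2" "sets M2 = sets borel"
    and c1 [measurable]: "c1 \<in> borel_measurable borel" and c2 [measurable]: "c2 \<in> borel_measurable borel"
    and te1: "density_te M1 c1 a1 a2" and te2: "density_te M2 c2 a1 a2"
    and f: "prob_density (M1 \<Otimes>\<^sub>M M2) f" and g: "prob_density (M1 \<Otimes>\<^sub>M M2) g"
    and p [measurable]: "p \<in> M1 \<rightarrow>\<^sub>M count_space UNIV" and e: "0 < (e :: ennreal)"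
  obtains N :: "(('a \<times> 'b) \<times> ('a \<times> 'b)) measure" where "prob_space N" "sets N = sets borel"
    "\<And>E. E \<in> sets (count_space UNIV \<Otimes>\<^sub>M M2) \<Longrightarrow> emeasure N {w. (p (fst (fst w)), snd (fst w)) \<in> E}
       = emeasure (density (M1 \<Otimes>\<^sub>M M2) (\<lambda>w. ennreal (f w))) {w. (p (fst w), snd w) \<in> E}"
    "\<And>E. E \<in> sets (count_space UNIV \<Otimes>\<^sub>M M2) \<Longrightarrow> emeasure N {w. (p (fst (snd w)), snd (snd w)) \<in> E}
       = emeasure (density (M1 \<Otimes>\<^sub>M M2) (\<lambda>w. ennreal (g w))) {w. (p (fst w), snd w) \<in> E}"
    "(\<integral>\<^sup>+ w. c1 (fst (fst w), fst (snd w)) + c2 (snd (fst w), snd (snd w)) \<partial>N)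
       \<le> a1 * density_entropy (M1 \<Otimes>\<^sub>M M2) f + a2 * density_entropy (M1 \<Otimes>\<^sub>M M2) g + (e + e)"
proof -
  interpret M1: prob_space M1 by fact
  interpret M2: prob_space M2 by fact
  obtain F u where F: "prob_density M1 F" and u: "\<And>j. prob_density M2 (u j)"
    and Fu_ent: "density_entropy M1 F + (\<integral>\<^sup>+ z. ennreal (F z) * density_entropy M2 (u (p z)) \<partial>M1) \<le> density_entropy (M1 \<Otimes>\<^sub>M M2) f"
    and Fu: "\<And>E. E \<in> sets (count_space UNIV \<Otimes>\<^sub>M M2) \<Longrightarrow>
       (\<integral>\<^sup>+ z. ennreal (F z) * (\<integral>\<^sup>+ x. ennreal (u (p z) x) * indicator E (p z, x) \<partial>M2) \<partial>M1)
     = emeasure (density (M1 \<Otimes>\<^sub>M M2) (\<lambda>w. ennreal (f w))) {w \<in> space (M1 \<Otimes>\<^sub>M M2). (p (fst w), snd w) \<in> E}"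
    by (rule discretize_prob_density[OF M1(1) M2(1) f p]) blast
  obtain G v where G: "prob_density M1 G" and v: "\<And>j. prob_density M2 (v j)"
    and Gv_ent: "density_entropy M1 G + (\<integral>\<^sup>+ z. ennreal (G z) * density_entropy M2 (v (p z)) \<partial>M1) \<le> density_entropy (M1 \<Otimes>\<^sub>M M2) g"
    and Gv: "\<And>E. E \<in> sets (count_space UNIV \<Otimes>\<^sub>M M2) \<Longrightarrow>
       (\<integral>\<^sup>+ z. ennreal (G z) * (\<integral>\<^sup>+ x. ennreal (v (p z) x) * indicator E (p z, x) \<partial>M2) \<partial>M1)
     = emeasure (density (M1 \<Otimes>\<^sub>M M2) (\<lambda>w. ennreal (g w))) {w \<in> space (M1 \<Otimes>\<^sub>M M2). (p (fst w), snd w) \<in> E}"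
    by (rule discretize_prob_density[OF M1(1) M2(1) g p]) blast
  obtain N0 where N0: "N0 \<in> couplings (density M1 (\<lambda>z. ennreal (F z))) (density M1 (\<lambda>z. ennreal (G z)))"
    and N0_c: "(\<integral>\<^sup>+ w. c1 w \<partial>N0) \<le> a1 * density_entropy M1 F + a2 * density_entropy M1 G + e"
    by (rule density_te_coupling[OF te1 F G e])
  have "\<exists>K. K \<in> couplings (density M2 (\<lambda>x. ennreal (u i x))) (density M2 (\<lambda>x. ennreal (v j x))) \<and>
      (\<integral>\<^sup>+ w. c2 w \<partial>K) \<le> a1 * density_entropy M2 (u i) + a2 * density_entropy M2 (v j) + e" for i j
    by (rule density_te_coupling[OF te2 u v e]) blast
  then obtain K where K: "\<And>i j. K i j \<in> couplings (density M2 (\<lambda>x. ennreal (u i x))) (density M2 (\<lambda>x. ennreal (v j x)))"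
    and K_c: "\<And>i j. (\<integral>\<^sup>+ w. c2 w \<partial>K i j) \<le> a1 * density_entropy M2 (u i) + a2 * density_entropy M2 (v j) + e"
    by metis
  obtain N :: "(('a \<times> 'b) \<times> ('a \<times> 'b)) measure" where N: "prob_space N" "sets N = sets borel"
    and N_fst: "\<And>h. h \<in> borel_measurable borel \<Longrightarrow>
       (\<integral>\<^sup>+ w. h (fst w) \<partial>N) = (\<integral>\<^sup>+ z. ennreal (F z) * (\<integral>\<^sup>+ x. ennreal (u (p z) x) * h (z, x) \<partial>M2) \<partial>M1)"
    and N_snd: "\<And>h. h \<in> borel_measurable borel \<Longrightarrow>
       (\<integral>\<^sup>+ w. h (snd w) \<partial>N) = (\<integral>\<^sup>+ z. ennreal (G z) * (\<integral>\<^sup>+ x. ennreal (v (p z) x) * h (z, x) \<partial>M2) \<partial>M1)"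
    and N_int: "\<And>h. h \<in> borel_measurable borel \<Longrightarrow>
       (\<integral>\<^sup>+ w. h w \<partial>N) = (\<integral>\<^sup>+ w0. (\<integral>\<^sup>+ w1. h ((fst w0, fst w1), (snd w0, snd w1)) \<partial>K (p (fst w0)) (p (snd w0))) \<partial>N0)"
    by (rule glue_couplings[where u = u and v = v and K = K, OF M1 M2 F G u v p N0 K]) blast
  have sp: "space M1 = UNIV" "space M2 = UNIV" "space N = UNIV"
    using sets_eq_imp_space_eq[OF M1(2)] sets_eq_imp_space_eq[OF M2(2)] sets_eq_imp_space_eq[OF N(2)] by auto
  note [measurable_cong] = N(2)
  have pE: "{w. (p (fst w), snd w) \<in> E} \<in> sets borel" if "E \<in> sets (count_space UNIV \<Otimes>\<^sub>M M2)" for E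
  proof -
    have "(\<lambda>w. (p (fst w), snd w)) \<in> M1 \<Otimes>\<^sub>M M2 \<rightarrow>\<^sub>M count_space UNIV \<Otimes>\<^sub>M M2" by measurable
    from measurable_sets[OF this that] show ?thesis
      by (simp add: sets_pair_borel[OF M1(2) M2(2)] space_pair_measure sp vimage_def)
  qed
  have N_eq: "emeasure N {w. (p (fst (\<pi> w)), snd (\<pi> w)) \<in> E} = (\<integral>\<^sup>+ w. indicator {w. (p (fst w), snd w) \<in> E} (\<pi> w) \<partial>N)"
    if \<pi>: "\<pi> \<in> borel_measurable borel" and E: "E \<in> sets (count_space UNIV \<Otimes>\<^sub>M M2)" for E and \<pi> :: "('a \<times> 'b) \<times> ('a \<times> 'b) \<Rightarrow> 'a \<times> 'b"
  proof -
    have "(\<integral>\<^sup>+ w. indicator {w. (p (fst w), snd w) \<in> E} (\<pi> w) \<partial>N) = (\<integral>\<^sup>+ w. indicator {w. (p (fst (\<pi> w)), snd (\<pi> w)) \<in> E} w \<partial>N)"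
      by (intro nn_integral_cong) (simp add: indicator_def)
    also have "\<dots> = emeasure N {w. (p (fst (\<pi> w)), snd (\<pi> w)) \<in> E}"
      using measurable_sets[OF \<pi> pE[OF E]] by (intro nn_integral_indicator) (simp add: N(2) vimage_def)
    finally show ?thesis ..
  qed
  show ?thesis
  proof (rule that[OF N])
    fix E :: "(nat \<times> 'b) set" assume E: "E \<in> sets (count_space UNIV \<Otimes>\<^sub>M M2)"
    have i: "(indicator {w. (p (fst w), snd w) \<in> E} (z, x) :: ennreal) = indicator E (p z, x)" for z x
      by (simp add: indicator_def)
    have im: "(indicator {w. (p (fst w), snd w) \<in> E} :: _ \<Rightarrow> ennreal) \<in> borel_measurable borel"
      using pE[OF E] by (rule borel_measurable_indicator)
    show "emeasure N {w. (p (fst (fst w)), snd (fst w)) \<in> E}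
       = emeasure (density (M1 \<Otimes>\<^sub>M M2) (\<lambda>w. ennreal (f w))) {w. (p (fst w), snd w) \<in> E}"
      using Fu[OF E] by (simp add: N_eq[OF borel_measurable_fst_snd(1) E] N_fst[OF im] i space_pair_measure sp)
    show "emeasure N {w. (p (fst (snd w)), snd (snd w)) \<in> E}
       = emeasure (density (M1 \<Otimes>\<^sub>M M2) (\<lambda>w. ennreal (g w))) {w. (p (fst w), snd w) \<in> E}"
      using Gv[OF E] by (simp add: N_eq[OF borel_measurable_fst_snd(2) E] N_snd[OF im] i space_pair_measure sp)
  next
    interpret N0: prob_space N0 by (rule prob_space_couplings[OF N0 prob_space_prob_density[OF F]])
    note [measurable] = prob_densityD(1)[OF F] prob_densityD(1)[OF G]
    have sN0: "sets N0 = sets borel"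
      using N0 sets_pair_borel[OF M1(2) M1(2)] by (simp add: couplings_def cong: sets_pair_measure_cong)
    have sK: "sets (K i j) = sets borel" for i j
      using K[of i j] sets_pair_borel[OF M2(2) M2(2)] by (simp add: couplings_def cong: sets_pair_measure_cong)
    note [measurable_cong] = sN0 sK M1(2) M2(2)
    have pK: "prob_space (K i j)" for i j by (rule prob_space_couplings[OF K prob_space_prob_density[OF u]])
    have eu: "(\<lambda>z. density_entropy M2 (u (p z))) \<in> borel_measurable M1" and ev: "(\<lambda>z. density_entropy M2 (v (p z))) \<in> borel_measurable M1"
      by (rule measurable_compose[OF p], simp)+
    have eu' [measurable]: "(\<lambda>w. density_entropy M2 (u (p (fst w)))) \<in> borel_measurable N0"
      and ev' [measurable]: "(\<lambda>w. density_entropy M2 (v (p (snd w)))) \<in> borel_measurable N0"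
      using measurable_compose[OF measurable_couplings(1)[OF N0], of "\<lambda>z. density_entropy M2 (u (p z))" borel]
        measurable_compose[OF measurable_couplings(2)[OF N0], of "\<lambda>z. density_entropy M2 (v (p z))" borel] eu ev by simp_all
    have "(\<integral>\<^sup>+ w. c1 (fst (fst w), fst (snd w)) + c2 (snd (fst w), snd (snd w)) \<partial>N)
        = (\<integral>\<^sup>+ w0. (\<integral>\<^sup>+ w1. c1 w0 + c2 w1 \<partial>K (p (fst w0)) (p (snd w0))) \<partial>N0)"
    proof (subst N_int)
      have "(\<lambda>w. (fst (fst w), fst (snd w))) \<in> borel_measurable (borel :: (('a \<times> 'b) \<times> ('a \<times> 'b)) measure)"
        "(\<lambda>w. (snd (fst w), snd (snd w))) \<in> borel_measurable (borel :: (('a \<times> 'b) \<times> ('a \<times> 'b)) measure)"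
        by (intro borel_measurable_Pair measurable_compose[OF borel_measurable_fst_snd(1)]
            measurable_compose[OF borel_measurable_fst_snd(2)] borel_measurable_fst_snd)+
      then show "(\<lambda>w. c1 (fst (fst w), fst (snd w)) + c2 (snd (fst w), snd (snd w))) \<in> borel_measurable (borel :: (('a \<times> 'b) \<times> ('a \<times> 'b)) measure)"
        by (intro borel_measurable_add measurable_compose[OF _ c1] measurable_compose[OF _ c2])
    qed simp
    also have "\<dots> = (\<integral>\<^sup>+ w0. c1 w0 + (\<integral>\<^sup>+ w1. c2 w1 \<partial>K (p (fst w0)) (p (snd w0))) \<partial>N0)"
      by (intro nn_integral_cong, subst nn_integral_add) (simp_all add: prob_space.emeasure_space_1[OF pK])
    \<comment> \<open>The conditional cost is bounded by the entropies of the averaged kernels; each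
      depends on one coordinate under \<open>N0\<close> only, so its mean is computed from a
      marginal of \<open>N0\<close>.\<close>
    also have "\<dots> \<le> (\<integral>\<^sup>+ w0. c1 w0 + (a1 * density_entropy M2 (u (p (fst w0))) + a2 * density_entropy M2 (v (p (snd w0))) + e) \<partial>N0)"
      by (intro nn_integral_mono add_left_mono K_c)
    also have "\<dots> = (\<integral>\<^sup>+ w0. c1 w0 \<partial>N0) + (a1 * (\<integral>\<^sup>+ w0. density_entropy M2 (u (p (fst w0))) \<partial>N0) + a2 * (\<integral>\<^sup>+ w0. density_entropy M2 (v (p (snd w0))) \<partial>N0) + e)"
      by (simp add: nn_integral_add nn_integral_cmult N0.emeasure_space_1)
    also have "(\<integral>\<^sup>+ w0. density_entropy M2 (u (p (fst w0))) \<partial>N0) = (\<integral>\<^sup>+ z. ennreal (F z) * density_entropy M2 (u (p z)) \<partial>M1)"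
      using eu by (simp add: nn_integral_couplings(1)[OF N0, of "\<lambda>z. density_entropy M2 (u (p z))"] nn_integral_density)
    also have "(\<integral>\<^sup>+ w0. density_entropy M2 (v (p (snd w0))) \<partial>N0) = (\<integral>\<^sup>+ z. ennreal (G z) * density_entropy M2 (v (p z)) \<partial>M1)"
      using ev by (simp add: nn_integral_couplings(2)[OF N0, of "\<lambda>z. density_entropy M2 (v (p z))"] nn_integral_density)
    also have "(\<integral>\<^sup>+ w0. c1 w0 \<partial>N0) + (a1 * (\<integral>\<^sup>+ z. ennreal (F z) * density_entropy M2 (u (p z)) \<partial>M1) + a2 * (\<integral>\<^sup>+ z. ennreal (G z) * density_entropy M2 (v (p z)) \<partial>M1) + e)
       \<le> (a1 * density_entropy M1 F + a2 * density_entropy M1 G + e) + (a1 * (\<integral>\<^sup>+ z. ennreal (F z) * density_entropy M2 (u (p z)) \<partial>M1) + a2 * (\<integral>\<^sup>+ z. ennreal (G z) * density_entropy M2 (v (p z)) \<partial>M1) + e)"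
      by (rule add_right_mono[OF N0_c])
    \<comment> \<open>Regrouped by law, each bracket is what the chain rule bounds; one slack comes
      from \<open>N0\<close>, the other from the \<open>K i j\<close>.\<close>
    also have "\<dots> = a1 * (density_entropy M1 F + (\<integral>\<^sup>+ z. ennreal (F z) * density_entropy M2 (u (p z)) \<partial>M1)) + a2 * (density_entropy M1 G + (\<integral>\<^sup>+ z. ennreal (G z) * density_entropy M2 (v (p z)) \<partial>M1)) + (e + e)"
      by (simp add: distrib_left ac_simps)
    also have "\<dots> \<le> a1 * density_entropy (M1 \<Otimes>\<^sub>M M2) f + a2 * density_entropy (M1 \<Otimes>\<^sub>M M2) g + (e + e)"
      by (intro add_mono mult_left_mono Fu_ent Gv_ent) auto
    finally show "(\<integral>\<^sup>+ w. c1 (fst (fst w), fst (snd w)) + c2 (snd (fst w), snd (snd w)) \<partial>N) \<le> \<dots>" .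
  qed
qed

lemma ex_basis_sequence:
  obtains B :: "nat \<Rightarrow> 'a::second_countable_topology set" where "topological_basis (range B)"
proof -
  obtain \<B> :: "'a set set" where \<B>: "countable \<B>" "topological_basis \<B>" using ex_countable_basis by blast
  have "\<B> \<noteq> {}" using topological_basisE[OF \<B>(2) open_UNIV UNIV_I] by blast
  then have "range (from_nat_into \<B>) = \<B>" using \<B>(1) by (rule range_from_nat_into)
  then show ?thesis using that[of "from_nat_into \<B>"] \<B>(2) by simp
qed

text \<open>The couplings over a partition have the right law only for \<open>(p k z, x)\<close>.
  With \<open>p k\<close> recording membership in the first \<open>k\<close> basic sets, any finite
  family of basic rectangles is decided by \<open>(p k z, x)\<close> for large \<open>k\<close>, as
  \<open>transport_cost_le_limit\<close> requires.\<close>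

lemma density_te_pair:
  fixes M1 :: "'a::{complete_space, second_countable_topology} measure"
    and M2 :: "'b::{complete_space, second_countable_topology} measure"
  assumes M1: "prob_space M1" "sets M1 = sets borel" and M2: "prob_space M2" "sets M2 = sets borel"
    and c1: "lower_semicontinuous c1" and c2: "lower_semicontinuous c2"
    and te1: "density_te M1 c1 a1 a2" and te2: "density_te M2 c2 a1 a2"
  shows "density_te (M1 \<Otimes>\<^sub>M M2) (\<lambda>w. c1 (fst (fst w), fst (snd w)) + c2 (snd (fst w), snd (snd w))) a1 a2"
  unfolding density_te_def
proof (intro allI impI)
  fix f g assume f: "prob_density (M1 \<Otimes>\<^sub>M M2) f" and g: "prob_density (M1 \<Otimes>\<^sub>M M2) g"
  let ?C = "a1 * density_entropy (M1 \<Otimes>\<^sub>M M2) f + a2 * density_entropy (M1 \<Otimes>\<^sub>M M2) g"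
  let ?c = "\<lambda>w. c1 (fst (fst w), fst (snd w)) + c2 (snd (fst w), snd (snd w))"
  let ?P = "density (M1 \<Otimes>\<^sub>M M2) (\<lambda>w. ennreal (f w))" and ?Q = "density (M1 \<Otimes>\<^sub>M M2) (\<lambda>w. ennreal (g w))"
  have sp: "space M1 = UNIV" "space M2 = UNIV"
    using sets_eq_imp_space_eq[OF M1(2)] sets_eq_imp_space_eq[OF M2(2)] by auto
  obtain BA :: "nat \<Rightarrow> 'a set" where BA: "topological_basis (range BA)" by (rule ex_basis_sequence)
  obtain BB :: "nat \<Rightarrow> 'b set" where BB: "topological_basis (range BB)" by (rule ex_basis_sequence)
  define U where "U i = BA (fst (prod_decode i)) \<times> BB (snd (prod_decode i))" for i
  have "range U = (\<lambda>(a, b). a \<times> b) ` (range BA \<times> range BB)"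
  proof
    show "(\<lambda>(a, b). a \<times> b) ` (range BA \<times> range BB) \<subseteq> range U"
    proof clarify
      fix i j show "BA i \<times> BB j \<in> range U" by (rule range_eqI[of _ _ "prod_encode (i, j)"]) (simp add: U_def)
    qed
  qed (auto simp: U_def)
  then have U: "topological_basis (range U)" using topological_basis_prod[OF BA BB] by simp
  have BA_meas: "BA i \<in> sets M1" for i using BA by (auto simp: M1 topological_basis_def)
  have BB_meas: "BB i \<in> sets M2" for i using BB by (auto simp: M2 topological_basis_def)
  \<comment> \<open>A finite set of indices coded as one natural number, so that cells are indexed
    by \<open>nat\<close>; \<open>set_decode\<close> recovers the memberships.\<close>
  define p where "p k z = set_encode {i. i < k \<and> z \<in> BA i}" for k z
  have p_dec: "set_decode (p k z) = {i. i < k \<and> z \<in> BA i}" for k z by (simp add: p_def)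
  have p_meas: "p k \<in> M1 \<rightarrow>\<^sub>M count_space UNIV" for k
    unfolding measurable_count_space_eq2_countable
  proof (intro conjI ballI)
    fix a
    have "p k z = a \<longleftrightarrow> (\<forall>i. (i < k \<and> z \<in> BA i) = (i \<in> set_decode a))" for z
      using p_dec[of k z] by (metis (mono_tags, lifting) Collect_cong Collect_mem_eq mem_Collect_eq p_def set_decode_inverse)
    then have "p k -` {a} \<inter> space M1 = {z \<in> space M1. \<forall>i. (i < k \<and> z \<in> BA i) = (i \<in> set_decode a)}" by auto
    also have "\<dots> \<in> sets M1" using BA_meas by measurable
    finally show "p k -` {a} \<inter> space M1 \<in> sets M1" .
  qed simp
  have c_lsc: "lower_semicontinuous ?c"
    by (intro lower_semicontinuous_add lower_semicontinuous_compose[OF c1] lower_semicontinuous_compose[OF c2] continuous_intros)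
  show "transport_cost ?c ?P ?Q \<le> ?C"
  proof (rule ennreal_le_epsilon)
    fix e :: real assume e: "0 < e"
    \<comment> \<open>One half of \<open>e\<close> is spent on the coupling of the first marginals,
      the other on those of the kernels.\<close>
    have ee: "ennreal (e / 2) + ennreal (e / 2) = ennreal e" using e by (simp add: ennreal_plus[symmetric] del: ennreal_plus)
    define good where "good k N \<longleftrightarrow> prob_space N \<and> sets N = sets borel \<and>
      (\<forall>E \<in> sets (count_space UNIV \<Otimes>\<^sub>M M2). emeasure N {w. (p k (fst (fst w)), snd (fst w)) \<in> E} = emeasure ?P {w. (p k (fst w), snd w) \<in> E}) \<and>
      (\<forall>E \<in> sets (count_space UNIV \<Otimes>\<^sub>M M2). emeasure N {w. (p k (fst (snd w)), snd (snd w)) \<in> E} = emeasure ?Q {w. (p k (fst w), snd w) \<in> E}) \<and>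
      (\<integral>\<^sup>+ w. ?c w \<partial>N) \<le> ?C + (ennreal (e / 2) + ennreal (e / 2))"
      for k and N :: "(('a \<times> 'b) \<times> ('a \<times> 'b)) measure"
    have "\<exists>N. good k N" for k
    proof (rule density_te_pair_partition[OF M1 M2 borel_measurable_lower_semicontinuous[OF c1] borel_measurable_lower_semicontinuous[OF c2] te1 te2 f g p_meas])
      show "0 < ennreal (e / 2)" using e by simp
    qed (unfold good_def, blast)
    then obtain N where good: "\<And>k. good k (N k)" using choice[of good] by blast
    note N = good[unfolded good_def, THEN conjunct1] good[unfolded good_def, THEN conjunct2, THEN conjunct1]
    note NP = good[unfolded good_def, THEN conjunct2, THEN conjunct2, THEN conjunct1, rule_format]
    note NQ = good[unfolded good_def, THEN conjunct2, THEN conjunct2, THEN conjunct2, THEN conjunct1, rule_format]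
    note NC = good[unfolded good_def, THEN conjunct2, THEN conjunct2, THEN conjunct2, THEN conjunct2]
    \<comment> \<open>The event that the pattern of \<open>J\<close> belongs to \<open>\<S>\<close>,
      written in terms of the cell code and \<open>x\<close>. It does not depend on
      \<open>k\<close>; \<open>E_eq\<close> identifies it with the original event as soon as
      \<open>k\<close> exceeds all first-factor indices in \<open>J\<close>.\<close>
    define E where "E J \<S> = {w :: nat \<times> 'b. {i\<in>J. fst (prod_decode i) \<in> set_decode (fst w) \<and> snd w \<in> BB (snd (prod_decode i))} \<in> \<S>}" for J \<S>
    have E_meas: "E J \<S> \<in> sets (count_space UNIV \<Otimes>\<^sub>M M2)" if "finite J" for J \<S>
    proof -
      let ?q = "\<lambda>i w. fst (prod_decode i) \<in> set_decode (fst w) \<and> snd w \<in> BB (snd (prod_decode i))"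
      let ?M = "count_space (UNIV :: nat set) \<Otimes>\<^sub>M M2"
      have q: "{w \<in> space ?M. ?q i w = b} \<in> sets ?M" for i b
        using BB_meas by measurable
      have "E J \<S> = (\<Union>T\<in>Pow J \<inter> \<S>. {w \<in> space ?M. \<forall>i\<in>J. ?q i w = (i \<in> T)})"
      proof (intro set_eqI iffI)
        fix w assume "w \<in> E J \<S>"
        then show "w \<in> (\<Union>T\<in>Pow J \<inter> \<S>. {w \<in> space ?M. \<forall>i\<in>J. ?q i w = (i \<in> T)})"
          by (intro UN_I[of "{i\<in>J. ?q i w}"]) (auto simp: E_def space_pair_measure sp)
      next
        fix w assume "w \<in> (\<Union>T\<in>Pow J \<inter> \<S>. {w \<in> space ?M. \<forall>i\<in>J. ?q i w = (i \<in> T)})"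
        then obtain T where "T \<subseteq> J" "T \<in> \<S>" "\<forall>i\<in>J. ?q i w = (i \<in> T)" by auto
        then have "{i\<in>J. ?q i w} = T" by blast
        then show "w \<in> E J \<S>" using \<open>T \<in> \<S>\<close> by (simp add: E_def)
      qed
      also have "\<dots> \<in> sets ?M"
        using that by (intro sets.finite_UN sets.sets_Collect_finite_All q) auto
      finally show ?thesis .
    qed
    have E_eq: "{w. {i\<in>J. \<pi> w \<in> U i} \<in> \<S>} = {w. (p k (fst (\<pi> w)), snd (\<pi> w)) \<in> E J \<S>}"
      if "\<And>i. i \<in> J \<Longrightarrow> fst (prod_decode i) < k" for J \<S> k and \<pi> :: "'w \<Rightarrow> 'a \<times> 'b"
    proof -
      have "{i\<in>J. \<pi> w \<in> U i} = {i\<in>J. fst (prod_decode i) \<in> set_decode (p k (fst (\<pi> w))) \<and> snd (\<pi> w) \<in> BB (snd (prod_decode i))}" for w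
        using that by (auto simp: U_def p_dec mem_Times_iff)
      then show ?thesis by (simp add: E_def)
    qed
    have ev: "eventually (\<lambda>k. \<forall>i\<in>J. fst (prod_decode i) < k) sequentially" if "finite J" for J
      using that by (intro eventually_ball_finite) (auto intro: eventually_gt_at_top)
    have "transport_cost ?c ?P ?Q \<le> ?C + (ennreal (e / 2) + ennreal (e / 2))"
    proof (rule transport_cost_le_limit[OF U c_lsc prob_space_prob_density[OF f] _ prob_space_prob_density[OF g] _ N _ _ NC])
      show "sets ?P = sets borel" "sets ?Q = sets borel" by (simp_all add: sets_pair_borel[OF M1(2) M2(2)])
    next
      fix J \<S> assume J: "finite (J :: nat set)"
      show "eventually (\<lambda>k. emeasure (N k) {w. {i\<in>J. fst w \<in> U i} \<in> \<S>} = emeasure ?P {x. {i\<in>J. x \<in> U i} \<in> \<S>}) sequentially"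
        using ev[OF J]
      proof eventually_elim
        case (elim k)
        show ?case using NP[OF E_meas[OF J], of k \<S>] E_eq[of J k "fst :: ('a \<times> 'b) \<times> ('a \<times> 'b) \<Rightarrow> _" \<S>] E_eq[of J k "\<lambda>x. x" \<S>] elim by simp
      qed
      show "eventually (\<lambda>k. emeasure (N k) {w. {i\<in>J. snd w \<in> U i} \<in> \<S>} = emeasure ?Q {x. {i\<in>J. x \<in> U i} \<in> \<S>}) sequentially"
        using ev[OF J]
      proof eventually_elim
        case (elim k)
        show ?case using NQ[OF E_meas[OF J], of k \<S>] E_eq[of J k "snd :: ('a \<times> 'b) \<times> ('a \<times> 'b) \<Rightarrow> _" \<S>] E_eq[of J k "\<lambda>x. x" \<S>] elim by simp
      qed
    qed
    then show "transport_cost ?c ?P ?Q \<le> ?C + ennreal e" by (simp add: ee)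
  qed
qed

section \<open>Push-forwards and the infinite product\<close>

text \<open>The cost between configurations is not known to be measurable, so only the following
  inequalities for lower integrals are available.\<close>

lemma nn_integral_distr_le:
  assumes T: "T \<in> M \<rightarrow>\<^sub>M M'"
  shows "(\<integral>\<^sup>+ y. f y \<partial>distr M M' T) \<le> (\<integral>\<^sup>+ x. f (T x) \<partial>M)"
  unfolding nn_integral_def[of "distr M M' T"]
proof (rule SUP_least)
  \<comment> \<open>The integral of \<open>f\<close> is a supremum over simple functions below it.
    Composed with \<open>T\<close> these lie below \<open>f \<circ> T\<close>, but they need not
    exhaust the simple functions there, whence only one inequality.\<close>
  fix g assume g: "g \<in> {g. simple_function (distr M M' T) g \<and> g \<le> f}"
  then have gm: "g \<in> borel_measurable M'" using borel_measurable_simple_function by fastforce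
  have "integral\<^sup>S (distr M M' T) g = (\<integral>\<^sup>+ y. g y \<partial>distr M M' T)"
    using g by (simp add: nn_integral_eq_simple_integral)
  also have "\<dots> = (\<integral>\<^sup>+ x. g (T x) \<partial>M)" using gm by (intro nn_integral_distr[OF T]) simp
  also have "\<dots> \<le> (\<integral>\<^sup>+ x. f (T x) \<partial>M)"
    using g by (intro nn_integral_mono) (auto simp: le_fun_def)
  finally show "integral\<^sup>S (distr M M' T) g \<le> (\<integral>\<^sup>+ x. f (T x) \<partial>M)" .
qed

lemma nn_integral_bind_le:
  assumes N: "N \<in> M \<rightarrow>\<^sub>M subprob_algebra B" and M: "space M \<noteq> {}"
  shows "(\<integral>\<^sup>+ y. f y \<partial>(M \<bind> N)) \<le> (\<integral>\<^sup>+ x. (\<integral>\<^sup>+ y. f y \<partial>N x) \<partial>M)"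
  unfolding nn_integral_def[of "M \<bind> N"]
proof (rule SUP_least)
  fix g assume g: "g \<in> {g. simple_function (M \<bind> N) g \<and> g \<le> f}"
  then have gm: "g \<in> borel_measurable B"
    using borel_measurable_simple_function[of "M \<bind> N" g] by (simp cong: measurable_cong_sets add: sets_bind_measurable[OF N M])
  have "integral\<^sup>S (M \<bind> N) g = (\<integral>\<^sup>+ y. g y \<partial>(M \<bind> N))"
    using g by (simp add: nn_integral_eq_simple_integral)
  also have "\<dots> = (\<integral>\<^sup>+ x. (\<integral>\<^sup>+ y. g y \<partial>N x) \<partial>M)" by (rule nn_integral_bind[OF gm N])
  also have "\<dots> \<le> (\<integral>\<^sup>+ x. (\<integral>\<^sup>+ y. f y \<partial>N x) \<partial>M)"
    using g by (intro nn_integral_mono) (auto simp: le_fun_def)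
  finally show "integral\<^sup>S (M \<bind> N) g \<le> (\<integral>\<^sup>+ x. (\<integral>\<^sup>+ y. f y \<partial>N x) \<partial>M)" .
qed

text \<open>Every coupling of \<open>A\<close> and \<open>B\<close> is pushed forward by the product
  map. \<open>nn_integral_distr_le\<close> compares the costs in the direction that also holds for
  nonmeasurable \<open>c'\<close>.\<close>

lemma transport_cost_distr_le:
  assumes T: "T \<in> A \<rightarrow>\<^sub>M A'" and S: "S \<in> B \<rightarrow>\<^sub>M B'"
    and c: "\<And>x y. x \<in> space A \<Longrightarrow> y \<in> space B \<Longrightarrow> c' (T x, S y) \<le> c (x, y)"
  shows "transport_cost c' (distr A A' T) (distr B B' S) \<le> transport_cost c A B"
  unfolding transport_cost_def[of c]
proof (rule INF_greatest)
  fix N assume N: "N \<in> couplings A B"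
  note m = measurable_couplings[OF N]
  define \<Phi> where "\<Phi> w = (T (fst w), S (snd w))" for w
  have Tm: "(\<lambda>w. T (fst w)) \<in> N \<rightarrow>\<^sub>M A'" and Sm: "(\<lambda>w. S (snd w)) \<in> N \<rightarrow>\<^sub>M B'"
    using measurable_compose[OF m(1) T] measurable_compose[OF m(2) S] .
  then have \<Phi>: "\<Phi> \<in> N \<rightarrow>\<^sub>M A' \<Otimes>\<^sub>M B'" unfolding \<Phi>_def by measurable
  let ?N = "distr N (A' \<Otimes>\<^sub>M B') \<Phi>"
  have NA: "distr N A fst = A" and NB: "distr N B snd = B" using N by (auto simp: couplings_def)
  have "distr ?N (distr A A' T) fst = distr ?N A' fst" by (rule distr_cong) auto
  also have "\<dots> = distr N A' (\<lambda>w. T (fst w))" by (subst distr_distr[OF _ \<Phi>]) (auto simp: \<Phi>_def comp_def)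
  also have "\<dots> = distr (distr N A fst) A' T" by (subst distr_distr[OF T m(1)]) (simp add: comp_def)
  finally have 1: "distr ?N (distr A A' T) fst = distr A A' T" by (simp add: NA)
  have "distr ?N (distr B B' S) snd = distr ?N B' snd" by (rule distr_cong) auto
  also have "\<dots> = distr N B' (\<lambda>w. S (snd w))" by (subst distr_distr[OF _ \<Phi>]) (auto simp: \<Phi>_def comp_def)
  also have "\<dots> = distr (distr N B snd) B' S" by (subst distr_distr[OF S m(2)]) (simp add: comp_def)
  finally have 2: "distr ?N (distr B B' S) snd = distr B B' S" by (simp add: NB)
  have "sets ?N = sets (distr A A' T \<Otimes>\<^sub>M distr B B' S)"
    unfolding sets_distr by (intro sets_pair_measure_cong) auto
  with 1 2 have "?N \<in> couplings (distr A A' T) (distr B B' S)" by (simp add: couplings_def)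
  moreover have "(\<integral>\<^sup>+ w. c' w \<partial>?N) \<le> (\<integral>\<^sup>+ w. c w \<partial>N)"
  proof -
    have "(\<integral>\<^sup>+ w. c' w \<partial>?N) \<le> (\<integral>\<^sup>+ w. c' (\<Phi> w) \<partial>N)" by (rule nn_integral_distr_le[OF \<Phi>])
    also have "\<dots> \<le> (\<integral>\<^sup>+ w. c w \<partial>N)"
      using c measurable_space[OF m(1)] measurable_space[OF m(2)]
      by (intro nn_integral_mono) (metis \<Phi>_def prod.collapse)
    finally show ?thesis .
  qed
  ultimately show "transport_cost c' (distr A A' T) (distr B B' S) \<le> (\<integral>\<^sup>+ w. c w \<partial>N)"
    unfolding transport_cost_def by (rule INF_lower2)
qed

text \<open>Densities with respect to the image are pulled back along \<open>T\<close>: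
  \<open>f \<circ> T\<close> has the same entropy, and \<open>T\<close> sends its law to the law of
  \<open>f\<close>. The inequality thus passes to images whose cost is dominated.\<close>

lemma density_te_distr:
  assumes te: "density_te M c a1 a2" and T: "T \<in> M \<rightarrow>\<^sub>M M'"
    and c: "\<And>x y. x \<in> space M \<Longrightarrow> y \<in> space M \<Longrightarrow> c' (T x, T y) \<le> c (x, y)"
  shows "density_te (distr M M' T) c' a1 a2"
  unfolding density_te_def
proof (intro allI impI)
  have T1: "prob_density M (\<lambda>x. f (T x))" "density_entropy (distr M M' T) f = density_entropy M (\<lambda>x. f (T x))"
    "density (distr M M' T) (\<lambda>y. ennreal (f y)) = distr (density M (\<lambda>x. ennreal (f (T x)))) M' T"
    if f: "prob_density (distr M M' T) f" for f
  proof -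
    have [measurable]: "f \<in> borel_measurable M'" using prob_densityD(1)[OF f] by simp
    show "prob_density M (\<lambda>x. f (T x))"
      unfolding prob_density_def
    proof (intro conjI allI)
      show "(\<lambda>x. f (T x)) \<in> borel_measurable M" by (rule measurable_compose[OF T]) measurable
      show "0 \<le> f (T x)" for x by (rule prob_densityD(2)[OF f])
      show "(\<integral>\<^sup>+ x. ennreal (f (T x)) \<partial>M) = 1"
        using prob_densityD(3)[OF f] by (subst (asm) nn_integral_distr[OF T]) auto
    qed
    show "density_entropy (distr M M' T) f = density_entropy M (\<lambda>x. f (T x))"
      unfolding density_entropy_def using T by (subst nn_integral_distr) auto
    show "density (distr M M' T) (\<lambda>y. ennreal (f y)) = distr (density M (\<lambda>x. ennreal (f (T x)))) M' T"
      using T by (intro density_distr) auto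
  qed
  fix f g assume f: "prob_density (distr M M' T) f" and g: "prob_density (distr M M' T) g"
  have "transport_cost c' (density (distr M M' T) (\<lambda>x. ennreal (f x))) (density (distr M M' T) (\<lambda>x. ennreal (g x)))
     \<le> transport_cost c (density M (\<lambda>x. ennreal (f (T x)))) (density M (\<lambda>x. ennreal (g (T x))))"
    unfolding T1(3)[OF f] T1(3)[OF g] using T c by (intro transport_cost_distr_le) auto
  also have "\<dots> \<le> a1 * density_entropy M (\<lambda>x. f (T x)) + a2 * density_entropy M (\<lambda>x. g (T x))"
    using te T1(1)[OF f] T1(1)[OF g] by (auto simp: density_te_def)
  finally show "transport_cost c' (density (distr M M' T) (\<lambda>x. ennreal (f x))) (density (distr M M' T) (\<lambda>x. ennreal (g x)))
     \<le> a1 * density_entropy (distr M M' T) f + a2 * density_entropy (distr M M' T) g"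
    by (simp add: T1(2)[OF f] T1(2)[OF g])
qed

text \<open>Induction on the number of coordinates that the cost reads: \<open>case_nat\<close>
  carries \<open>\<mu> \<Otimes>\<^sub>M S\<close> to \<open>S\<close> itself, so
  \<open>density_te_pair\<close> followed by a push-forward adds one coordinate. For
  \<open>n = 0\<close> the cost vanishes and the product coupling is free.\<close>

lemma density_te_sequence:
  fixes \<mu> :: "'z::polish_space measure"
  assumes \<mu>: "prob_space \<mu>" "sets \<mu> = sets borel" and \<rho>: "lower_semicontinuous \<rho>" and te: "density_te \<mu> \<rho> a1 a2"
  shows "density_te (PiM (UNIV :: nat set) (\<lambda>_. \<mu>)) (\<lambda>w. \<Sum>i<n. \<rho> (fst w i, snd w i)) a1 a2"
proof -
  interpret \<mu>: prob_space \<mu> by fact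
  interpret sequence_space \<mu> ..
  have lsc: "lower_semicontinuous (\<lambda>w :: (nat \<Rightarrow> 'z) \<times> (nat \<Rightarrow> 'z). \<Sum>i<n. \<rho> (fst w i, snd w i))" for n
  proof (induction n)
    case 0
    then show ?case by (simp add: lower_semicontinuous_def)
  next
    case (Suc n)
    have "lower_semicontinuous (\<lambda>w :: (nat \<Rightarrow> 'z) \<times> (nat \<Rightarrow> 'z). \<rho> (fst w n, snd w n))"
    proof (rule lower_semicontinuous_compose[OF \<rho>, of "\<lambda>w. (fst w n, snd w n)"])
      show "continuous_on UNIV (\<lambda>w :: (nat \<Rightarrow> 'z) \<times> (nat \<Rightarrow> 'z). (fst w n, snd w n))"
        by (intro continuous_on_Pair continuous_on_product_then_coordinatewise[of _ fst]
            continuous_on_product_then_coordinatewise[of _ snd] continuous_on_fst continuous_on_snd continuous_on_id)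
    qed
    then show ?case using lower_semicontinuous_add[OF Suc] by simp
  qed
  have sS: "sets S = sets (borel :: (nat \<Rightarrow> 'z) measure)"
    using sets_PiM_cong[OF refl, of UNIV "\<lambda>_. \<mu>" "\<lambda>_. borel"] \<mu> sets_PiM_equal_borel by auto
  show ?thesis
  proof (induction n)
    case 0
    show ?case
      unfolding density_te_def transport_cost_def
      by (intro allI impI INF_lower2[OF pair_measure_couplings] prob_space_prob_density) auto
  next
    case (Suc n)
    have "density_te (\<mu> \<Otimes>\<^sub>M S) (\<lambda>w. \<rho> (fst (fst w), fst (snd w)) + (\<Sum>i<n. \<rho> (fst (snd (fst w), snd (snd w)) i, snd (snd (fst w), snd (snd w)) i))) a1 a2"
      using density_te_pair[OF \<mu> P.prob_space_axioms sS \<rho> lsc te Suc] by simp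
    then have "density_te (distr (\<mu> \<Otimes>\<^sub>M S) S (\<lambda>(s, \<omega>). case_nat s \<omega>)) (\<lambda>w. \<Sum>i<Suc n. \<rho> (fst w i, snd w i)) a1 a2"
      by (rule density_te_distr) (auto simp: sum.lessThan_Suc_shift simp del: sum.lessThan_Suc)
    then show ?case unfolding PiM_iter .
  qed
qed

text \<open>Passes from \<open>ereal\<close> to \<open>ennreal\<close>, in which
  \<open>density_te\<close> is stated; infinite constants are included, with
  \<open>0 * \<infinity> = 0\<close> in both types.\<close>

lemma density_te_transport_entropy_inequality:
  fixes \<mu> :: "'z::topological_space measure"
  assumes \<mu>: "prob_space \<mu>" "sets \<mu> = sets borel"
    and "transport_entropy_inequality \<rho> (enn2ereal a1) (enn2ereal a2) \<mu>"
  shows "density_te \<mu> \<rho> a1 a2"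
  unfolding density_te_def
proof (intro allI impI)
  fix f g assume fg: "prob_density \<mu> f" "prob_density \<mu> g"
  have d: "density \<mu> (\<lambda>x. ennreal (h x)) \<in> space (prob_algebra borel)" if "prob_density \<mu> h" for h
    using prob_space_prob_density[OF that] \<mu> by (simp add: space_prob_algebra)
  show "transport_cost \<rho> (density \<mu> (\<lambda>x. ennreal (f x))) (density \<mu> (\<lambda>x. ennreal (g x))) \<le> a1 * density_entropy \<mu> f + a2 * density_entropy \<mu> g"
    using assms(3)[unfolded transport_entropy_inequality_def, rule_format, OF d[OF fg(1)] d[OF fg(2)]]
    by (simp add: relative_entropy_density[OF \<mu>(1) prob_densityD[OF fg(1)]]
        relative_entropy_density[OF \<mu>(1) prob_densityD[OF fg(2)]]
        times_ennreal.rep_eq plus_ennreal.rep_eq less_eq_ennreal.rep_eq)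
qed

section \<open>Mixtures and configurations\<close>

text \<open>Where \<open>pmf \<kappa> n = 0\<close> the quotient is 0 by convention, and
  \<open>ac\<close> makes \<open>pmf l n\<close> vanish too.\<close>

lemma density_pmf_ratio:
  fixes l \<kappa> :: "'a::countable pmf"
  assumes ac: "\<And>n. pmf \<kappa> n = 0 \<Longrightarrow> pmf l n = 0"
  shows "density (measure_pmf \<kappa>) (\<lambda>n. ennreal (pmf l n / pmf \<kappa> n)) = measure_pmf l"
proof (rule measure_eqI_countable)
  fix n
  have "emeasure (density (measure_pmf \<kappa>) (\<lambda>n. ennreal (pmf l n / pmf \<kappa> n))) {n}
      = (\<integral>\<^sup>+ m. ennreal (pmf l n / pmf \<kappa> n) * indicator {n} m \<partial>measure_pmf \<kappa>)"
    by (subst emeasure_density) (auto intro!: nn_integral_cong split: split_indicator)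
  also have "\<dots> = ennreal (pmf l n / pmf \<kappa> n) * ennreal (pmf \<kappa> n)"
    by (subst nn_integral_cmult) (auto simp: emeasure_pmf_single)
  also have "\<dots> = ennreal (pmf l n)"
    using ac[of n] by (cases "pmf \<kappa> n = 0") (auto simp: ennreal_mult'[symmetric])
  also have "\<dots> = emeasure (measure_pmf l) {n}" by (simp add: emeasure_pmf_single)
  finally show "emeasure (density (measure_pmf \<kappa>) (\<lambda>n. ennreal (pmf l n / pmf \<kappa> n))) {n} = emeasure (measure_pmf l) {n}" .
qed auto

text \<open>Chain rule for a mixture. The \<open>B n\<close> live on disjoint levels of
  \<open>mass\<close>, so the index can be read off the point:
  \<open>pmf l n / pmf \<kappa> n\<close> is the density of the mass law and \<open>h n\<close> the
  conditional density at mass \<open>n\<close>.\<close>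

lemma condition_prob_density:
  fixes \<kappa> l :: "nat pmf" and B :: "nat \<Rightarrow> 'x measure" and mass :: "'x \<Rightarrow> nat"
  assumes B: "\<And>n. prob_space (B n)" "\<And>n. sets (B n) = sets S"
    and mass [measurable]: "mass \<in> S \<rightarrow>\<^sub>M count_space UNIV" and massB: "\<And>n. AE x in B n. mass x = n"
    and f: "prob_density (measure_pmf \<kappa> \<bind> B) f"
    and l: "\<And>n. emeasure (density (measure_pmf \<kappa> \<bind> B) (\<lambda>x. ennreal (f x))) {x \<in> space S. mass x = n} = ennreal (pmf l n)"
  obtains h where "\<And>n. prob_density (B n) (h n)"
    "\<And>n. pmf \<kappa> n = 0 \<Longrightarrow> pmf l n = 0"
    "density_entropy \<kappa> (\<lambda>n. pmf l n / pmf \<kappa> n) + (\<integral>\<^sup>+ n. density_entropy (B n) (h n) \<partial>measure_pmf l) \<le> density_entropy (measure_pmf \<kappa> \<bind> B) f"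
    "\<And>A. A \<in> sets S \<Longrightarrow> (\<integral>\<^sup>+ n. emeasure (density (B n) (\<lambda>x. ennreal (h n x))) A \<partial>measure_pmf l)
       = emeasure (density (measure_pmf \<kappa> \<bind> B) (\<lambda>x. ennreal (f x))) A"
proof -
  have B_meas: "B \<in> measure_pmf \<kappa> \<rightarrow>\<^sub>M subprob_algebra S"
    using B by (auto simp: space_subprob_algebra prob_space_imp_subprob_space)
  have sM: "sets (measure_pmf \<kappa> \<bind> B) = sets S" by (rule sets_bind_measurable[OF B_meas]) simp
  note [measurable_cong] = B(2) sM
  have spB: "space (B n) = space S" for n using sets_eq_imp_space_eq[OF B(2)] .
  have [measurable]: "f \<in> borel_measurable S" using prob_densityD(1)[OF f] by simp
  have f0: "0 \<le> f x" for x by (rule prob_densityD(2)[OF f])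
  have int: "(\<integral>\<^sup>+ x. g x \<partial>(measure_pmf \<kappa> \<bind> B)) = (\<integral>\<^sup>+ n. (\<integral>\<^sup>+ x. g x \<partial>B n) \<partial>measure_pmf \<kappa>)"
    if "g \<in> borel_measurable S" for g
    by (rule nn_integral_bind[OF that B_meas])
  have dens: "emeasure (density (measure_pmf \<kappa> \<bind> B) (\<lambda>x. ennreal (f x))) A
      = (\<integral>\<^sup>+ n. (\<integral>\<^sup>+ x. ennreal (f x) * indicator A x \<partial>B n) \<partial>measure_pmf \<kappa>)" if [measurable]: "A \<in> sets S" for A
    by (subst emeasure_density) (auto simp: sM intro!: int)
  \<comment> \<open>The event \<open>mass = n\<close> selects the single component
    \<open>B n\<close> of the mixture.\<close>
  have l_eq: "ennreal (pmf \<kappa> n) * (\<integral>\<^sup>+ x. ennreal (f x) \<partial>B n) = ennreal (pmf l n)" for n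
  proof -
    have A: "{x \<in> space S. mass x = n} \<in> sets S" by measurable
    have "(\<integral>\<^sup>+ x. ennreal (f x) * indicator {x \<in> space S. mass x = n} x \<partial>B m) = indicator {n} m * (\<integral>\<^sup>+ x. ennreal (f x) \<partial>B n)" for m
    proof (cases "m = n")
      case True
      have "(\<integral>\<^sup>+ x. ennreal (f x) * indicator {x \<in> space S. mass x = n} x \<partial>B n) = (\<integral>\<^sup>+ x. ennreal (f x) \<partial>B n)"
        using massB[of n] AE_space[of "B n"]
        by (intro nn_integral_cong_AE, eventually_elim) (simp add: spB)
      then show ?thesis using True by simp
    next
      case False
      have "(\<integral>\<^sup>+ x. ennreal (f x) * indicator {x \<in> space S. mass x = n} x \<partial>B m) = (\<integral>\<^sup>+ x. 0 \<partial>B m)"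
        using massB[of m] by (intro nn_integral_cong_AE, eventually_elim) (use False in simp)
      then show ?thesis using False by simp
    qed
    then have "ennreal (pmf l n) = (\<integral>\<^sup>+ m. indicator {n} m * (\<integral>\<^sup>+ x. ennreal (f x) \<partial>B n) \<partial>measure_pmf \<kappa>)"
      using l[of n] dens[OF A] by simp
    also have "\<dots> = ennreal (pmf \<kappa> n) * (\<integral>\<^sup>+ x. ennreal (f x) \<partial>B n)"
      by (subst nn_integral_multc) (auto simp: emeasure_pmf_single)
    finally show ?thesis ..
  qed
  have ac: "pmf l n = 0" if "pmf \<kappa> n = 0" for n using l_eq[of n] that by simp
  define s where "s n = pmf l n / pmf \<kappa> n" for n
  have s0: "0 \<le> s n" for n by (simp add: s_def)
  have s: "(\<integral>\<^sup>+ x. ennreal (f x) \<partial>B n) = ennreal (s n)" if "pmf \<kappa> n \<noteq> 0" for n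
  proof -
    have "0 < pmf \<kappa> n" using that pmf_nonneg[of \<kappa> n] by (simp add: order_less_le)
    then have "ennreal (pmf \<kappa> n) * ennreal (s n) = ennreal (pmf l n)" by (simp add: s_def ennreal_mult'[symmetric])
    then have "ennreal (pmf \<kappa> n) * (\<integral>\<^sup>+ x. ennreal (f x) \<partial>B n) = ennreal (pmf \<kappa> n) * ennreal (s n)" by (simp add: l_eq)
    then show ?thesis using \<open>0 < pmf \<kappa> n\<close> by (subst (asm) ennreal_mult_cancel_left) auto
  qed
  \<comment> \<open>The default 1 makes \<open>h n\<close> a probability density also where
    \<open>s n = 0\<close>; such levels have weight 0 under \<open>l\<close> and contribute
    nothing.\<close>
  define h where "h n x = (if s n = 0 then 1 else f x / s n)" for n x
  have h: "prob_density (B n) (h n)" for n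
  proof (cases "s n = 0")
    case True
    then show ?thesis by (simp add: h_def[abs_def] prob_density_def prob_space.emeasure_space_1[OF B(1)])
  next
    case False
    then have k: "pmf \<kappa> n \<noteq> 0" and pos: "0 < s n" using s0[of n] by (auto simp: s_def)
    have "(\<integral>\<^sup>+ x. ennreal (h n x) \<partial>B n) = (\<integral>\<^sup>+ x. ennreal (f x) / ennreal (s n) \<partial>B n)"
      using pos f0 by (intro nn_integral_cong) (simp add: h_def divide_ennreal)
    also have "\<dots> = ennreal (s n) / ennreal (s n)" by (subst nn_integral_divide) (auto simp: s[OF k])
    also have "\<dots> = 1" using pos by (simp add: divide_ennreal)
    finally show ?thesis using f0 s0[of n] by (auto simp: prob_density_def h_def[abs_def])
  qed
  have sh: "AE x in B n. f x = s n * h n x" if "pmf \<kappa> n \<noteq> 0" for n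
  proof (cases "s n = 0")
    case True
    then have "(\<integral>\<^sup>+ x. ennreal (f x) \<partial>B n) = 0" using s[OF that] by simp
    then have "AE x in B n. ennreal (f x) = 0" by (subst (asm) nn_integral_0_iff_AE) auto
    then show ?thesis by eventually_elim (use True f0 in \<open>auto simp: ennreal_eq_0_iff intro: antisym\<close>)
  qed (simp add: h_def)
  have AE_\<kappa>: "AE n in measure_pmf \<kappa>. pmf \<kappa> n \<noteq> 0" by (simp add: AE_measure_pmf_iff set_pmf_iff)
  have l_dens: "measure_pmf l = density (measure_pmf \<kappa>) (\<lambda>n. ennreal (s n))"
    unfolding s_def by (rule density_pmf_ratio[OF ac, symmetric])
  have "density_entropy \<kappa> s + (\<integral>\<^sup>+ n. density_entropy (B n) (h n) \<partial>measure_pmf l) = (\<integral>\<^sup>+ n. ennreal (entropy_fun (s n)) + ennreal (s n) * density_entropy (B n) (h n) \<partial>measure_pmf \<kappa>)"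
    unfolding l_dens density_entropy_def[of "measure_pmf \<kappa>"] by (simp add: nn_integral_density nn_integral_add)
  also have "\<dots> \<le> (\<integral>\<^sup>+ n. (\<integral>\<^sup>+ x. ennreal (entropy_fun (f x)) \<partial>B n) \<partial>measure_pmf \<kappa>)"
  proof (rule nn_integral_mono_AE)
    show "AE n in measure_pmf \<kappa>. ennreal (entropy_fun (s n)) + ennreal (s n) * density_entropy (B n) (h n) \<le> (\<integral>\<^sup>+ x. ennreal (entropy_fun (f x)) \<partial>B n)"
      using AE_\<kappa>
    proof eventually_elim
      case (elim n)
      have "ennreal (entropy_fun (s n)) + ennreal (s n) * density_entropy (B n) (h n) \<le> density_entropy (B n) (\<lambda>x. s n * h n x)"
        by (rule density_entropy_mult_ge[OF B(1) prob_densityD[OF h] s0])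
      also have "\<dots> = (\<integral>\<^sup>+ x. ennreal (entropy_fun (f x)) \<partial>B n)"
        unfolding density_entropy_def using sh[OF elim] by (intro nn_integral_cong_AE) (auto elim!: eventually_mono)
      finally show ?case .
    qed
  qed
  also have "\<dots> = density_entropy (measure_pmf \<kappa> \<bind> B) f" unfolding density_entropy_def by (intro int[symmetric]) measurable
  finally have ent_le: "density_entropy \<kappa> s + (\<integral>\<^sup>+ n. density_entropy (B n) (h n) \<partial>measure_pmf l) \<le> density_entropy (measure_pmf \<kappa> \<bind> B) f" .
  have "(\<integral>\<^sup>+ n. emeasure (density (B n) (\<lambda>x. ennreal (h n x))) A \<partial>measure_pmf l)
       = emeasure (density (measure_pmf \<kappa> \<bind> B) (\<lambda>x. ennreal (f x))) A" if A [measurable]: "A \<in> sets S" for A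
  proof -
    have "(\<integral>\<^sup>+ n. emeasure (density (B n) (\<lambda>x. ennreal (h n x))) A \<partial>measure_pmf l)
        = (\<integral>\<^sup>+ n. ennreal (s n) * emeasure (density (B n) (\<lambda>x. ennreal (h n x))) A \<partial>measure_pmf \<kappa>)"
      unfolding l_dens by (simp add: nn_integral_density)
    also have "\<dots> = (\<integral>\<^sup>+ n. (\<integral>\<^sup>+ x. ennreal (f x) * indicator A x \<partial>B n) \<partial>measure_pmf \<kappa>)"
    proof (rule nn_integral_cong_AE)
      show "AE n in measure_pmf \<kappa>. ennreal (s n) * emeasure (density (B n) (\<lambda>x. ennreal (h n x))) A = (\<integral>\<^sup>+ x. ennreal (f x) * indicator A x \<partial>B n)"
        using AE_\<kappa>
      proof eventually_elim
        case (elim n)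
        note [measurable] = prob_densityD(1)[OF h]
        have "ennreal (s n) * emeasure (density (B n) (\<lambda>x. ennreal (h n x))) A = (\<integral>\<^sup>+ x. ennreal (s n) * (ennreal (h n x) * indicator A x) \<partial>B n)"
          by (subst nn_integral_cmult) (auto simp: emeasure_density)
        also have "\<dots> = (\<integral>\<^sup>+ x. ennreal (f x) * indicator A x \<partial>B n)"
          using sh[OF elim] by (intro nn_integral_cong_AE, eventually_elim) (simp add: ennreal_mult' s0 mult.assoc)
        finally show ?case .
      qed
    qed
    also have "\<dots> = emeasure (density (measure_pmf \<kappa> \<bind> B) (\<lambda>x. ennreal (f x))) A" by (rule dens[OF A, symmetric])
    finally show ?thesis .
  qed
  then show ?thesis using that[of h] h ac ent_le unfolding s_def by blast
qed

text \<open>Marginals commute with mixing. \<open>P\<close> and \<open>Q\<close> are compared with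
  the mixtures set by set, which is how \<open>condition_prob_density\<close> delivers them.\<close>

lemma bind_pmf_couplings:
  fixes l :: "nat pmf"
  assumes N: "\<And>n. N n \<in> couplings (D1 n) (D2 n)" and D1: "\<And>n. prob_space (D1 n)" "\<And>n. sets (D1 n) = sets S"
    and D2: "\<And>n. sets (D2 n) = sets S" and P: "sets P = sets S" and Q: "sets Q = sets S"
    and PD: "\<And>A. A \<in> sets S \<Longrightarrow> (\<integral>\<^sup>+ n. emeasure (D1 n) A \<partial>measure_pmf l) = emeasure P A"
    and QD: "\<And>A. A \<in> sets S \<Longrightarrow> (\<integral>\<^sup>+ n. emeasure (D2 n) A \<partial>measure_pmf l) = emeasure Q A"
  shows "measure_pmf l \<bind> N \<in> couplings P Q"
proof -
  have pN: "prob_space (N n)" for n by (rule prob_space_couplings[OF N D1(1)])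
  have sN: "sets (N n) = sets (S \<Otimes>\<^sub>M S)" for n
    using N[of n] sets_pair_measure_cong[OF D1(2) D2] by (simp add: couplings_def)
  have N_meas: "N \<in> measure_pmf l \<rightarrow>\<^sub>M subprob_algebra (S \<Otimes>\<^sub>M S)"
    using pN sN by (auto simp: space_subprob_algebra prob_space_imp_subprob_space)
  have sB: "sets (measure_pmf l \<bind> N) = sets (S \<Otimes>\<^sub>M S)" by (rule sets_bind_measurable[OF N_meas]) simp
  have spB: "space (measure_pmf l \<bind> N) = space (S \<Otimes>\<^sub>M S)" by (rule sets_eq_imp_space_eq[OF sB])
  have marg: "distr (measure_pmf l \<bind> N) R \<pi> = R"
    if \<pi>: "\<pi> \<in> S \<Otimes>\<^sub>M S \<rightarrow>\<^sub>M S" and R: "sets R = sets S"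
      and D: "\<And>n. distr (N n) (D n) \<pi> = D n" "\<And>n. sets (D n) = sets S"
      and RD: "\<And>A. A \<in> sets S \<Longrightarrow> (\<integral>\<^sup>+ n. emeasure (D n) A \<partial>measure_pmf l) = emeasure R A"
    for \<pi> R D
  proof (rule measure_eqI)
    fix A assume "A \<in> sets (distr (measure_pmf l \<bind> N) R \<pi>)"
    then have A: "A \<in> sets S" by (simp add: R)
    have \<pi>A: "\<pi> -` A \<inter> space (S \<Otimes>\<^sub>M S) \<in> sets (S \<Otimes>\<^sub>M S)" by (rule measurable_sets[OF \<pi> A])
    have "emeasure (distr (measure_pmf l \<bind> N) R \<pi>) A = emeasure (measure_pmf l \<bind> N) (\<pi> -` A \<inter> space (S \<Otimes>\<^sub>M S))"
      using \<pi> A by (subst emeasure_distr) (auto simp: spB R sB cong: measurable_cong_sets)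
    also have "\<dots> = (\<integral>\<^sup>+ n. emeasure (N n) (\<pi> -` A \<inter> space (S \<Otimes>\<^sub>M S)) \<partial>measure_pmf l)"
      by (rule emeasure_bind[OF _ N_meas \<pi>A]) simp
    also have "\<dots> = (\<integral>\<^sup>+ n. emeasure (D n) A \<partial>measure_pmf l)"
    proof (rule nn_integral_cong)
      fix n
      have "emeasure (distr (N n) (D n) \<pi>) A = emeasure (N n) (\<pi> -` A \<inter> space (S \<Otimes>\<^sub>M S))"
        using \<pi> A by (subst emeasure_distr) (auto simp: sets_eq_imp_space_eq[OF sN] D(2) sN cong: measurable_cong_sets)
      then show "emeasure (N n) (\<pi> -` A \<inter> space (S \<Otimes>\<^sub>M S)) = emeasure (D n) A" by (simp add: D(1))
    qed
    also have "\<dots> = emeasure R A" by (rule RD[OF A])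
    finally show "emeasure (distr (measure_pmf l \<bind> N) R \<pi>) A = emeasure R A" .
  qed simp
  have "distr (measure_pmf l \<bind> N) P fst = P"
    using N by (intro marg[OF measurable_fst P _ D1(2) PD]) (auto simp: couplings_def)
  moreover have "distr (measure_pmf l \<bind> N) Q snd = Q"
    using N by (intro marg[OF measurable_snd Q _ D2 QD]) (auto simp: couplings_def)
  ultimately show ?thesis using sB sets_pair_measure_cong[OF P Q] by (simp add: couplings_def)
qed

text \<open>Both laws carry the same mass law \<open>l\<close>, so a coupling may act within each
  level \<open>n\<close> and be mixed over \<open>l\<close>. The cost then consumes conditional
  entropies only; the mass entropies, one from each chain rule, remain available for the left-hand
  side.\<close>

lemma density_te_mixture:
  fixes \<kappa> l :: "nat pmf" and B :: "nat \<Rightarrow> 'x measure" and mass :: "'x \<Rightarrow> nat"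
  assumes B: "\<And>n. prob_space (B n)" "\<And>n. sets (B n) = sets S"
    and mass: "mass \<in> S \<rightarrow>\<^sub>M count_space UNIV" and massB: "\<And>n. AE x in B n. mass x = n"
    and te: "\<And>n. density_te (B n) c a1 a2"
    and f: "prob_density (measure_pmf \<kappa> \<bind> B) f" and g: "prob_density (measure_pmf \<kappa> \<bind> B) g"
    and lf: "\<And>n. emeasure (density (measure_pmf \<kappa> \<bind> B) (\<lambda>x. ennreal (f x))) {x \<in> space S. mass x = n} = ennreal (pmf l n)"
    and lg: "\<And>n. emeasure (density (measure_pmf \<kappa> \<bind> B) (\<lambda>x. ennreal (g x))) {x \<in> space S. mass x = n} = ennreal (pmf l n)"
  shows "enn2ereal (transport_cost c (density (measure_pmf \<kappa> \<bind> B) (\<lambda>x. ennreal (f x))) (density (measure_pmf \<kappa> \<bind> B) (\<lambda>x. ennreal (g x))))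
       + enn2ereal (a1 + a2) * relative_entropy l \<kappa>
     \<le> enn2ereal (a1 * density_entropy (measure_pmf \<kappa> \<bind> B) f + a2 * density_entropy (measure_pmf \<kappa> \<bind> B) g)"
proof -
  let ?B = "measure_pmf \<kappa> \<bind> B"
  let ?P = "density ?B (\<lambda>x. ennreal (f x))" and ?Q = "density ?B (\<lambda>x. ennreal (g x))"
  let ?s = "\<lambda>n. pmf l n / pmf \<kappa> n"
  have B_meas: "B \<in> measure_pmf \<kappa> \<rightarrow>\<^sub>M subprob_algebra S"
    using B by (auto simp: space_subprob_algebra prob_space_imp_subprob_space)
  have sM: "sets ?B = sets S" by (rule sets_bind_measurable[OF B_meas]) simp
  obtain h where h: "\<And>n. prob_density (B n) (h n)" and ac: "\<And>n. pmf \<kappa> n = 0 \<Longrightarrow> pmf l n = 0"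
    and h_ent: "density_entropy \<kappa> ?s + (\<integral>\<^sup>+ n. density_entropy (B n) (h n) \<partial>measure_pmf l) \<le> density_entropy ?B f"
    and hP: "\<And>A. A \<in> sets S \<Longrightarrow> (\<integral>\<^sup>+ n. emeasure (density (B n) (\<lambda>x. ennreal (h n x))) A \<partial>measure_pmf l) = emeasure ?P A"
    by (rule condition_prob_density[OF B mass massB f lf]) blast
  obtain k where k: "\<And>n. prob_density (B n) (k n)"
    and k_ent: "density_entropy \<kappa> ?s + (\<integral>\<^sup>+ n. density_entropy (B n) (k n) \<partial>measure_pmf l) \<le> density_entropy ?B g"
    and kQ: "\<And>A. A \<in> sets S \<Longrightarrow> (\<integral>\<^sup>+ n. emeasure (density (B n) (\<lambda>x. ennreal (k n x))) A \<partial>measure_pmf l) = emeasure ?Q A"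
    by (rule condition_prob_density[OF B mass massB g lg]) blast
  let ?h = "\<integral>\<^sup>+ n. density_entropy (B n) (h n) \<partial>measure_pmf l" and ?k = "\<integral>\<^sup>+ n. density_entropy (B n) (k n) \<partial>measure_pmf l"
  have T: "transport_cost c ?P ?Q \<le> a1 * ?h + a2 * ?k"
  proof (rule ennreal_le_epsilon)
    fix e :: real assume e: "0 < e"
    have "\<exists>N. N \<in> couplings (density (B n) (\<lambda>x. ennreal (h n x))) (density (B n) (\<lambda>x. ennreal (k n x))) \<and>
        (\<integral>\<^sup>+ w. c w \<partial>N) \<le> a1 * density_entropy (B n) (h n) + a2 * density_entropy (B n) (k n) + ennreal e" for n
    proof (rule density_te_coupling[OF te[of n] h k])
      show "0 < ennreal e" using e by simp
    qed blast
    then obtain N where N: "\<And>n. N n \<in> couplings (density (B n) (\<lambda>x. ennreal (h n x))) (density (B n) (\<lambda>x. ennreal (k n x)))"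
      and Nc: "\<And>n. (\<integral>\<^sup>+ w. c w \<partial>N n) \<le> a1 * density_entropy (B n) (h n) + a2 * density_entropy (B n) (k n) + ennreal e"
      by metis
    have C: "measure_pmf l \<bind> N \<in> couplings ?P ?Q"
      by (rule bind_pmf_couplings[where S = S, OF N prob_space_prob_density[OF h] _ _ _ _ hP kQ]) (simp_all add: B sM)
    have sN: "sets (N n) = sets (S \<Otimes>\<^sub>M S)" for n
      using N[of n] sets_pair_measure_cong[OF B(2)[of n] B(2)[of n]] by (simp add: couplings_def cong: sets_pair_measure_cong)
    have N_meas: "N \<in> measure_pmf l \<rightarrow>\<^sub>M subprob_algebra (S \<Otimes>\<^sub>M S)"
      using prob_space_couplings[OF N prob_space_prob_density[OF h]] sN
      by (auto simp: space_subprob_algebra prob_space_imp_subprob_space)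
    have "transport_cost c ?P ?Q \<le> (\<integral>\<^sup>+ w. c w \<partial>(measure_pmf l \<bind> N))"
      unfolding transport_cost_def by (rule INF_lower[OF C])
    also have "\<dots> \<le> (\<integral>\<^sup>+ n. (\<integral>\<^sup>+ w. c w \<partial>N n) \<partial>measure_pmf l)"
      by (rule nn_integral_bind_le[OF N_meas]) simp
    also have "\<dots> \<le> (\<integral>\<^sup>+ n. a1 * density_entropy (B n) (h n) + a2 * density_entropy (B n) (k n) + ennreal e \<partial>measure_pmf l)"
      by (intro nn_integral_mono Nc)
    also have "\<dots> = a1 * ?h + a2 * ?k + ennreal e"
      by (simp add: nn_integral_add nn_integral_cmult measure_pmf.emeasure_space_1[simplified])
    finally show "transport_cost c ?P ?Q \<le> a1 * ?h + a2 * ?k + ennreal e" .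
  qed
  have ratio: "density (measure_pmf \<kappa>) (\<lambda>n. ennreal (?s n)) = measure_pmf l"
    by (rule density_pmf_ratio) (rule ac)
  have s1: "(\<integral>\<^sup>+ n. ennreal (?s n) \<partial>measure_pmf \<kappa>) = 1"
  proof -
    have "(\<integral>\<^sup>+ n. ennreal (?s n) \<partial>measure_pmf \<kappa>) = emeasure (density (measure_pmf \<kappa>) (\<lambda>n. ennreal (?s n))) UNIV"
      by (simp add: emeasure_density)
    also have "\<dots> = 1" unfolding ratio by simp
    finally show ?thesis .
  qed
  have "relative_entropy (density (measure_pmf \<kappa>) (\<lambda>n. ennreal (?s n))) \<kappa> = enn2ereal (density_entropy \<kappa> ?s)"
    by (rule relative_entropy_density[OF measure_pmf.prob_space_axioms _ _ s1]) auto
  then have re: "relative_entropy l \<kappa> = enn2ereal (density_entropy \<kappa> ?s)" unfolding ratio .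
  have "transport_cost c ?P ?Q + (a1 + a2) * density_entropy \<kappa> ?s \<le> a1 * ?h + a2 * ?k + (a1 + a2) * density_entropy \<kappa> ?s"
    by (rule add_right_mono[OF T])
  also have "\<dots> = a1 * (density_entropy \<kappa> ?s + ?h) + a2 * (density_entropy \<kappa> ?s + ?k)"
    by (simp add: distrib_left distrib_right ac_simps)
  also have "\<dots> \<le> a1 * density_entropy ?B f + a2 * density_entropy ?B g"
    by (intro add_mono mult_left_mono h_ent k_ent) auto
  finally show ?thesis
    unfolding re times_ennreal.rep_eq[symmetric] plus_ennreal.rep_eq[symmetric] less_eq_ennreal.rep_eq[symmetric] .
qed

section \<open>Total mass of configurations\<close>

lemma emeasure_dirac_sum_UNIV: "emeasure (dirac_sum k a) UNIV = of_nat k"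
  by (simp add: dirac_sum_eq_distr emeasure_distr emeasure_count_space_finite)

lemma space_dirac_sum: "space (dirac_sum k a) = UNIV"
  by (simp add: dirac_sum_eq_distr)

text \<open>Match the \<open>i\<close>-th atom of one configuration with the \<open>i\<close>-th of
  the other: the diagonal coupling of counting measures, pushed forward by \<open>x\<close> and
  \<open>y\<close>.\<close>

lemma transport_cost_dirac_sum_le:
  fixes \<rho> :: "'z::topological_space \<times> 'z \<Rightarrow> ennreal"
  shows "transport_cost \<rho> (dirac_sum n x) (dirac_sum n y) \<le> (\<Sum>i<n. \<rho> (x i, y i))"
proof -
  let ?C = "count_space {..<n}"
  let ?c = "\<lambda>(i, j). \<rho> (x i, y j)"
  let ?N = "distr ?C (?C \<Otimes>\<^sub>M ?C) (\<lambda>i. (i, i))"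
  have "transport_cost \<rho> (dirac_sum n x) (dirac_sum n y) \<le> transport_cost ?c ?C ?C"
    unfolding dirac_sum_eq_distr by (intro transport_cost_distr_le) auto
  also have "\<dots> \<le> (\<integral>\<^sup>+ w. ?c w \<partial>?N)"
  proof -
    have m: "(\<lambda>i. (i, i)) \<in> ?C \<rightarrow>\<^sub>M ?C \<Otimes>\<^sub>M ?C" by measurable
    have "distr ?N ?C fst = ?C" "distr ?N ?C snd = ?C"
      by (auto simp: distr_distr[OF _ m] comp_def distr_id)
    then show ?thesis
      unfolding transport_cost_def by (intro INF_lower) (simp add: couplings_def)
  qed
  also have "\<dots> \<le> (\<integral>\<^sup>+ i. ?c (i, i) \<partial>?C)" by (rule nn_integral_distr_le) measurable
  also have "\<dots> = (\<Sum>i<n. \<rho> (x i, y i))" by (simp add: nn_integral_count_space_finite)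
  finally show ?thesis .
qed

text \<open>Natural-valued, so that its levels form a countable partition. On configurations the
  mass is an integer and rounding changes nothing; elsewhere the value carries no meaning.\<close>

definition total_mass :: "'z::topological_space measure \<Rightarrow> nat" where
  "total_mass \<eta> = nat \<lfloor>measure \<eta> UNIV\<rfloor>"

lemma total_mass_dirac_sum [simp]: "total_mass (dirac_sum n a) = n"
  by (simp add: total_mass_def measure_def emeasure_dirac_sum_UNIV enn2real_of_nat)

lemma emeasure_configuration: "\<eta> \<in> configurations \<Longrightarrow> emeasure \<eta> UNIV = of_nat (total_mass \<eta>)"
  by (auto simp: configurations_def emeasure_dirac_sum_UNIV)

text \<open>Mass is the integral of the constant 1, so a level set is the preimage of an open
  interval around \<open>n\<close>; radius 1/2 isolates \<open>n\<close> among the integers. The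
  level is thus one of the generating open sets of the weak topology.\<close>

lemma measurable_total_mass:
  "total_mass \<in> (config_space :: 'z::topological_space measure measure) \<rightarrow>\<^sub>M count_space UNIV"
  unfolding measurable_count_space_eq2_countable
proof (intro conjI ballI)
  fix n :: nat
  let ?I = "{real n - 1 / 2 <..< real n + 1 / 2}"
  let ?S = "{{\<eta> \<in> configurations. (LINT z|\<eta>. f z) \<in> U} |(f :: 'z \<Rightarrow> real) U.
        continuous_on UNIV f \<and> bounded (range f) \<and> open U}"
  have mass: "measure \<eta> (space \<eta>) = real (total_mass \<eta>)" if "\<eta> \<in> configurations" for \<eta> :: "'z measure"
    using that by (auto simp: configurations_def measure_def emeasure_dirac_sum_UNIV space_dirac_sum enn2real_of_nat)
  have "total_mass -` {n} \<inter> space config_space = {\<eta> \<in> configurations. (LINT z|\<eta>. (\<lambda>_ :: 'z. 1 :: real) z) \<in> ?I}"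
  proof -
    have "total_mass \<eta> = n \<longleftrightarrow> real (total_mass \<eta>) \<in> ?I" for \<eta> :: "'z measure" by auto
    then show ?thesis by (auto simp: space_config_space mass)
  qed
  also have "\<dots> \<in> ?S"
    by (intro CollectI exI[of _ "\<lambda>_. 1"] exI[of _ ?I]) (auto simp: image_constant_conv)
  finally have "openin config_topology (total_mass -` {n} \<inter> space (config_space :: 'z measure measure))"
    unfolding config_topology_def openin_topology_generated_by_iff by (rule generate_topology_on.Basis)
  then show "total_mass -` {n} \<inter> space (config_space :: 'z measure measure) \<in> sets config_space"
    unfolding sets_config_space by (intro sigma_sets.Basic) simp
qed simp

text \<open>A coupling has the total mass of both its marginals, so there is none here.\<close>

lemma transport_cost_total_mass_neq:
  assumes "\<xi>1 \<in> configurations" "\<xi>2 \<in> configurations" "total_mass \<xi>1 \<noteq> total_mass \<xi>2"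
  shows "transport_cost \<rho> \<xi>1 \<xi>2 = \<infinity>"
proof -
  have False if "N \<in> couplings \<xi>1 \<xi>2" for N
  proof -
    have "space \<xi>1 = UNIV" "space \<xi>2 = UNIV"
      using assms(1,2) by (auto simp: configurations_def dirac_sum_eq_distr)
    then have "emeasure \<xi>1 UNIV = emeasure \<xi>2 UNIV"
      using nn_integral_couplings(1)[OF that, of "\<lambda>_. 1"] nn_integral_couplings(2)[OF that, of "\<lambda>_. 1"] by simp
    then show False using assms by (simp add: emeasure_configuration)
  qed
  then have "couplings \<xi>1 \<xi>2 = {}" by blast
  then show ?thesis by (simp add: transport_cost_def)
qed

text \<open>On a countable type all singletons of mass 0 together form a null set, so almost every
  point is an atom.\<close>

lemma pmf_of_countable_measure:
  fixes M :: "'a::countable measure"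
  assumes "prob_space M" "sets M = UNIV"
  obtains l where "measure_pmf l = M"
proof -
  interpret prob_space M by fact
  have "(\<Union>x\<in>{x. measure M {x} = 0}. {x}) \<in> null_sets M"
    using assms(2) by (intro null_sets_UN') (auto simp: null_sets_def emeasure_eq_measure)
  then have "AE x in M. measure M {x} \<noteq> 0" by (rule AE_I') auto
  then have "measure_pmf (Abs_pmf M) = M" using assms by (intro Abs_pmf_inverse) simp
  then show ?thesis using that by blast
qed

text \<open>Under a coupling of finite cost the two masses agree almost surely, because the cost is
  infinite where they differ.\<close>

lemma common_mass_law:
  fixes \<Pi>1 \<Pi>2 :: "'z::topological_space measure measure"
  assumes \<Pi>1: "prob_space \<Pi>1" "sets \<Pi>1 = sets config_space" and \<Pi>2: "prob_space \<Pi>2" "sets \<Pi>2 = sets config_space"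
    and fin: "config_transport_cost \<rho> \<Pi>1 \<Pi>2 < \<infinity>"
  obtains l :: "nat pmf" where
    "\<And>A. emeasure \<Pi>1 {\<eta> \<in> configurations. total_mass \<eta> \<in> A} = emeasure l A"
    "\<And>A. emeasure \<Pi>2 {\<eta> \<in> configurations. total_mass \<eta> \<in> A} = emeasure l A"
proof -
  let ?c = "\<lambda>(\<xi>1, \<xi>2). transport_cost \<rho> \<xi>1 \<xi>2"
  obtain N where N: "N \<in> couplings \<Pi>1 \<Pi>2" and Nc: "(\<integral>\<^sup>+ w. ?c w \<partial>N) < \<infinity>"
    using fin unfolding config_transport_cost_def transport_cost_def[of _ \<Pi>1] INF_less_iff by blast
  have sp: "space \<Pi>1 = configurations" "space \<Pi>2 = configurations"
    using sets_eq_imp_space_eq[OF \<Pi>1(2)] sets_eq_imp_space_eq[OF \<Pi>2(2)] by (auto simp: space_config_space)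
  have tm: "total_mass \<in> \<Pi>1 \<rightarrow>\<^sub>M count_space UNIV" "total_mass \<in> \<Pi>2 \<rightarrow>\<^sub>M count_space UNIV"
    using measurable_total_mass measurable_cong_sets[OF \<Pi>1(2) refl] measurable_cong_sets[OF \<Pi>2(2) refl] by blast+
  note m = measurable_couplings[OF N]
  have tm_N: "(\<lambda>w. total_mass (fst w)) \<in> N \<rightarrow>\<^sub>M count_space UNIV" "(\<lambda>w. total_mass (snd w)) \<in> N \<rightarrow>\<^sub>M count_space UNIV"
    using measurable_compose[OF m(1) tm(1)] measurable_compose[OF m(2) tm(2)] .
  define D where "D = {w \<in> space N. total_mass (fst w) \<noteq> total_mass (snd w)}"
  have [measurable]: "D \<in> sets N"
    using borel_measurable_neq[OF measurable_compose[OF tm_N(1), of real borel] measurable_compose[OF tm_N(2), of real borel]]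
    by (simp add: D_def)
  have tm_sets: "{w \<in> space N. total_mass (fst w) \<in> A} \<in> sets N" "{w \<in> space N. total_mass (snd w) \<in> A} \<in> sets N" for A
    using measurable_sets[OF tm_N(1), of A] measurable_sets[OF tm_N(2), of A] by (simp_all add: vimage_def Int_def conj_commute)
  \<comment> \<open>Only monotonicity of the lower integral is applied to the possibly nonmeasurable
    cost; \<open>D\<close> is measurable, so the minorant is integrated exactly.\<close>
  have "\<infinity> * emeasure N D = (\<integral>\<^sup>+ w. \<infinity> * indicator D w \<partial>N)" by (simp add: nn_integral_cmult)
  also have "\<dots> \<le> (\<integral>\<^sup>+ w. ?c w \<partial>N)"
  proof (rule nn_integral_mono)
    fix w assume w: "w \<in> space N"
    show "\<infinity> * indicator D w \<le> ?c w"
    proof (cases "w \<in> D")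
      case True
      have "fst w \<in> configurations" "snd w \<in> configurations"
        using measurable_space[OF m(1) w] measurable_space[OF m(2) w] sp by auto
      then have "?c w = \<infinity>"
        using True transport_cost_total_mass_neq[of "fst w" "snd w" \<rho>] by (auto simp: D_def case_prod_beta')
      then show ?thesis by simp
    qed simp
  qed
  finally have "\<infinity> * emeasure N D < \<infinity>" using Nc by (rule order_le_less_trans)
  then have ND: "emeasure N D = 0" by (auto simp: ennreal_mult_less_top ennreal_top_mult split: if_splits)
  have eq: "emeasure \<Pi>1 (total_mass -` A \<inter> space \<Pi>1) = emeasure \<Pi>2 (total_mass -` A \<inter> space \<Pi>2)" for A
  proof -
    have "emeasure \<Pi>1 (total_mass -` A \<inter> space \<Pi>1) = emeasure N {w \<in> space N. total_mass (fst w) \<in> A}"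
    proof -
      have "emeasure \<Pi>1 (total_mass -` A \<inter> space \<Pi>1) = emeasure (distr N \<Pi>1 fst) (total_mass -` A \<inter> space \<Pi>1)"
        using N by (simp add: couplings_def)
      also have "\<dots> = emeasure N (fst -` (total_mass -` A \<inter> space \<Pi>1) \<inter> space N)"
        by (intro emeasure_distr m measurable_sets[OF tm(1)]) simp
      also have "fst -` (total_mass -` A \<inter> space \<Pi>1) \<inter> space N = {w \<in> space N. total_mass (fst w) \<in> A}"
        using measurable_space[OF m(1)] by auto
      finally show ?thesis .
    qed
    also have "\<dots> = emeasure N {w \<in> space N. total_mass (snd w) \<in> A}"
    proof (rule emeasure_eq_AE)
      have "AE w in N. w \<notin> D" using ND by (intro AE_not_in) (auto simp: null_sets_def)
      then show "AE w in N. (w \<in> {w \<in> space N. total_mass (fst w) \<in> A}) = (w \<in> {w \<in> space N. total_mass (snd w) \<in> A})"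
        by (rule eventually_mono) (auto simp: D_def)
    qed (rule tm_sets)+
    also have "\<dots> = emeasure \<Pi>2 (total_mass -` A \<inter> space \<Pi>2)"
    proof -
      have "emeasure \<Pi>2 (total_mass -` A \<inter> space \<Pi>2) = emeasure (distr N \<Pi>2 snd) (total_mass -` A \<inter> space \<Pi>2)"
        using N by (simp add: couplings_def)
      also have "\<dots> = emeasure N (snd -` (total_mass -` A \<inter> space \<Pi>2) \<inter> space N)"
        by (intro emeasure_distr m measurable_sets[OF tm(2)]) simp
      also have "snd -` (total_mass -` A \<inter> space \<Pi>2) \<inter> space N = {w \<in> space N. total_mass (snd w) \<in> A}"
        using measurable_space[OF m(2)] by auto
      finally show ?thesis ..
    qed
    finally show ?thesis .
  qed
  interpret \<Pi>1: prob_space \<Pi>1 by fact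
  obtain l :: "nat pmf" where l: "measure_pmf l = distr \<Pi>1 (count_space UNIV) total_mass"
    by (rule pmf_of_countable_measure[OF \<Pi>1.prob_space_distr[OF tm(1)]]) auto
  have l1: "emeasure \<Pi>1 (total_mass -` A \<inter> space \<Pi>1) = emeasure l A" for A
    unfolding l using tm(1) by (simp add: emeasure_distr)
  have pre: "total_mass -` A \<inter> configurations = {\<eta> \<in> configurations. total_mass \<eta> \<in> A}" for A
    by blast
  show ?thesis
  proof (rule that)
    show "emeasure \<Pi>1 {\<eta> \<in> configurations. total_mass \<eta> \<in> A} = emeasure l A" for A
      using l1[of A] unfolding sp pre .
    show "emeasure \<Pi>2 {\<eta> \<in> configurations. total_mass \<eta> \<in> A} = emeasure l A" for A
      using l1[of A] eq[of A] unfolding sp pre by simp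
  qed
qed

text \<open>The mixed binomial law is the mixture over \<open>\<kappa>\<close> of the images
  \<open>B n\<close> of the infinite product under \<open>dirac_sum n\<close>. Each
  \<open>B n\<close> sits on mass \<open>n\<close> and inherits the inequality because the
  configuration cost is at most that of matching atoms in order.\<close>

lemma density_te_mixed_binomial:
  fixes \<mu> :: "'z::polish_space measure"
  assumes \<mu>: "prob_space \<mu>" "sets \<mu> = sets borel" and \<rho>: "lower_semicontinuous \<rho>" and te: "density_te \<mu> \<rho> a1 a2"
    and f: "prob_density (mixed_binomial \<mu> \<kappa>) f" and g: "prob_density (mixed_binomial \<mu> \<kappa>) g"
    and lf: "\<And>n. emeasure (density (mixed_binomial \<mu> \<kappa>) (\<lambda>x. ennreal (f x))) {\<eta> \<in> configurations. total_mass \<eta> = n} = ennreal (pmf l n)"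
    and lg: "\<And>n. emeasure (density (mixed_binomial \<mu> \<kappa>) (\<lambda>x. ennreal (g x))) {\<eta> \<in> configurations. total_mass \<eta> = n} = ennreal (pmf l n)"
  shows "enn2ereal (config_transport_cost \<rho> (density (mixed_binomial \<mu> \<kappa>) (\<lambda>x. ennreal (f x))) (density (mixed_binomial \<mu> \<kappa>) (\<lambda>x. ennreal (g x))))
       + enn2ereal (a1 + a2) * relative_entropy l \<kappa>
     \<le> enn2ereal (a1 * density_entropy (mixed_binomial \<mu> \<kappa>) f + a2 * density_entropy (mixed_binomial \<mu> \<kappa>) g)"
proof -
  let ?S = "PiM (UNIV :: nat set) (\<lambda>_. \<mu>)"
  interpret \<mu>: prob_space \<mu> by fact
  interpret sequence_space \<mu> ..
  define B where "B n = distr ?S config_space (dirac_sum n)" for n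
  have joint: "(\<lambda>(n, x). dirac_sum n x) \<in> measure_pmf \<kappa> \<Otimes>\<^sub>M ?S \<rightarrow>\<^sub>M config_space"
    by (rule measurable_dirac_sum[OF \<mu>(2)])
  have ds: "dirac_sum n \<in> ?S \<rightarrow>\<^sub>M config_space" for n
    using measurable_compose[OF measurable_Pair1' joint, of n] by simp
  have pB: "prob_space (B n)" for n unfolding B_def by (rule P.prob_space_distr[OF ds])
  have B_meas: "B \<in> measure_pmf \<kappa> \<rightarrow>\<^sub>M subprob_algebra config_space"
    using pB by (auto simp: space_subprob_algebra prob_space_imp_subprob_space B_def)
  have mb: "mixed_binomial \<mu> \<kappa> = measure_pmf \<kappa> \<bind> B"
  proof (rule measure_eqI)
    show "sets (mixed_binomial \<mu> \<kappa>) = sets (measure_pmf \<kappa> \<bind> B)"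
      by (simp add: mixed_binomial_def sets_bind_measurable[OF B_meas])
    fix A assume "A \<in> sets (mixed_binomial \<mu> \<kappa>)"
    then have A: "A \<in> sets config_space" by (simp add: mixed_binomial_def)
    have "emeasure (mixed_binomial \<mu> \<kappa>) A = emeasure (measure_pmf \<kappa> \<Otimes>\<^sub>M ?S) ((\<lambda>(n, x). dirac_sum n x) -` A \<inter> space (measure_pmf \<kappa> \<Otimes>\<^sub>M ?S))"
      unfolding mixed_binomial_def by (rule emeasure_distr[OF joint A])
    also have "\<dots> = (\<integral>\<^sup>+ n. emeasure ?S (Pair n -` ((\<lambda>(n, x). dirac_sum n x) -` A \<inter> space (measure_pmf \<kappa> \<Otimes>\<^sub>M ?S))) \<partial>measure_pmf \<kappa>)"
      by (rule P.emeasure_pair_measure_alt[OF measurable_sets[OF joint A]])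
    also have "\<dots> = (\<integral>\<^sup>+ n. emeasure (B n) A \<partial>measure_pmf \<kappa>)"
      unfolding B_def by (intro nn_integral_cong, subst emeasure_distr[OF ds A])
        (auto intro!: arg_cong2[where f=emeasure] simp: space_pair_measure)
    also have "\<dots> = emeasure (measure_pmf \<kappa> \<bind> B) A" by (rule emeasure_bind[OF _ B_meas A, symmetric]) simp
    finally show "emeasure (mixed_binomial \<mu> \<kappa>) A = emeasure (measure_pmf \<kappa> \<bind> B) A" .
  qed
  have teB: "density_te (B n) (\<lambda>(\<xi>1, \<xi>2). transport_cost \<rho> \<xi>1 \<xi>2) a1 a2" for n
    unfolding B_def by (rule density_te_distr[OF density_te_sequence[OF \<mu> \<rho> te, of n] ds]) (simp add: transport_cost_dirac_sum_le)
  have massB: "AE x in B n. total_mass x = n" for n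
    using measurable_sets[OF measurable_total_mass, of "{n}"]
    unfolding B_def by (subst AE_distr_iff[OF ds]) (auto simp: vimage_def Int_def conj_commute)
  show ?thesis
    using f g lf lg unfolding mb config_transport_cost_def
    by (intro density_te_mixture[where S = config_space and mass = total_mass] pB massB teB measurable_total_mass)
      (auto simp: space_config_space B_def)
qed

lemma prob_space_mixed_binomial:
  fixes \<mu> :: "'z::second_countable_topology measure"
  assumes "prob_space \<mu>" "sets \<mu> = sets borel"
  shows "prob_space (mixed_binomial \<mu> \<kappa>)"
proof -
  interpret \<mu>: prob_space \<mu> by fact
  interpret sequence_space \<mu> ..
  show ?thesis unfolding mixed_binomial_def
    by (rule prob_space.prob_space_distr[OF prob_space_pair[OF prob_space_measure_pmf P.prob_space_axioms]
          measurable_dirac_sum[OF assms(2)]])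
qed

theorem theorem3p1:
  fixes \<kappa> :: "nat pmf"
    and \<mu> :: "'z::polish_space measure"
    and \<rho> :: "'z \<times> 'z \<Rightarrow> ennreal"
    and a1 a2 :: ereal
  assumes "\<mu> \<in> space (prob_algebra borel)"
    and "lower_semicontinuous \<rho>"
    and "0 < a1" and "0 < a2"
    and "transport_entropy_inequality \<rho> a1 a2 \<mu>"
  shows "\<forall>\<Pi>1 \<in> space (prob_algebra config_space). \<forall>\<Pi>2 \<in> space (prob_algebra config_space).
           config_transport_cost \<rho> \<Pi>1 \<Pi>2 < \<infinity> \<longrightarrow>
           (\<exists>l :: nat pmf.
              (\<forall>P \<in> {\<Pi>1, \<Pi>2}. \<forall>A.
                 emeasure P {\<eta> \<in> configurations. \<exists>n\<in>A. emeasure \<eta> UNIV = of_nat n} = emeasure l A) \<and>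
              enn2ereal (config_transport_cost \<rho> \<Pi>1 \<Pi>2) + (a1 + a2) * relative_entropy l \<kappa>
                \<le> a1 * relative_entropy \<Pi>1 (mixed_binomial \<mu> \<kappa>)
                  + a2 * relative_entropy \<Pi>2 (mixed_binomial \<mu> \<kappa>))"
proof (intro ballI impI)
  fix \<Pi>1 \<Pi>2 :: "'z measure measure"
  assume "\<Pi>1 \<in> space (prob_algebra config_space)" "\<Pi>2 \<in> space (prob_algebra config_space)"
    and fin: "config_transport_cost \<rho> \<Pi>1 \<Pi>2 < \<infinity>"
  then have \<Pi>1: "prob_space \<Pi>1" "sets \<Pi>1 = sets config_space" and \<Pi>2: "prob_space \<Pi>2" "sets \<Pi>2 = sets config_space"
    by (auto simp: space_prob_algebra)
  have \<mu>: "prob_space \<mu>" "sets \<mu> = sets borel" using assms(1) by (auto simp: space_prob_algebra)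
  let ?B = "mixed_binomial \<mu> \<kappa>"
  have pB: "prob_space ?B" by (rule prob_space_mixed_binomial[OF \<mu>])
  have sB: "sets ?B = sets config_space" by (simp add: mixed_binomial_def)
  obtain l :: "nat pmf" where l1: "\<And>A. emeasure \<Pi>1 {\<eta> \<in> configurations. total_mass \<eta> \<in> A} = emeasure l A"
    and l2: "\<And>A. emeasure \<Pi>2 {\<eta> \<in> configurations. total_mass \<eta> \<in> A} = emeasure l A"
    by (rule common_mass_law[OF \<Pi>1 \<Pi>2 fin]) blast
  have mass_eq: "{\<eta> \<in> configurations. \<exists>n\<in>A. emeasure \<eta> UNIV = of_nat n} = {\<eta> \<in> configurations. total_mass \<eta> \<in> A}" for A
    by (auto simp: emeasure_configuration)
  \<comment> \<open>Positive \<open>ereal\<close> constants, possibly infinite, are faithfully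
    represented in \<open>ennreal\<close>.\<close>
  define b1 b2 where "b1 = e2ennreal a1" and "b2 = e2ennreal a2"
  have b: "a1 = enn2ereal b1" "a2 = enn2ereal b2" using assms(3,4) by (simp_all add: b1_def b2_def enn2ereal_e2ennreal)
  have te: "density_te \<mu> \<rho> b1 b2" using assms(5) by (intro density_te_transport_entropy_inequality \<mu>) (simp add: b)
  have "enn2ereal (config_transport_cost \<rho> \<Pi>1 \<Pi>2) + (a1 + a2) * relative_entropy l \<kappa>
      \<le> a1 * relative_entropy \<Pi>1 ?B + a2 * relative_entropy \<Pi>2 ?B"
  \<comment> \<open>Finite entropies supply densities. Otherwise the right-hand side is infinite:
    the constants are positive, and in \<open>ereal\<close> a sum with a summand
    \<open>\<infinity>\<close> is \<open>\<infinity>\<close>.\<close>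
  proof (cases "relative_entropy \<Pi>1 ?B = \<infinity> \<or> relative_entropy \<Pi>2 ?B = \<infinity>")
    case True
    then have top: "a1 * relative_entropy \<Pi>1 ?B + a2 * relative_entropy \<Pi>2 ?B = \<infinity>" using assms(3,4) by auto
    show ?thesis unfolding top by simp
  next
    case False
    obtain f where f: "prob_density ?B f" "\<Pi>1 = density ?B (\<lambda>x. ennreal (f x))" "relative_entropy \<Pi>1 ?B = enn2ereal (density_entropy ?B f)"
      by (rule relative_entropy_finite_density[OF pB \<Pi>1(1)]) (use False \<Pi>1 sB in \<open>auto simp: prob_density_def\<close>)
    obtain g where g: "prob_density ?B g" "\<Pi>2 = density ?B (\<lambda>x. ennreal (g x))" "relative_entropy \<Pi>2 ?B = enn2ereal (density_entropy ?B g)"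
      by (rule relative_entropy_finite_density[OF pB \<Pi>2(1)]) (use False \<Pi>2 sB in \<open>auto simp: prob_density_def\<close>)
    have "enn2ereal (config_transport_cost \<rho> \<Pi>1 \<Pi>2) + enn2ereal (b1 + b2) * relative_entropy l \<kappa>
        \<le> enn2ereal (b1 * density_entropy ?B f + b2 * density_entropy ?B g)"
      unfolding f(2) g(2)
    proof (rule density_te_mixed_binomial[OF \<mu> assms(2) te f(1) g(1)])
      show "emeasure (density ?B (\<lambda>x. ennreal (f x))) {\<eta> \<in> configurations. total_mass \<eta> = n} = ennreal (pmf l n)" for n
        using l1[of "{n}"] by (simp add: f(2) emeasure_pmf_single)
      show "emeasure (density ?B (\<lambda>x. ennreal (g x))) {\<eta> \<in> configurations. total_mass \<eta> = n} = ennreal (pmf l n)" for n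
        using l2[of "{n}"] by (simp add: g(2) emeasure_pmf_single)
    qed
    then show ?thesis by (simp add: f(3) g(3) b plus_ennreal.rep_eq times_ennreal.rep_eq)
  qed
  then show "\<exists>l :: nat pmf. (\<forall>P \<in> {\<Pi>1, \<Pi>2}. \<forall>A.
        emeasure P {\<eta> \<in> configurations. \<exists>n\<in>A. emeasure \<eta> UNIV = of_nat n} = emeasure l A) \<and>
      enn2ereal (config_transport_cost \<rho> \<Pi>1 \<Pi>2) + (a1 + a2) * relative_entropy l \<kappa>
        \<le> a1 * relative_entropy \<Pi>1 ?B + a2 * relative_entropy \<Pi>2 ?B"
    using l1 l2 by (intro exI[of _ l]) (simp add: mass_eq)
qed

end
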